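(* The index transform $$(Gg)(x)=\sqrt\pi\,e^{-x/2}\int_{-\infty}^\infty\mathrm{Re}\left[I_{i\tau}\left(\frac x2\right)\right]\frac{g(\tau)\,d\tau}{\cosh(\pi\tau)},\qquad x\in\mathbb R_+,$$ is well-defined as a bounded operator $$G:L_1\left(\mathbb R;[\cosh(\pi\tau)]^{-1/2}d\tau\right)\to C(\mathbb R_+),$$ and the following norm inequality holds: $$\|Gg\|_{C(\mathbb R_+)}\le\sqrt\pi\,\|g\|_{L_1(\mathbb R;[\cosh(\pi\tau)]^{-1/2}d\tau)} .$$ Besides, if $(Gg)(x)\in L_{\nu,1}(\mathbb R_+)$, $0<\nu<1/2$, then for all $x>0$ $$\int_0^\infty\frac{(Gg)(t)}{x+t}\,dt=\sqrt\pi\,e^{x/2}\int_{-\infty}^\infty K_{i\tau}\left(\frac x2\right)\frac{g(\tau)}{\cosh(\pi\tau)}\,d\tau .$$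
   Context: $g$ is complex-valued on $\mathbb R$; $\mathbb R_+=(0,\infty)$. $C(\mathbb R_+)$ is the space of bounded continuous functions on $\mathbb R_+$ with the sup norm. $L_1(\mathbb R;w(\tau)d\tau)$ has norm $\int_{-\infty}^\infty|g(\tau)|w(\tau)d\tau$. $L_{\nu,1}(\mathbb R_+)$ is the space of functions $h$ with $\int_0^\infty|h(x)|x^{\nu-1}dx<\infty$. $I_\nu(z)=\sum_{k\ge0}\frac{(z/2)^{2k+\nu}}{k!\,\Gamma(k+\nu+1)}$ is the modified Bessel function of the first kind and $K_\nu(z)=\frac{\pi}{2\sin(\pi\nu)}[I_{-\nu}(z)-I_\nu(z)]$ is the Macdonald function (for $\nu=0$ by continuity). *)

theory Defs
  imports "HOL-Analysis.Analysis"
begin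

text \<open>Modified Bessel function of the first kind, on the principal branch of the power.
  At the poles of the Gamma function the library has \<open>Gamma z = 0\<close>, and division by zero gives
  zero, so those summands vanish, in agreement with the usual convention \<open>1 / \<Gamma> = 0\<close> there.\<close>

definition bessel_I :: "complex \<Rightarrow> complex \<Rightarrow> complex" where
  "bessel_I \<nu> z =
     (\<Sum>k. (z / 2) powr (of_nat (2 * k) + \<nu>) / (fact k * Gamma (of_nat k + \<nu> + 1)))"

text \<open>Macdonald function, with the removable singularities at integer order filled by continuity
  in the order.\<close>

definition macdonald_quotient :: "complex \<Rightarrow> complex \<Rightarrow> complex" where
  "macdonald_quotient \<nu> z =
     of_real pi / (2 * sin (of_real pi * \<nu>)) * (bessel_I (- \<nu>) z - bessel_I \<nu> z)"

definition bessel_K :: "complex \<Rightarrow> complex \<Rightarrow> complex" where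
  "bessel_K \<nu> z =
     (if \<nu> \<in> \<int> then Lim (at \<nu>) (\<lambda>\<mu>. macdonald_quotient \<mu> z) else macdonald_quotient \<nu> z)"

text \<open>The spaces below consist of functions rather than of classes modulo null sets. Functions on
  the open half line are total functions whose values outside \<open>{0<..}\<close> are ignored.\<close>

definition weighted_L1 :: "(real \<Rightarrow> real) \<Rightarrow> (real \<Rightarrow> complex) set" where
  "weighted_L1 w =
     {g \<in> borel_measurable lebesgue. integrable lebesgue (\<lambda>\<tau>. norm (g \<tau>) * w \<tau>)}"

definition weighted_L1_norm :: "(real \<Rightarrow> real) \<Rightarrow> (real \<Rightarrow> complex) \<Rightarrow> real" where
  "weighted_L1_norm w g = (LINT \<tau>|lebesgue. norm (g \<tau>) * w \<tau>)"

definition cosh_weight :: "real \<Rightarrow> real" where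
  "cosh_weight \<tau> = cosh (pi * \<tau>) powr (- 1 / 2)"

definition BC_halfline :: "(real \<Rightarrow> complex) set" where
  "BC_halfline = {f. continuous_on {0<..} f \<and> bounded (f ` {0<..})}"

definition sup_norm_halfline :: "(real \<Rightarrow> complex) \<Rightarrow> real" where
  "sup_norm_halfline f = (SUP x\<in>{0<..}. norm (f x))"

definition L_halfline :: "real \<Rightarrow> (real \<Rightarrow> complex) set" where
  "L_halfline \<nu> =
     {h. set_borel_measurable lebesgue {0<..} h \<and>
         set_integrable lebesgue {0<..} (\<lambda>x. norm (h x) * x powr (\<nu> - 1))}"

definition G_integrand :: "(real \<Rightarrow> complex) \<Rightarrow> real \<Rightarrow> real \<Rightarrow> complex" where
  "G_integrand g x \<tau> =
     of_real (Re (bessel_I (\<i> * of_real \<tau>) (of_real (x / 2)))) * (g \<tau> / of_real (cosh (pi * \<tau>)))"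

definition G_transform :: "(real \<Rightarrow> complex) \<Rightarrow> real \<Rightarrow> complex" where
  "G_transform g x =
     of_real (sqrt pi * exp (- x / 2)) * (LINT \<tau>|lebesgue. G_integrand g x \<tau>)"

end

theory Submission imports Defs begin

text \<open>
  The modulus of the reciprocal Gamma function on the line \<open>1 + i \<tau>\<close> is at most
  \<open>(cosh (pi \<tau>))^(1/2)\<close>, so \<open>I(i \<tau>, y)\<close> is dominated by \<open>(cosh (pi \<tau>))^(1/2) I(0, y)\<close>,
  and \<open>exp (-y) I(0, y)\<close> is bounded both by \<open>1\<close> and by \<open>1 / (2 y^(1/2))\<close>. The first bound gives the norm
  inequality; the second one makes the double integral of the Stieltjes transform absolutely convergent.
  After Fubini it remains to show, for real \<open>\<tau> \<noteq> 0\<close>, that the Stieltjes transform of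
  \<open>exp (-t) Re I(i \<tau>, t)\<close> at \<open>z\<close> is \<open>exp z K(i \<tau>, z)\<close>. Writing \<open>1 / (t + z)\<close> as the integral of
  \<open>exp (-(cosh \<theta> - 1) (t + z)) sinh \<theta>\<close> over \<open>\<theta> > 0\<close> reduces this to the Laplace transform
  \<open>exp (-\<nu> \<theta>) / sinh \<theta>\<close> of \<open>I(\<nu>, t)\<close> at \<open>cosh \<theta>\<close> and to the representation of \<open>K(i \<tau>, z)\<close> as the integral of
  \<open>exp (-z cosh \<theta>) cos (\<tau> \<theta>)\<close>. The latter follows from the Wronskian relations of the Bessel functions,
  whose constants are read off at the origin.
\<close>

section \<open>Modified Bessel functions of the first kind\<close>



text \<open>At imaginary order the power of y/2 oscillates at the origin, so no constant can be read
  off there from I or K directly. The power is therefore split off: \<open>bessel_red\<close> is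
  entire in a = y^2/4, its derivative is a shift of the order and its value at 0 is explicit;
  \<open>mac_int\<close> is normalised to match. With the bound 1 alone the Stieltjes integrand is
  majorised only by 1 / (t + z), which is not integrable at infinity. The bound with y^(-1/2)
  repairs this, and its singularity at the origin is integrable. The order 0 stays outside the
  kernel identity, because sin (pi \<nu>) vanishes there and K is defined by a limit; it is a single
  point in the integral over \<tau>. Since \<open>g\<close> is merely Lebesgue measurable, the last
  use of Fubini takes place on \<open>lborel \<Otimes>\<^sub>M lebesgue\<close>, with a kernel that
  is jointly Borel measurable.\<close>

definition bessel_red :: "complex \<Rightarrow> complex \<Rightarrow> complex" where
  "bessel_red \<nu> a = (\<Sum>k. rGamma (of_nat k + \<nu> + 1) / fact k * a ^ k)"

text \<open>Each use of the functional equation divides by k + \<nu> + 1, whose modulus is at least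
  its real part and hence at least k + 1. Up to the factor |1 / Gamma(\<nu> + 1)| the series is thus
  dominated by the one of order 0.\<close>

lemma norm_rGamma_shift_le:
  assumes "Re \<nu> \<ge> 0"
  shows "norm (rGamma (of_nat k + \<nu> + 1)) \<le> norm (rGamma (\<nu> + 1)) / fact k"
proof (induction k)
  case (Suc k)
  let ?z = "of_nat k + \<nu> + 1"
  have re: "real k + 1 \<le> Re ?z" using assms by simp
  also have "\<dots> \<le> norm ?z" by (rule complex_Re_le_cmod)
  finally have le: "real k + 1 \<le> norm ?z" .
  have "norm ?z * norm (rGamma (?z + 1)) = norm (rGamma ?z)"
    by (metis norm_mult rGamma_plus1)
  hence "(real k + 1) * norm (rGamma (?z + 1)) \<le> norm (rGamma ?z)"
    by (metis le mult_right_mono norm_ge_zero)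
  also have "\<dots> \<le> norm (rGamma (\<nu> + 1)) / fact k" by (rule Suc)
  finally have "norm (rGamma (?z + 1)) \<le> norm (rGamma (\<nu> + 1)) / fact k / (real k + 1)"
    by (subst pos_le_divide_eq) (auto simp: mult.commute)
  also have "\<dots> = norm (rGamma (\<nu> + 1)) / fact (Suc k)"
    by (simp add: mult.commute)
  finally show ?case
    by (simp add: add_ac)
qed simp

lemma norm_bessel_red_coeff_le:
  assumes "Re \<nu> \<ge> 0"
  shows "norm (rGamma (of_nat k + \<nu> + 1) / fact k) \<le> norm (rGamma (\<nu> + 1)) / (fact k)\<^sup>2"
  using divide_right_mono[OF norm_rGamma_shift_le[OF assms, of k], of "fact k"]
  by (simp add: norm_divide power2_eq_square)

lemma summable_norm_bessel_red:
  assumes "Re \<nu> \<ge> 0"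
  shows "summable (\<lambda>k. norm (rGamma (of_nat k + \<nu> + 1) / fact k * a ^ k))"
proof (rule summable_comparison_test')
  show "summable (\<lambda>k. norm (rGamma (\<nu> + 1)) * (inverse (fact k) * norm a ^ k))"
    by (intro summable_mult summable_exp)
  fix k :: nat assume "k \<ge> 0"
  have "norm (rGamma (of_nat k + \<nu> + 1) / fact k) \<le> norm (rGamma (\<nu> + 1)) / (fact k)\<^sup>2"
    by (rule norm_bessel_red_coeff_le[OF assms])
  also have "\<dots> \<le> norm (rGamma (\<nu> + 1)) / fact k"
    by (intro divide_left_mono) (auto simp: power2_eq_square fact_ge_1)
  finally have "norm (rGamma (of_nat k + \<nu> + 1) / fact k) \<le> norm (rGamma (\<nu> + 1)) * inverse (fact k)"
    by (simp add: divide_inverse)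
  from mult_right_mono[OF this, of "norm a ^ k"]
  show "norm (norm (rGamma (of_nat k + \<nu> + 1) / fact k * a ^ k))
      \<le> norm (rGamma (\<nu> + 1)) * (inverse (fact k) * norm a ^ k)"
    by (simp add: norm_mult norm_power mult.assoc del: norm_divide times_divide_eq_left)
qed

lemma summable_bessel_red:
  "Re \<nu> \<ge> 0 \<Longrightarrow> summable (\<lambda>k. rGamma (of_nat k + \<nu> + 1) / fact k * a ^ k)"
  by (rule summable_norm_cancel) (rule summable_norm_bessel_red)

lemma bessel_red_0 [simp]: "bessel_red \<nu> 0 = rGamma (\<nu> + 1)"
  using powser_zero[of "\<lambda>k. rGamma (of_nat k + \<nu> + 1) / fact k"] unfolding bessel_red_def by simp

text \<open>The factor k + 1 from differentiation cancels against the factorial, and the shift of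
  the index moves into the argument of Gamma as a shift of the order.\<close>

lemma has_field_derivative_bessel_red:
  assumes "Re \<nu> \<ge> 0"
  shows "(bessel_red \<nu> has_field_derivative bessel_red (\<nu> + 1) a) (at a)"
proof -
  have "diffs (\<lambda>k. rGamma (of_nat k + \<nu> + 1) / fact k) =
        (\<lambda>k. rGamma (of_nat k + (\<nu> + 1) + 1) / fact k)"
  proof
    fix k
    have "(fact (Suc k) :: complex) = of_nat (Suc k) * fact k" by (rule fact_Suc)
    thus "diffs (\<lambda>k. rGamma (of_nat k + \<nu> + 1) / fact k) k = rGamma (of_nat k + (\<nu> + 1) + 1) / fact k"
      unfolding diffs_def by (simp del: of_nat_Suc) (simp add: add_ac)
  qed
  moreover have "((\<lambda>a. \<Sum>k. rGamma (of_nat k + \<nu> + 1) / fact k * a ^ k) has_field_derivative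
     (\<Sum>k. diffs (\<lambda>k. rGamma (of_nat k + \<nu> + 1) / fact k) k * a ^ k)) (at a)"
    by (rule termdiffs_strong_converges_everywhere) (rule summable_bessel_red[OF assms])
  ultimately show ?thesis
    unfolding bessel_red_def[abs_def] by simp
qed

text \<open>This is I(\<nu>,y) - I(\<nu>+2,y) = 2 (\<nu>+1) / y I(\<nu>+1,y), freed of powers of y.
  Termwise it is 1 / Gamma(z) = z / Gamma(z + 1) with z = (\<nu> + 1) + k; the part k of the factor
  z produces the last series.\<close>

lemma bessel_red_recurrence:
  assumes "Re \<nu> \<ge> 0"
  shows "bessel_red \<nu> a = (\<nu> + 1) * bessel_red (\<nu> + 1) a + a * bessel_red (\<nu> + 2) a"
proof -
  define c where "c = (\<lambda>k. rGamma (of_nat k + \<nu> + 2) / fact k * a ^ k)"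
  have c: "c sums bessel_red (\<nu> + 1) a"
    using summable_bessel_red[of "\<nu> + 1" a] assms unfolding bessel_red_def c_def
    by (simp add: add_ac summable_sums)
  have "(\<lambda>k. a * (rGamma (of_nat k + (\<nu> + 2) + 1) / fact k * a ^ k)) sums (a * bessel_red (\<nu> + 2) a)"
    using summable_bessel_red[of "\<nu> + 2" a] assms unfolding bessel_red_def
    by (intro sums_mult summable_sums) auto
  also have "(\<lambda>k. a * (rGamma (of_nat k + (\<nu> + 2) + 1) / fact k * a ^ k)) =
     (\<lambda>k. of_nat (Suc k) * c (Suc k))"
  proof
    fix k
    have "(fact (Suc k) :: complex) = of_nat (Suc k) * fact k" by (rule fact_Suc)
    thus "a * (rGamma (of_nat k + (\<nu> + 2) + 1) / fact k * a ^ k) = of_nat (Suc k) * c (Suc k)"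
      unfolding c_def by (simp del: of_nat_Suc) (simp add: add_ac)
  qed
  finally have "(\<lambda>k. of_nat k * c k) sums (a * bessel_red (\<nu> + 2) a)"
    by (subst (asm) sums_Suc_iff) simp
  from sums_add[OF sums_mult[OF c, of "\<nu> + 1"] this]
  have "(\<lambda>k. (\<nu> + 1) * c k + of_nat k * c k) sums
     ((\<nu> + 1) * bessel_red (\<nu> + 1) a + a * bessel_red (\<nu> + 2) a)" .
  moreover have "(\<nu> + 1) * c k + of_nat k * c k = rGamma (of_nat k + \<nu> + 1) / fact k * a ^ k" for k
  proof -
    have "(of_nat k + \<nu> + 1) * rGamma (of_nat k + \<nu> + 1 + 1) = rGamma (of_nat k + \<nu> + 1)"
      by (rule rGamma_plus1)
    hence "rGamma (of_nat k + \<nu> + 1) = (of_nat k + \<nu> + 1) * rGamma (of_nat k + \<nu> + 2)"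
      by (simp add: add.assoc)
    thus ?thesis unfolding c_def by (simp add: ring_distribs add_divide_distrib mult.assoc)
  qed
  ultimately show ?thesis
    unfolding bessel_red_def[of \<nu> a] by (simp add: sums_iff)
qed

lemma bessel_I_term:
  assumes "y > 0"
  shows "(complex_of_real y / 2) powr (of_nat (2 * k) + \<nu>) / (fact k * Gamma (of_nat k + \<nu> + 1)) =
     (of_real (y / 2)) powr \<nu> * (rGamma (of_nat k + \<nu> + 1) / fact k * (of_real (y\<^sup>2 / 4)) ^ k)"
proof -
  have "(complex_of_real y / 2) powr (of_nat (2 * k) + \<nu>) =
      (complex_of_real y / 2) ^ (2 * k) * (complex_of_real y / 2) powr \<nu>"
    using assms by (subst powr_add, subst powr_nat') auto
  also have "(complex_of_real y / 2) ^ (2 * k) = of_real (y\<^sup>2 / 4) ^ k"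
    by (simp add: power_mult power_divide)
  finally have "(complex_of_real y / 2) powr (of_nat (2 * k) + \<nu>) =
      of_real (y\<^sup>2 / 4) ^ k * of_real (y / 2) powr \<nu>" by simp
  \<comment> \<open>This holds at the poles too, where Gamma z = 0 by convention and both sides
    vanish.\<close>
  moreover have "x / (fact k * Gamma z) = x * (rGamma z / fact k)" for x z :: complex
    unfolding rGamma_inverse_Gamma divide_inverse inverse_mult_distrib by (simp only: mult_ac)
  ultimately show ?thesis
    by (simp only: mult_ac)
qed

lemma bessel_I_eq_red:
  assumes "y > 0" "Re \<nu> \<ge> 0"
  shows "bessel_I \<nu> (of_real y) = of_real (y / 2) powr \<nu> * bessel_red \<nu> (of_real (y\<^sup>2 / 4))"
  unfolding bessel_I_def bessel_I_term[OF assms(1)] bessel_red_def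
  by (rule suminf_mult) (rule summable_bessel_red[OF assms(2)])

lemma continuous_on_bessel_I:
  assumes "Re \<nu> \<ge> 0"
  shows "continuous_on {0<..} (\<lambda>y. bessel_I \<nu> (of_real y))"
proof -
  have c: "continuous_on UNIV (bessel_red \<nu>)"
    using has_field_derivative_bessel_red[OF assms] 
    by (intro continuous_at_imp_continuous_on) (auto intro: DERIV_isCont)
  have "continuous_on {0<..} (\<lambda>y. of_real (y / 2) powr \<nu> * bessel_red \<nu> (of_real (y\<^sup>2 / 4)))"
    by (intro continuous_intros continuous_on_compose2[OF c]) (auto simp flip: of_real_divide)
  thus ?thesis
    by (subst continuous_on_cong[OF refl bessel_I_eq_red]) (use assms in auto)
qed

lemma borel_measurable_rGamma: "(rGamma :: complex \<Rightarrow> complex) \<in> borel_measurable borel"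
  by (intro borel_measurable_continuous_onI continuous_on_rGamma)

lemma powr_of_real_imaginary:
  "y > 0 \<Longrightarrow> complex_of_real y powr (\<i> * of_real \<tau>) = cis (\<tau> * ln y)"
  by (simp add: powr_def cis_conv_exp Ln_of_real mult_ac)

text \<open>Fubini needs measurability in both variables at once. For y > 0 the power is cis (\<tau>
  ln (y/2)), so every summand is visibly Borel; the cut-off keeps away from the other branches of
  the power.\<close>

lemma borel_measurable_bessel_I_imaginary:
  "(\<lambda>(y, \<tau>). if y > 0 then bessel_I (\<i> * complex_of_real \<tau>) (complex_of_real y) else 0)
     \<in> borel_measurable (borel \<Otimes>\<^sub>M borel)"
proof -
  note [measurable] = measurable_compose[OF _ borel_measurable_rGamma]
  have "(\<lambda>p. if fst p > 0 then cis (snd p * ln (fst p / 2)) *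
     (\<Sum>k. rGamma (of_nat k + \<i> * complex_of_real (snd p) + 1) / fact k * (of_real ((fst p)\<^sup>2 / 4)) ^ k) else 0) \<in>
      borel_measurable (borel \<Otimes>\<^sub>M borel)"
    unfolding cis_conv_exp by measurable
  also have "?this \<longleftrightarrow> ?thesis"
    by (intro measurable_cong)
       (auto simp: case_prod_unfold bessel_I_eq_red bessel_red_def powr_of_real_imaginary simp del: of_real_divide)
  finally show ?thesis .
qed


text \<open>Conjugation turns 1 + i \<tau> into 1 - i \<tau>, so the reflection formula evaluates
  the square of the left side as sinh (pi \<tau>) / (pi \<tau>). The rest is sinh x \<le> x cosh x
  for x \<ge> 0.\<close>

lemma norm_rGamma_imaginary_le:
  "norm (rGamma (\<i> * complex_of_real \<tau> + 1)) \<le> sqrt (cosh (pi * \<tau>))"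
proof (cases "\<tau> = 0")
  case False
  let ?z = "\<i> * complex_of_real \<tau>"
  \<comment> \<open>Multiplying and dividing by z^2 leads to the product of 1 / Gamma(z) and 1 /
    Gamma(-z), to which reflection applies.\<close>
  have "rGamma (?z + 1) * rGamma (- ?z + 1) = - ((?z * rGamma (?z + 1)) * (- ?z * rGamma (- ?z + 1))) / ?z\<^sup>2"
    using False by (simp add: power2_eq_square field_simps)
  also have "\<dots> = - (rGamma ?z * rGamma (- ?z)) / ?z\<^sup>2"
    by (simp only: rGamma_plus1)
  also have "\<dots> = sin (of_real pi * ?z) / (of_real pi * ?z)"
    using False by (simp add: rGamma_reflection_complex' power2_eq_square field_simps)
  also have "of_real pi * ?z = \<i> * of_real (pi * \<tau>)" by simp
  also have "sin (\<i> * of_real (pi * \<tau>)) = \<i> * of_real (sinh (pi * \<tau>))"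
    using sin_i_times[of "of_real (pi * \<tau>)"]
    by (simp add: sinh_def exp_minus scaleR_conv_of_real exp_of_real flip: of_real_mult)
  also have "\<i> * of_real (sinh (pi * \<tau>)) / (\<i> * of_real (pi * \<tau>)) = complex_of_real (sinh (pi * \<tau>) / (pi * \<tau>))"
    by simp
  finally have *: "rGamma (?z + 1) * rGamma (- ?z + 1) = of_real (sinh (pi * \<tau>) / (pi * \<tau>))" .
  have "of_real ((norm (rGamma (?z + 1)))\<^sup>2) = rGamma (?z + 1) * cnj (rGamma (?z + 1))"
    by (rule complex_norm_square)
  also have "\<dots> = of_real (sinh (pi * \<tau>) / (pi * \<tau>))"
    by (simp add: cnj_rGamma * [simplified])
  finally have "(norm (rGamma (?z + 1)))\<^sup>2 = sinh (pi * \<tau>) / (pi * \<tau>)"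
    by (simp only: of_real_eq_iff)
  also have "\<dots> \<le> cosh (pi * \<tau>)"
  proof -
    have le: "sinh x \<le> x * cosh x" if "x \<ge> 0" for x :: real
    proof -
      have "(\<lambda>x. x * cosh x - sinh x) 0 \<le> (\<lambda>x. x * cosh x - sinh x) x"
        by (rule DERIV_nonneg_imp_nondecreasing[OF that], rule exI)
           (auto intro!: derivative_eq_intros)
      thus ?thesis by simp
    qed
    have "sinh x / x \<le> cosh x" if "x \<noteq> 0" for x :: real
      using le[of x] le[of "-x"] that by (cases "x > 0") (auto simp: field_simps)
    from this[of "pi * \<tau>"] show ?thesis using False by simp
  qed
  finally show ?thesis by (rule real_le_rsqrt)
qed simp

section \<open>Growth of the modified Bessel function of order zero\<close>

definition bessel_I0 :: "real \<Rightarrow> real" where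
  "bessel_I0 y = (\<Sum>k. y ^ (2 * k) / (4 ^ k * (fact k)\<^sup>2))"

text \<open>The left side is the quotient of the k-th coefficients of I(0,y) and cosh y. Consecutive
  values have ratio (2k+1) / (2k+2), and (2k+1) (2k+3) \<le> (2k+2)^2 carries the induction. The
  square root is the source of the decay y^(-1/2).\<close>

lemma central_binomial_le:
  "fact (2 * k) / (4 ^ k * (fact k)\<^sup>2) \<le> 1 / sqrt (2 * real k + 1)"
proof (induction k)
  case (Suc k)
  let ?c = "\<lambda>k. fact (2 * k) / (4 ^ k * (fact k)\<^sup>2) :: real"
  have "?c (Suc k) = ?c k * ((2 * real k + 1) / (2 * real k + 2))"
  proof -
    have f: "fact (2 * Suc k) = (2 * real k + 2) * ((2 * real k + 1) * fact (2 * k))"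
      by (simp add: algebra_simps)
    have "fact (Suc k) = (real k + 1) * fact k" by simp
    hence g: "(4::real) ^ Suc k * (fact (Suc k))\<^sup>2 = (2 * real k + 2) * (2 * real k + 2) * (4 ^ k * (fact k)\<^sup>2)"
      by (simp add: power2_eq_square algebra_simps)
    show ?thesis unfolding f g by (simp add: mult_ac)
  qed
  also have "\<dots> \<le> 1 / sqrt (2 * real k + 1) * ((2 * real k + 1) / (2 * real k + 2))"
    by (intro mult_right_mono Suc) auto
  also have "\<dots> = sqrt (2 * real k + 1) / (2 * real k + 2)"
    by (simp add: real_div_sqrt)
  also have "\<dots> \<le> 1 / sqrt (2 * real k + 3)"
  proof -
    have "sqrt (2 * real k + 1) * sqrt (2 * real k + 3) = sqrt ((2 * real k + 1) * (2 * real k + 3))"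
      by (simp add: real_sqrt_mult)
    also have "\<dots> \<le> 2 * real k + 2"
      by (rule real_le_lsqrt) (auto simp: power2_eq_square algebra_simps)
    finally show ?thesis by (simp add: field_simps)
  qed
  finally show ?case by (simp add: algebra_simps)
qed simp

lemma bessel_I0_term_le:
  assumes "y \<ge> 0"
  shows "y ^ (2 * k) / (4 ^ k * (fact k)\<^sup>2) \<le> y ^ (2 * k) / fact (2 * k) / sqrt (2 * real k + 1)"
proof -
  have "y ^ (2 * k) / (4 ^ k * (fact k)\<^sup>2) = y ^ (2 * k) / fact (2 * k) * (fact (2 * k) / (4 ^ k * (fact k)\<^sup>2))"
    by simp
  also have "\<dots> \<le> y ^ (2 * k) / fact (2 * k) * (1 / sqrt (2 * real k + 1))"
    using assms by (intro mult_left_mono central_binomial_le) auto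
  finally show ?thesis by simp
qed

lemma cosh_sums: "(\<lambda>k. y ^ (2 * k) / fact (2 * k)) sums cosh (y :: real)"
proof -
  have "(\<lambda>n. if even n then y ^ n /\<^sub>R fact n else 0) sums cosh y"
    by (rule cosh_converges)
  hence "(\<lambda>n. (\<lambda>n. if even n then y ^ n /\<^sub>R fact n else 0) (2 * n)) sums cosh y"
    by (subst sums_mono_reindex) (auto simp: strict_mono_def elim!: evenE)
  thus ?thesis by (simp add: divide_inverse mult.commute)
qed

lemma sinh_sums: "(\<lambda>k. y ^ (2 * k + 1) / fact (2 * k + 1)) sums sinh (y :: real)"
proof -
  have "(\<lambda>n. if even n then 0 else y ^ n /\<^sub>R fact n) sums sinh y"
    by (rule sinh_converges)
  hence "(\<lambda>n. (\<lambda>n. if even n then 0 else y ^ n /\<^sub>R fact n) (2 * n + 1)) sums sinh y"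
    by (subst sums_mono_reindex) (auto simp: strict_mono_def elim!: oddE)
  thus ?thesis by (simp add: divide_inverse mult.commute del: fact_Suc)
qed

lemma bessel_I0_sums: "(\<lambda>k. y ^ (2 * k) / (4 ^ k * (fact k)\<^sup>2)) sums bessel_I0 y"
proof -
  have "summable (\<lambda>k. \<bar>y\<bar> ^ (2 * k) / (4 ^ k * (fact k)\<^sup>2))"
  proof (rule summable_comparison_test')
    show "summable (\<lambda>k. \<bar>y\<bar> ^ (2 * k) / fact (2 * k))"
      using cosh_sums by (rule sums_summable)
    fix k :: nat
    have "\<bar>y\<bar> ^ (2 * k) / (4 ^ k * (fact k)\<^sup>2) \<le> \<bar>y\<bar> ^ (2 * k) / fact (2 * k) / sqrt (2 * real k + 1)"
      by (rule bessel_I0_term_le) simp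
    also have "\<dots> \<le> \<bar>y\<bar> ^ (2 * k) / fact (2 * k) / 1"
      by (intro divide_left_mono) auto
    finally show "norm (\<bar>y\<bar> ^ (2 * k) / (4 ^ k * (fact k)\<^sup>2)) \<le> \<bar>y\<bar> ^ (2 * k) / fact (2 * k)" by simp
  qed
  thus ?thesis unfolding bessel_I0_def by (simp add: power_mult summable_sums)
qed

lemma bessel_I0_le_exp:
  assumes "y \<ge> 0" shows "bessel_I0 y \<le> exp y"
proof -
  have "bessel_I0 y \<le> cosh y"
  proof (rule sums_le[OF _ bessel_I0_sums cosh_sums])
    fix k
    have "y ^ (2 * k) / (4 ^ k * (fact k)\<^sup>2) \<le> y ^ (2 * k) / fact (2 * k) / sqrt (2 * real k + 1)"
      by (rule bessel_I0_term_le) fact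
    also have "\<dots> \<le> y ^ (2 * k) / fact (2 * k) / 1"
      using assms by (intro divide_left_mono) auto
    finally show "y ^ (2 * k) / (4 ^ k * (fact k)\<^sup>2) \<le> y ^ (2 * k) / fact (2 * k)" by simp
  qed
  also have "\<dots> \<le> exp y" using assms by (simp add: cosh_def field_simps)
  finally show ?thesis .
qed

text \<open>The AM-GM inequality \<open>1 / sqrt (2 k + 1) \<le> (1 / sqrt y + sqrt y / (2 k + 1)) / 2\<close> splits the
  majorant into the series of \<open>cosh\<close> and \<open>sinh\<close>.\<close>

lemma bessel_I0_le_exp_sqrt:
  assumes "y > 0" shows "bessel_I0 y \<le> exp y / (2 * sqrt y)"
proof -
  have "(\<lambda>k. (1 / sqrt y * (y ^ (2 * k) / fact (2 * k)) + 1 / sqrt y * (y ^ (2 * k + 1) / fact (2 * k + 1))) / 2)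
     sums ((1 / sqrt y * cosh y + 1 / sqrt y * sinh y) / 2)"
    by (intro sums_divide sums_add sums_mult cosh_sums sinh_sums)
  moreover have "y ^ (2 * k) / (4 ^ k * (fact k)\<^sup>2) \<le>
      (1 / sqrt y * (y ^ (2 * k) / fact (2 * k)) + 1 / sqrt y * (y ^ (2 * k + 1) / fact (2 * k + 1))) / 2" for k
  proof -
    define m where "m = 2 * real k + 1"
    have m: "m > 0" by (simp add: m_def)
    have "1 / sqrt m \<le> (1 / sqrt y + sqrt y / m) / 2"
    proof -
      \<comment> \<open>The fourth roots are chosen so that y cancels from the cross term 2 / sqrt
        m.\<close>
      have "0 \<le> (1 / sqrt (sqrt y) - sqrt (sqrt y) / sqrt m)\<^sup>2" by simp
      also have "\<dots> = 1 / sqrt y + sqrt y / m - 2 / sqrt m"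
        using assms m by (simp add: power2_diff power_divide)
      finally show ?thesis by simp
    qed
    have "y ^ (2 * k) / (4 ^ k * (fact k)\<^sup>2) \<le> y ^ (2 * k) / fact (2 * k) * (1 / sqrt m)"
      using bessel_I0_term_le[of y k] assms by (simp add: m_def)
    also have "\<dots> \<le> y ^ (2 * k) / fact (2 * k) * ((1 / sqrt y + sqrt y / m) / 2)"
      using assms by (intro mult_left_mono \<open>1 / sqrt m \<le> _\<close>) auto
    also have "sqrt y / m = 1 / sqrt y * (y / m)" using assms by (simp add: real_div_sqrt)
    also have "y ^ (2 * k) / fact (2 * k) * ((1 / sqrt y + 1 / sqrt y * (y / m)) / 2) =
       (1 / sqrt y * (y ^ (2 * k) / fact (2 * k)) + 1 / sqrt y * (y ^ (2 * k + 1) / (m * fact (2 * k)))) / 2"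
      using m by (simp add: field_simps)
    also have "m * fact (2 * k) = fact (2 * k + 1)"
      by (simp add: m_def algebra_simps)
    finally show ?thesis .
  qed
  ultimately have "bessel_I0 y \<le> (1 / sqrt y * cosh y + 1 / sqrt y * sinh y) / 2"
    by (intro sums_le[OF _ bessel_I0_sums])
  also have "\<dots> = (cosh y + sinh y) / (2 * sqrt y)"
    by (simp add: add_divide_distrib)
  finally show ?thesis by (simp add: cosh_plus_sinh)
qed

text \<open>At imaginary order the power of y/2 has modulus 1, so only the reduced series counts,
  and its coefficients are at most |1 / Gamma(1 + i \<tau>)| times those of order 0.\<close>

lemma norm_bessel_I_imaginary_le:
  assumes "y > 0"
  shows "norm (bessel_I (\<i> * of_real \<tau>) (of_real y)) \<le> sqrt (cosh (pi * \<tau>)) * bessel_I0 y"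
proof -
  let ?\<nu> = "\<i> * complex_of_real \<tau>"
  have "bessel_I ?\<nu> (of_real y) = cis (\<tau> * ln (y / 2)) * bessel_red ?\<nu> (of_real (y\<^sup>2 / 4))"
    using assms powr_of_real_imaginary[of "y / 2" \<tau>] by (simp add: bessel_I_eq_red)
  hence "norm (bessel_I ?\<nu> (of_real y)) = norm (bessel_red ?\<nu> (of_real (y\<^sup>2 / 4)))"
    by (simp add: norm_mult)
  also have "\<dots> \<le> sqrt (cosh (pi * \<tau>)) * bessel_I0 y"
  proof (rule norm_sums_le)
    show "(\<lambda>k. rGamma (of_nat k + ?\<nu> + 1) / fact k * of_real (y\<^sup>2 / 4) ^ k) sums bessel_red ?\<nu> (of_real (y\<^sup>2 / 4))"
      unfolding bessel_red_def by (intro summable_sums summable_bessel_red) simp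
    show "(\<lambda>k. sqrt (cosh (pi * \<tau>)) * (y ^ (2 * k) / (4 ^ k * (fact k)\<^sup>2))) sums (sqrt (cosh (pi * \<tau>)) * bessel_I0 y)"
      by (intro sums_mult bessel_I0_sums)
    fix k
    have "norm (rGamma (of_nat k + ?\<nu> + 1) / fact k) \<le> norm (rGamma (?\<nu> + 1)) / (fact k)\<^sup>2"
      by (rule norm_bessel_red_coeff_le) simp
    also have "\<dots> \<le> sqrt (cosh (pi * \<tau>)) / (fact k)\<^sup>2"
      by (intro divide_right_mono norm_rGamma_imaginary_le) auto
    finally have le: "norm (rGamma (of_nat k + ?\<nu> + 1) / fact k) \<le> sqrt (cosh (pi * \<tau>)) / (fact k)\<^sup>2" .
    have "norm (rGamma (of_nat k + ?\<nu> + 1) / fact k * complex_of_real (y\<^sup>2 / 4) ^ k) =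
        norm (rGamma (of_nat k + ?\<nu> + 1) / fact k) * norm (complex_of_real (y\<^sup>2 / 4) ^ k)"
      by (rule norm_mult)
    also have "norm (complex_of_real (y\<^sup>2 / 4) ^ k) = y ^ (2 * k) / 4 ^ k"
      by (simp add: norm_power power_divide norm_divide power_mult)
    also have "norm (rGamma (of_nat k + ?\<nu> + 1) / fact k) * (y ^ (2 * k) / 4 ^ k) \<le>
        sqrt (cosh (pi * \<tau>)) / (fact k)\<^sup>2 * (y ^ (2 * k) / 4 ^ k)"
      using assms by (intro mult_right_mono le) auto
    finally show "norm (rGamma (of_nat k + ?\<nu> + 1) / fact k * of_real (y\<^sup>2 / 4) ^ k) \<le>
        sqrt (cosh (pi * \<tau>)) * (y ^ (2 * k) / (4 ^ k * (fact k)\<^sup>2))"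
      by (simp add: mult_ac)
  qed
  finally show ?thesis .
qed


section \<open>The integral representation of the Macdonald function\<close>

text \<open>\<open>mac_int \<nu> (y^2/4)\<close> equals \<open>2 (y/2)^(-\<nu>) K(\<nu>,y)\<close>. The normalisation turns the recurrences of the
  Bessel functions into relations with coefficients affine in \<open>a\<close> and \<open>\<nu>\<close>.\<close>

definition mac_integrand :: "complex \<Rightarrow> real \<Rightarrow> real \<Rightarrow> complex" where
  "mac_integrand \<nu> a \<theta> = exp (- of_real (exp \<theta> + a * exp (- \<theta>)) - \<nu> * of_real \<theta>)"

definition mac_int :: "complex \<Rightarrow> real \<Rightarrow> complex" where
  "mac_int \<nu> a = (LINT \<theta>|lborel. mac_integrand \<nu> a \<theta>)"

lemma norm_mac_integrand:
  "norm (mac_integrand \<nu> a \<theta>) = exp (- (exp \<theta> + a * exp (- \<theta>)) - Re \<nu> * \<theta>)"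
  by (simp add: mac_integrand_def)

lemma mac_integrand_parameter:
  "mac_integrand \<nu> a \<theta> = of_real (exp (- (a * exp (- \<theta>)))) * mac_integrand \<nu> 0 \<theta>"
  by (simp add: mac_integrand_def exp_of_real[symmetric] algebra_simps flip: exp_add)

text \<open>Raising the order and differentiating in \<open>a\<close> both bring down a factor exp
  (-\<theta>), up to sign; this is why the derivatives of \<open>mac_int\<close> stay in the same
  family.\<close>

lemma mac_integrand_order:
  "mac_integrand (\<nu> + of_nat n) a \<theta> = of_real (exp (- \<theta>) ^ n) * mac_integrand \<nu> a \<theta>"
proof -
  have "complex_of_real (exp (- \<theta>) ^ n) = exp (of_real (- (of_nat n * \<theta>)))"
    by (simp add: exp_of_nat_mult[symmetric] exp_of_real del: of_real_minus of_real_mult)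
  thus ?thesis by (simp add: mac_integrand_def algebra_simps flip: exp_add)
qed

lemma continuous_mac_integrand: "isCont (mac_integrand \<nu> a) \<theta>"
  unfolding mac_integrand_def by (intro continuous_intros)

lemma borel_measurable_mac_integrand [measurable]: "mac_integrand \<nu> a \<in> borel_measurable borel"
  by (intro borel_measurable_continuous_onI continuous_at_imp_continuous_on ballI continuous_mac_integrand)

text \<open>This function serves as the majorant in all estimates of the section, including the two
  limits at the origin.\<close>

lemma integrable_exp_neg_abs: "integrable lborel (\<lambda>\<theta>. exp (- \<bar>\<theta>\<bar>) :: real)"
proof -
  have "((\<lambda>x::real. exp (- x)) \<longlongrightarrow> 0) at_top"
    by (rule filterlim_compose[OF exp_at_bot filterlim_uminus_at_bot_at_top])
  hence "((\<lambda>x::real. - exp (- x)) \<longlongrightarrow> - 0) at_top"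
    by (rule tendsto_minus)
  hence "(\<integral>\<^sup>+x. ennreal (exp (- x)) * indicator {0 ..} x \<partial>lborel) = ennreal (- 0 - - exp (- 0))"
    by (intro nn_integral_FTC_atLeast) (auto intro!: derivative_eq_intros)
  hence "integrable lborel (\<lambda>x::real. indicator {0..} x *\<^sub>R exp (- x))"
    by (intro integrableI_nonneg) (auto simp: ennreal_mult'' mult.commute ennreal_indicator)
  also have "(\<lambda>x::real. indicator {0..} x *\<^sub>R exp (- x)) = (\<lambda>x. indicator {0..} x *\<^sub>R exp (- \<bar>x\<bar>))"
    by (auto simp: indicator_def)
  finally show ?thesis
    using has_bochner_integral_even_function[of "\<lambda>x. exp (- \<bar>x\<bar>)"]
    by (auto simp: has_bochner_integral_iff)
qed

text \<open>The sum of the two exponentials exceeds \<theta>^2 / 2, and completing the square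
  absorbs any linear term. Treating the slope as |c| + 1 instead of |c| leaves the surplus
  -|\<theta>|.\<close>

lemma mac_exponent_bound:
  fixes c m :: real
  assumes "m > 0"
  shows "- (m * (exp \<theta> + exp (- \<theta>))) + c * \<theta> \<le> (\<bar>c\<bar> + 1)\<^sup>2 / (2 * m) - \<bar>\<theta>\<bar>"
proof -
  have "\<theta>\<^sup>2 / 2 \<le> exp \<bar>\<theta>\<bar>"
    using exp_lower_Taylor_quadratic[of "\<bar>\<theta>\<bar>"] by simp
  also have "\<dots> \<le> exp \<theta> + exp (- \<theta>)" by (simp add: abs_if)
  finally have "m * (\<theta>\<^sup>2 / 2) \<le> m * (exp \<theta> + exp (- \<theta>))" using assms by (intro mult_left_mono) auto
  moreover have "c * \<theta> \<le> \<bar>c\<bar> * \<bar>\<theta>\<bar>" by (metis abs_ge_self abs_mult)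
  moreover have "(\<bar>c\<bar> + 1) * \<bar>\<theta>\<bar> \<le> (\<bar>c\<bar> + 1)\<^sup>2 / (2 * m) + m * (\<theta>\<^sup>2 / 2)"
  proof -
    have "0 \<le> (m * \<bar>\<theta>\<bar> - (\<bar>c\<bar> + 1))\<^sup>2 / (2 * m)" using assms by simp
    also have "\<dots> = (m\<^sup>2 * \<theta>\<^sup>2 + (\<bar>c\<bar> + 1)\<^sup>2 - 2 * (m * \<bar>\<theta>\<bar>) * (\<bar>c\<bar> + 1)) / (2 * m)"
      by (simp only: power2_diff power_mult_distrib power2_abs)
    also have "\<dots> = (\<bar>c\<bar> + 1)\<^sup>2 / (2 * m) + m * (\<theta>\<^sup>2 / 2) - (\<bar>c\<bar> + 1) * \<bar>\<theta>\<bar>"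
      using assms by (simp add: add_divide_distrib diff_divide_distrib power2_eq_square)
    finally show ?thesis by simp
  qed
  ultimately show ?thesis by (simp add: algebra_simps)
qed

lemma norm_mac_integrand_le:
  assumes "a > 0"
  obtains C where "\<And>\<theta>. norm (mac_integrand \<nu> a \<theta>) \<le> C * exp (- \<bar>\<theta>\<bar>)"
proof
  \<comment> \<open>A common lower bound of the coefficients 1 and a of the two exponentials makes
    the exponent symmetric.\<close>
  define m where "m = min 1 a"
  have m: "m > 0" "m \<le> 1" "m \<le> a" using assms by (auto simp: m_def)
  fix \<theta> :: real
  have "m * exp \<theta> \<le> exp \<theta>" "m * exp (- \<theta>) \<le> a * exp (- \<theta>)" using m by auto
  hence "- (exp \<theta> + a * exp (- \<theta>)) - Re \<nu> * \<theta> \<le> - (m * (exp \<theta> + exp (- \<theta>))) + (- Re \<nu>) * \<theta>"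
    unfolding ring_distribs by linarith
  also have "\<dots> \<le> (\<bar>- Re \<nu>\<bar> + 1)\<^sup>2 / (2 * m) - \<bar>\<theta>\<bar>"
    by (rule mac_exponent_bound[OF m(1)])
  finally show "norm (mac_integrand \<nu> a \<theta>) \<le> exp ((\<bar>- Re \<nu>\<bar> + 1)\<^sup>2 / (2 * m)) * exp (- \<bar>\<theta>\<bar>)"
    unfolding norm_mac_integrand by (simp flip: exp_add)
qed

lemma integrable_mac_integrand:
  assumes "a > 0"
  shows "integrable lborel (mac_integrand \<nu> a)"
proof -
  obtain C where C: "\<And>\<theta>. norm (mac_integrand \<nu> a \<theta>) \<le> C * exp (- \<bar>\<theta>\<bar>)"
    using norm_mac_integrand_le[OF assms] by blast
  show ?thesis
  proof (rule Bochner_Integration.integrable_bound)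
    show "integrable lborel (\<lambda>\<theta>. C * exp (- \<bar>\<theta>\<bar>))"
      by (intro integrable_mult_right integrable_exp_neg_abs)
    show "AE \<theta> in lborel. norm (mac_integrand \<nu> a \<theta>) \<le> norm (C * exp (- \<bar>\<theta>\<bar>))"
      using C by (intro AE_I2) (smt (verit) real_norm_def)
  qed simp
qed

text \<open>A Taylor remainder in the parameter. The lower bound c for both parameters retains the
  decay exp (-c b), which keeps the remainder integrable when b = exp (-\<theta>).\<close>

lemma exp_neg_linear_error:
  fixes a b c y :: real
  assumes "b \<ge> 0" "c \<le> a" "c \<le> y"
  shows "\<bar>exp (- (y * b)) - exp (- (a * b)) + (y - a) * (b * exp (- (a * b)))\<bar> \<le> (y - a)\<^sup>2 * (b\<^sup>2 * exp (- (c * b)))"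
proof -
  define u where "u = (y - a) * b"
  have split: "exp (- (y * b)) = exp (- (a * b)) * exp (- u)"
    by (simp add: u_def algebra_simps flip: exp_add)
  have 1: "1 - u \<le> exp (- u)" using exp_ge_add_one_self[of "- u"] by simp
  have "(1 + u) * exp (- u) \<le> exp u * exp (- u)"
    using exp_ge_add_one_self[of u] by (intro mult_right_mono) auto
  hence 2: "exp (- u) - 1 + u \<le> u * (1 - exp (- u))"
    by (simp add: algebra_simps exp_minus)
  have "\<bar>exp (- (y * b)) - exp (- (a * b)) + (y - a) * (b * exp (- (a * b)))\<bar> =
      \<bar>exp (- (a * b)) * (exp (- u) - 1 + u)\<bar>"
    unfolding split by (simp add: u_def algebra_simps)
  also have "\<dots> = exp (- (a * b)) * (exp (- u) - 1 + u)" using 1 by (simp add: abs_mult)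
  also have "\<dots> \<le> exp (- (a * b)) * (u * (1 - exp (- u)))" using 2 by simp
  also have "\<dots> \<le> u\<^sup>2 * exp (- (c * b))"
  \<comment> \<open>The sign of u decides which of exp (-a b) and exp (-y b) is the larger; the
    larger one is pulled out before comparison with exp (-c b).\<close>
  proof (cases "u \<ge> 0")
    case True
    have "exp (- (a * b)) * (u * (1 - exp (- u))) \<le> exp (- (a * b)) * (u * u)"
      using True 1 by (intro mult_left_mono) auto
    also have "\<dots> \<le> exp (- (c * b)) * (u * u)"
      using assms by (intro mult_right_mono) (auto intro: mult_right_mono)
    finally show ?thesis by (simp add: power2_eq_square mult.commute)
  next
    case False
    have "exp (- (a * b)) * (u * (1 - exp (- u))) = exp (- (y * b)) * ((- u) * (1 - exp u))"
      unfolding split by (simp add: algebra_simps flip: exp_add)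
    also have "\<dots> \<le> exp (- (y * b)) * ((- u) * (- u))"
    proof -
      have "1 - exp u \<le> - u" using exp_ge_add_one_self[of u] by linarith
      thus ?thesis using False by (intro mult_left_mono) auto
    qed
    also have "\<dots> \<le> exp (- (c * b)) * ((- u) * (- u))"
      using assms by (intro mult_right_mono) (auto intro: mult_right_mono)
    finally show ?thesis by (simp add: power2_eq_square mult.commute)
  qed
  finally show ?thesis by (simp add: u_def power_mult_distrib mult_ac)
qed

text \<open>Differentiation under the integral sign by a quadratic remainder: the first-order term
  raises the order by one, and the remainder is an integral of order \<nu> + 2.\<close>

lemma has_vector_derivative_mac_int:
  assumes "a > 0"
  shows "(mac_int \<nu> has_vector_derivative - mac_int (\<nu> + 1) a) (at a)"
  unfolding has_vector_derivative_def
proof (rule has_derivativeI_sandwich[of "a / 2"])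
  \<comment> \<open>The factor b^2 of the remainder raises the order by two, and a / 2 is a lower
    bound for all parameters y within distance a / 2 of a.\<close>
  let ?K = "LINT \<theta>|lborel. norm (mac_integrand (\<nu> + 2) (a / 2) \<theta>)"
  have "((\<lambda>y. ?K * \<bar>y - a\<bar>) \<longlongrightarrow> ?K * \<bar>a - a\<bar>) (at a)"
    by (intro tendsto_intros)
  thus "((\<lambda>y. ?K * \<bar>y - a\<bar>) \<longlongrightarrow> 0) (at a)" by simp
  show "bounded_linear (\<lambda>h. h *\<^sub>R - mac_int (\<nu> + 1) a)"
    by (rule bounded_linear_scaleR_left)
  fix y assume y: "y \<noteq> a" "dist y a < a / 2"
  hence y2: "y > a / 2" by (auto simp: dist_real_def abs_if split: if_splits)
  note int [simp] = integrable_mac_integrand[OF assms] integrable_mac_integrand[of y]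
     integrable_mac_integrand[of "a / 2"]
  have y0: "y > 0" using y2 assms by linarith
  have "norm (mac_int \<nu> y - mac_int \<nu> a - (y - a) *\<^sub>R - mac_int (\<nu> + 1) a) =
     norm (LINT \<theta>|lborel. (mac_integrand \<nu> y \<theta> - mac_integrand \<nu> a \<theta>) + of_real (y - a) * mac_integrand (\<nu> + 1) a \<theta>)"
    unfolding mac_int_def using assms y0
    by (subst Bochner_Integration.integral_add, simp, simp, subst Bochner_Integration.integral_diff)
       (simp_all add: scaleR_conv_of_real)
  also have "\<dots> \<le> (LINT \<theta>|lborel. (y - a)\<^sup>2 * norm (mac_integrand (\<nu> + 2) (a / 2) \<theta>))"
  proof (rule Bochner_Integration.integral_norm_bound_integral)
    fix \<theta> :: real
    let ?b = "exp (- \<theta>)"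
    have "(mac_integrand \<nu> y \<theta> - mac_integrand \<nu> a \<theta>) + of_real (y - a) * mac_integrand (\<nu> + 1) a \<theta> =
      of_real (exp (- (y * ?b)) - exp (- (a * ?b)) + (y - a) * (?b * exp (- (a * ?b)))) * mac_integrand \<nu> 0 \<theta>"
      using mac_integrand_order[of \<nu> 1 a \<theta>] mac_integrand_parameter[of \<nu> y \<theta>] mac_integrand_parameter[of \<nu> a \<theta>]
      by (simp add: algebra_simps)
    hence "norm ((mac_integrand \<nu> y \<theta> - mac_integrand \<nu> a \<theta>) + of_real (y - a) * mac_integrand (\<nu> + 1) a \<theta>) =
      \<bar>exp (- (y * ?b)) - exp (- (a * ?b)) + (y - a) * (?b * exp (- (a * ?b)))\<bar> * norm (mac_integrand \<nu> 0 \<theta>)"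
      by (simp only: norm_mult norm_of_real)
    also have "\<dots> \<le> ((y - a)\<^sup>2 * (?b\<^sup>2 * exp (- ((a / 2) * ?b)))) * norm (mac_integrand \<nu> 0 \<theta>)"
      using y2 assms by (intro mult_right_mono exp_neg_linear_error) auto
    also have "\<dots> = (y - a)\<^sup>2 * norm (mac_integrand (\<nu> + 2) (a / 2) \<theta>)"
      using mac_integrand_order[of \<nu> 2 "a / 2" \<theta>] mac_integrand_parameter[of \<nu> "a / 2" \<theta>]
      by (simp add: norm_mult norm_power)
    finally show "norm ((mac_integrand \<nu> y \<theta> - mac_integrand \<nu> a \<theta>) + of_real (y - a) * mac_integrand (\<nu> + 1) a \<theta>)
       \<le> (y - a)\<^sup>2 * norm (mac_integrand (\<nu> + 2) (a / 2) \<theta>)" .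
  qed (use assms y0 in auto)
  also have "\<dots> = ?K * \<bar>y - a\<bar> * norm (y - a)" by (simp add: power2_eq_square)
  finally show "norm (mac_int \<nu> y - mac_int \<nu> a - (y - a) *\<^sub>R - mac_int (\<nu> + 1) a) / norm (y - a) \<le> ?K * \<bar>y - a\<bar>"
    using y by (subst pos_divide_le_eq) simp_all
qed (use assms in auto)

lemma mac_integrand_tendsto_0:
  assumes "a > 0"
  shows "(mac_integrand \<nu> a \<longlongrightarrow> 0) at_top" "(mac_integrand \<nu> a \<longlongrightarrow> 0) at_bot"
proof -
  obtain C where C: "\<And>\<theta>. norm (mac_integrand \<nu> a \<theta>) \<le> C * exp (- \<bar>\<theta>\<bar>)"
    using norm_mac_integrand_le[OF assms] by blast
  have lim: "((\<lambda>\<theta>::real. C * exp (- \<bar>\<theta>\<bar>)) \<longlongrightarrow> C * 0) F" if "filterlim (\<lambda>\<theta>::real. \<bar>\<theta>\<bar>) at_top F" for F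
    by (intro tendsto_intros filterlim_compose[OF exp_at_bot]
          filterlim_compose[OF filterlim_uminus_at_bot_at_top] that)
  have lim': "(mac_integrand \<nu> a \<longlongrightarrow> 0) F" if "filterlim (\<lambda>\<theta>::real. \<bar>\<theta>\<bar>) at_top F" for F
    by (rule Lim_null_comparison[OF always_eventually[OF allI[OF C]]]) (use lim[OF that] in simp)
  show "(mac_integrand \<nu> a \<longlongrightarrow> 0) at_top"
    by (rule lim'[OF filterlim_abs_real])
  have "filterlim (\<lambda>\<theta>::real. \<bar>\<theta>\<bar>) at_top at_bot"
    using filterlim_compose[OF filterlim_abs_real filterlim_uminus_at_top_at_bot] by simp
  thus "(mac_integrand \<nu> a \<longlongrightarrow> 0) at_bot"
    by (rule lim')
qed

text \<open>The combination \<open>d\<close> is the derivative in \<theta> of the integrand of order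
  \<nu> + 1, which vanishes at both ends, so its integral is 0. In terms of K this is K(\<nu>+2,y) -
  K(\<nu>,y) = 2 (\<nu>+1) / y K(\<nu>+1,y).\<close>

lemma mac_int_recurrence:
  assumes "a > 0"
  shows "mac_int \<nu> a = of_real a * mac_int (\<nu> + 2) a - (\<nu> + 1) * mac_int (\<nu> + 1) a"
proof -
  define d where "d \<theta> = of_real a * mac_integrand (\<nu> + 2) a \<theta> - (\<nu> + 1) * mac_integrand (\<nu> + 1) a \<theta> - mac_integrand \<nu> a \<theta>" for \<theta>
  note int = integrable_mac_integrand[OF assms]
  have "(LBINT \<theta>=-\<infinity>..\<infinity>. d \<theta>) = 0 - 0"
  proof (rule interval_integral_FTC_integrable)
    fix \<theta> :: real
    have "((\<lambda>z. exp (- (exp z + of_real a * exp (- z)) - (\<nu> + 1) * z)) has_field_derivative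
       (- (exp (of_real \<theta>) - of_real a * exp (- of_real \<theta>)) - (\<nu> + 1)) * exp (- (exp (of_real \<theta>) + of_real a * exp (- of_real \<theta>)) - (\<nu> + 1) * of_real \<theta>)) (at (of_real \<theta>))"
      by (auto intro!: derivative_eq_intros simp: algebra_simps)
    hence "((\<lambda>\<theta>. exp (- (exp (of_real \<theta>) + of_real a * exp (- of_real \<theta>)) - (\<nu> + 1) * of_real \<theta>)) has_vector_derivative
       (- (exp (of_real \<theta>) - of_real a * exp (- of_real \<theta>)) - (\<nu> + 1)) * exp (- (exp (of_real \<theta>) + of_real a * exp (- of_real \<theta>)) - (\<nu> + 1) * of_real \<theta>)) (at \<theta>)"
      by (rule has_vector_derivative_real_field)
    also have "(\<lambda>\<theta>. exp (- (exp (of_real \<theta>) + of_real a * exp (- of_real \<theta>)) - (\<nu> + 1) * of_real \<theta>)) = mac_integrand (\<nu> + 1) a"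
      by (simp add: mac_integrand_def fun_eq_iff exp_of_real[symmetric])
    also have "(- (exp (of_real \<theta>) - of_real a * exp (- of_real \<theta>)) - (\<nu> + 1)) * mac_integrand (\<nu> + 1) a \<theta>
        = (- (of_real (exp \<theta>) - of_real a * of_real (exp (- \<theta>))) - (\<nu> + 1)) * mac_integrand (\<nu> + 1) a \<theta>"
      by (simp add: mac_integrand_def exp_of_real[symmetric])
    also have "\<dots> = of_real a * (of_real (exp (- \<theta>)) * mac_integrand (\<nu> + 1) a \<theta>) - (\<nu> + 1) * mac_integrand (\<nu> + 1) a \<theta>
           - of_real (exp \<theta>) * mac_integrand (\<nu> + 1) a \<theta>"
      by (simp add: algebra_simps)
    also have "of_real (exp (- \<theta>)) * mac_integrand (\<nu> + 1) a \<theta> = mac_integrand (\<nu> + 2) a \<theta>"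
      using mac_integrand_order[of "\<nu> + 1" 1 a \<theta>] by (simp add: add.assoc)
    also have "of_real (exp \<theta>) * mac_integrand (\<nu> + 1) a \<theta> = mac_integrand \<nu> a \<theta>"
    proof -
      have "of_real (exp \<theta>) * mac_integrand (\<nu> + 1) a \<theta> = of_real (exp \<theta> * exp (- \<theta>)) * mac_integrand \<nu> a \<theta>"
        using mac_integrand_order[of \<nu> 1 a \<theta>] by (simp only: of_real_mult) simp
      thus ?thesis by (simp flip: exp_add)
    qed
    finally show "(mac_integrand (\<nu> + 1) a has_vector_derivative d \<theta>) (at \<theta>)" by (simp add: d_def)
    show "isCont d \<theta>" unfolding d_def by (intro continuous_intros continuous_mac_integrand)
  next
    show "set_integrable lborel (einterval (- \<infinity>) \<infinity>) d"
      unfolding d_def using int by (auto simp: set_integrable_def)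
    show "((mac_integrand (\<nu> + 1) a \<circ> real_of_ereal) \<longlongrightarrow> 0) (at_right (- \<infinity>))"
      "((mac_integrand (\<nu> + 1) a \<circ> real_of_ereal) \<longlongrightarrow> 0) (at_left \<infinity>)"
      using mac_integrand_tendsto_0[OF assms] by (simp_all add: ereal_tendsto_simps1)
  qed auto
  hence "(LINT \<theta>|lborel. d \<theta>) = 0"
    by (simp add: interval_lebesgue_integral_def set_lebesgue_integral_def)
  moreover have "(LINT \<theta>|lborel. d \<theta>) = of_real a * mac_int (\<nu> + 2) a - (\<nu> + 1) * mac_int (\<nu> + 1) a - mac_int \<nu> a"
    unfolding d_def mac_int_def using int by simp
  ultimately show ?thesis by simp
qed

text \<open>The substitution of ln a - \<theta> for \<theta> exchanges exp \<theta> and a exp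
  (-\<theta>). This is the symmetry K(-\<nu>,y) = K(\<nu>,y).\<close>

lemma mac_int_reflect:
  assumes "a > 0"
  shows "mac_int \<nu> a = exp (- \<nu> * of_real (ln a)) * mac_int (- \<nu>) a"
proof -
  have "mac_int \<nu> a = (LINT \<theta>|lborel. mac_integrand \<nu> a (ln a + (- 1) * \<theta>))"
    unfolding mac_int_def by (subst lborel_integral_real_affine[of "- 1" _ "ln a"]) auto
  also have "\<dots> = (LINT \<theta>|lborel. exp (- \<nu> * of_real (ln a)) * mac_integrand (- \<nu>) a \<theta>)"
  proof (intro Bochner_Integration.integral_cong refl)
    fix \<theta>
    have "exp (ln a + - 1 * \<theta>) = a * exp (- \<theta>)" "a * exp (- (ln a + - 1 * \<theta>)) = exp \<theta>"
      using assms by (simp_all add: exp_add exp_minus exp_diff divide_inverse)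
    thus "mac_integrand \<nu> a (ln a + (- 1) * \<theta>) = exp (- \<nu> * of_real (ln a)) * mac_integrand (- \<nu>) a \<theta>"
      unfolding mac_integrand_def by (simp only: flip: exp_add) (simp add: algebra_simps)
  qed
  finally show ?thesis using integrable_mac_integrand[OF assms] by (simp add: mac_int_def)
qed

section \<open>Limits of the Macdonald integrals at the origin\<close>

lemma mac_int_0:
  assumes "Re \<mu> > 0"
  shows "mac_int (- \<mu>) 0 = Gamma \<mu>" "integrable lborel (mac_integrand (- \<mu>) 0)"
proof -
  let ?f = "\<lambda>t. complex_of_real t powr (\<mu> - 1) / of_real (exp t)"
  have img: "exp ` UNIV = {0::real<..}"
    by (auto simp: image_iff) (metis exp_ln)
  \<comment> \<open>Euler's integral under t = exp \<theta>: the Jacobian raises the exponent \<mu>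
    - 1 to \<mu>.\<close>
  have eq: "(\<lambda>\<theta>. \<bar>exp \<theta>\<bar> *\<^sub>R ?f (exp \<theta>)) = mac_integrand (- \<mu>) 0"
  proof
    fix \<theta> :: real
    have "Ln (complex_of_real (exp \<theta>)) = of_real \<theta>" by (simp add: Ln_of_real)
    thus "\<bar>exp \<theta>\<bar> *\<^sub>R ?f (exp \<theta>) = mac_integrand (- \<mu>) 0 \<theta>"
      unfolding mac_integrand_def powr_def scaleR_conv_of_real
      by (simp add: exp_of_real[symmetric] exp_minus[symmetric] divide_inverse flip: exp_add)
         (simp add: algebra_simps)
  qed
  have "?f absolutely_integrable_on exp ` UNIV \<and> integral (exp ` UNIV) ?f = Gamma \<mu>"
    unfolding img using absolutely_integrable_Gamma_integral'[OF assms] Gamma_integral_complex'[OF assms]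
    by (auto simp: integral_unique)
  hence *: "(\<lambda>\<theta>. \<bar>exp \<theta>\<bar> *\<^sub>R ?f (exp \<theta>)) absolutely_integrable_on UNIV \<and>
    integral UNIV (\<lambda>\<theta>. \<bar>exp \<theta>\<bar> *\<^sub>R ?f (exp \<theta>)) = Gamma \<mu>"
    by (subst has_absolute_integral_change_of_variables_real) (auto intro!: derivative_eq_intros simp: inj_on_def)
  hence "mac_integrand (- \<mu>) 0 absolutely_integrable_on UNIV" "integral UNIV (mac_integrand (- \<mu>) 0) = Gamma \<mu>"
    unfolding eq by auto
  thus "integrable lborel (mac_integrand (- \<mu>) 0)"
    by (simp add: set_integrable_def integrable_completion)
  thus "mac_int (- \<mu>) 0 = Gamma \<mu>"
    unfolding mac_int_def using \<open>integral UNIV _ = _\<close> by (simp add: integral_lborel)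
qed

text \<open>For nonnegative \<theta> this says 2 \<theta> \<le> exp \<theta>, which follows from the
  quadratic Taylor bound; for negative \<theta> the exponential is simply dropped.\<close>

lemma mac_exponent_le: "\<theta> - exp \<theta> \<le> - \<bar>\<theta>\<bar>" for \<theta> :: real
proof (cases "\<theta> \<ge> 0")
  case True
  have "1 + \<theta> + \<theta>\<^sup>2 / 2 \<le> exp \<theta>" by (rule exp_lower_Taylor_quadratic[OF True])
  moreover have "0 \<le> (\<theta> - 1)\<^sup>2" by simp
  ultimately show ?thesis using True by (simp add: power2_eq_square algebra_simps)
qed (simp add: less_imp_le)

text \<open>The real part 1 is the case \<mu> = \<nu> + 1 with imaginary \<nu>, which fixes the
  constant of the Wronskian relation. The integrand is dominated uniformly because \<open>a\<close>
  only adds damping.\<close>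

lemma mac_int_tendsto_Gamma:
  assumes "Re \<mu> = 1"
  shows "(\<lambda>n. mac_int (- \<mu>) (1 / real (Suc n))) \<longlonglongrightarrow> Gamma \<mu>"
proof -
  have "(\<lambda>n. LINT \<theta>|lborel. mac_integrand (- \<mu>) (1 / real (Suc n)) \<theta>) \<longlonglongrightarrow> (LINT \<theta>|lborel. mac_integrand (- \<mu>) 0 \<theta>)"
  proof (rule integral_dominated_convergence)
    show "integrable lborel (\<lambda>\<theta>. exp (- \<bar>\<theta>\<bar>) :: real)" by (rule integrable_exp_neg_abs)
    show "AE \<theta> in lborel. (\<lambda>n. mac_integrand (- \<mu>) (1 / real (Suc n)) \<theta>) \<longlonglongrightarrow> mac_integrand (- \<mu>) 0 \<theta>"
    proof (rule AE_I2)
      fix \<theta>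
      have "(\<lambda>n. mac_integrand (- \<mu>) (1 / real (Suc n)) \<theta>) \<longlonglongrightarrow> exp (- of_real (exp \<theta> + 0 * exp (- \<theta>)) - (- \<mu>) * of_real \<theta>)"
        unfolding mac_integrand_def by (intro tendsto_intros LIMSEQ_Suc lim_1_over_n)
      thus "(\<lambda>n. mac_integrand (- \<mu>) (1 / real (Suc n)) \<theta>) \<longlonglongrightarrow> mac_integrand (- \<mu>) 0 \<theta>"
        by (simp only: mac_integrand_def)
    qed
    show "AE \<theta> in lborel. norm (mac_integrand (- \<mu>) (1 / real (Suc n)) \<theta>) \<le> exp (- \<bar>\<theta>\<bar>)" for n
    proof (rule AE_I2)
      fix \<theta> :: real
      have "0 \<le> exp (- \<theta>) / (1 + real n)" by simp
      thus "norm (mac_integrand (- \<mu>) (1 / real (Suc n)) \<theta>) \<le> exp (- \<bar>\<theta>\<bar>)"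
        using assms by (simp add: norm_mac_integrand)
          (use mac_exponent_le[of \<theta>] \<open>0 \<le> exp (- \<theta>) / (1 + real n)\<close> in linarith)
    qed
  qed auto
  thus ?thesis using mac_int_0[of \<mu>] assms by (simp add: mac_int_def)
qed

text \<open>At a = 0 the integrand of imaginary order no longer decays as \<theta> tends to minus
  infinity. The factor \<open>a\<close> compensates: the products tend to 0 pointwise and share an
  integrable majorant.\<close>

lemma mac_int_imaginary_tendsto:
  assumes "Re \<nu> = 0"
  shows "(\<lambda>n. of_real (1 / real (Suc n)) * mac_int \<nu> (1 / real (Suc n))) \<longlonglongrightarrow> 0"
proof -
  have "(\<lambda>n. LINT \<theta>|lborel. of_real (1 / real (Suc n)) * mac_integrand \<nu> (1 / real (Suc n)) \<theta>) \<longlonglongrightarrow> integral\<^sup>L lborel (\<lambda>\<theta>::real. 0 :: complex)"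
  proof (rule integral_dominated_convergence[where f = "\<lambda>_. 0"])
    show "integrable lborel (\<lambda>\<theta>. exp (- \<bar>\<theta>\<bar>) :: real)" by (rule integrable_exp_neg_abs)
    show "AE \<theta> in lborel. (\<lambda>n. of_real (1 / real (Suc n)) * mac_integrand \<nu> (1 / real (Suc n)) \<theta>) \<longlonglongrightarrow> (0 :: complex)"
    proof (rule AE_I2)
      fix \<theta>
      have "(\<lambda>n. of_real (1 / real (Suc n)) * mac_integrand \<nu> (1 / real (Suc n)) \<theta>) \<longlonglongrightarrow> of_real 0 * exp (- of_real (exp \<theta> + 0 * exp (- \<theta>)) - \<nu> * of_real \<theta>)"
        unfolding mac_integrand_def by (intro tendsto_intros LIMSEQ_Suc lim_1_over_n)
      thus "(\<lambda>n. of_real (1 / real (Suc n)) * mac_integrand \<nu> (1 / real (Suc n)) \<theta>) \<longlonglongrightarrow> (0 :: complex)" by simp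
    qed
    show "AE \<theta> in lborel. norm (of_real (1 / real (Suc n)) * mac_integrand \<nu> (1 / real (Suc n)) \<theta>) \<le> exp (- \<bar>\<theta>\<bar>)" for n
    proof (rule AE_I2)
      fix \<theta> :: real
      \<comment> \<open>With v = a exp (-\<theta>) the prefactor a equals v exp \<theta>. The v is
        absorbed by v exp (-v) \<le> 1, and exp \<theta> supplies the decay on the negative
        side.\<close>
      define v where "v = 1 / real (Suc n) * exp (- \<theta>)"
      have "v * exp (- v) \<le> exp v * exp (- v)"
        using exp_ge_add_one_self[of v] by (intro mult_right_mono) (linarith, simp)
      hence v: "v * exp (- v) \<le> 1" by (simp flip: exp_add)
      have "norm (of_real (1 / real (Suc n)) * mac_integrand \<nu> (1 / real (Suc n)) \<theta>) =
         1 / real (Suc n) * (exp (- exp \<theta>) * exp (- v))"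
        using assms unfolding norm_mult norm_mac_integrand v_def norm_of_real by (simp flip: exp_add)
      also have "\<dots> = (v * exp \<theta>) * (exp (- exp \<theta>) * exp (- v))"
        unfolding v_def by (simp add: exp_minus)
      also have "\<dots> = (v * exp (- v)) * exp (\<theta> - exp \<theta>)"
        by (simp add: exp_diff exp_minus divide_inverse)
      also have "\<dots> \<le> 1 * exp (- \<bar>\<theta>\<bar>)"
        using v mac_exponent_le[of \<theta>] by (intro mult_mono) (auto simp: v_def)
      finally show "norm (of_real (1 / real (Suc n)) * mac_integrand \<nu> (1 / real (Suc n)) \<theta>) \<le> exp (- \<bar>\<theta>\<bar>)"
        by (simp only: mult_1)
    qed
  qed auto
  thus ?thesis using integrable_mac_integrand[of _ \<nu>] by (simp add: mac_int_def del: of_nat_Suc)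
qed

section \<open>Wronskian relations and the identification of the integral with K\<close>

lemma has_vector_derivative_bessel_red:
  "Re \<nu> \<ge> 0 \<Longrightarrow> ((\<lambda>a. bessel_red \<nu> (of_real a)) has_vector_derivative bessel_red (\<nu> + 1) (of_real a)) (at a within S)"
  by (rule has_vector_derivative_real_field[OF has_field_derivative_bessel_red])

lemma has_vector_derivative_zero_constant:
  fixes f :: "real \<Rightarrow> 'a :: real_normed_vector"
  assumes "convex S" "\<And>x. x \<in> S \<Longrightarrow> (f has_vector_derivative 0) (at x within S)"
  shows "\<exists>c. \<forall>x\<in>S. f x = c"
  using assms by (intro has_derivative_zero_constant) (auto simp: has_vector_derivative_def)

text \<open>In terms of \<open>I\<close> and \<open>K\<close> this is the relation \<open>I(\<nu>,y) K(\<nu>+1,y) + I(\<nu>+1,y) K(\<nu>,y) = 1 / y\<close>.\<close>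

lemma mac_int_wronskian:
  assumes \<nu>: "Re \<nu> = 0" and a: "a > 0"
  shows "bessel_red \<nu> (of_real a) * mac_int (\<nu> + 1) a + bessel_red (\<nu> + 1) (of_real a) * mac_int \<nu> a =
     exp (- (\<nu> + 1) * of_real (ln a))"
proof -
  \<comment> \<open>The factor a^(\<nu>+1) makes this expression constant: the derivatives of the
    two families shift the order with opposite signs, and the two recurrences bring the order \<nu>
    + 2 down again.\<close>
  define Q where "Q a = exp ((\<nu> + 1) * of_real (ln a)) * (bessel_red \<nu> (of_real a) * mac_int (\<nu> + 1) a +
     bessel_red (\<nu> + 1) (of_real a) * mac_int \<nu> a)" for a
  have "(Q has_vector_derivative 0) (at a within {0<..})" if a: "a > 0" for a
  proof -
    define E where "E = exp ((\<nu> + 1) * of_real (ln a))"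
    have "((\<lambda>z. exp ((\<nu> + 1) * z)) has_field_derivative (\<nu> + 1) * exp ((\<nu> + 1) * of_real (ln a))) (at (of_real (ln a)))"
      by (auto intro!: derivative_eq_intros)
    hence "((\<lambda>x. exp ((\<nu> + 1) * of_real x)) has_vector_derivative (\<nu> + 1) * exp ((\<nu> + 1) * of_real (ln a))) (at (ln a))"
      by (rule has_vector_derivative_real_field)
    moreover have "(ln has_vector_derivative (1 / a)) (at a)"
      using a DERIV_ln_divide by (auto simp flip: has_real_derivative_iff_has_vector_derivative)
    ultimately have "((\<lambda>a. exp ((\<nu> + 1) * of_real (ln a))) has_vector_derivative (1 / a) *\<^sub>R ((\<nu> + 1) * E)) (at a)"
      using vector_diff_chain_at[of ln "1 / a" a "\<lambda>x. exp ((\<nu> + 1) * of_real x)"] by (simp add: o_def E_def)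
    note dE = has_vector_derivative_at_within[OF this]
    have K: "(mac_int \<mu> has_vector_derivative - mac_int (\<mu> + 1) a) (at a within {0<..})" for \<mu>
      by (rule has_vector_derivative_at_within[OF has_vector_derivative_mac_int[OF a]])
    let ?f = "\<lambda>\<mu>. bessel_red \<mu> (of_real a)" and ?h = "\<lambda>\<mu>. mac_int \<mu> a"
    have "(Q has_vector_derivative
        (E * ((?f \<nu> * - ?h (\<nu> + 1 + 1) + ?f (\<nu> + 1) * ?h (\<nu> + 1)) +
              (?f (\<nu> + 1) * - ?h (\<nu> + 1) + ?f (\<nu> + 1 + 1) * ?h \<nu>)) +
         ((1 / a) *\<^sub>R ((\<nu> + 1) * E)) * (?f \<nu> * ?h (\<nu> + 1) + ?f (\<nu> + 1) * ?h \<nu>))) (at a within {0<..})"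
      unfolding Q_def E_def using \<nu>
      by (intro has_vector_derivative_mult has_vector_derivative_add has_vector_derivative_bessel_red K dE[unfolded E_def]) auto
    also have "(E * ((?f \<nu> * - ?h (\<nu> + 1 + 1) + ?f (\<nu> + 1) * ?h (\<nu> + 1)) +
              (?f (\<nu> + 1) * - ?h (\<nu> + 1) + ?f (\<nu> + 1 + 1) * ?h \<nu>)) +
         ((1 / a) *\<^sub>R ((\<nu> + 1) * E)) * (?f \<nu> * ?h (\<nu> + 1) + ?f (\<nu> + 1) * ?h \<nu>)) =
         E / of_real a * ((of_real a * ?f (\<nu> + 2)) * ?h \<nu> - ?f \<nu> * (of_real a * ?h (\<nu> + 2)) + (\<nu> + 1) * (?f \<nu> * ?h (\<nu> + 1) + ?f (\<nu> + 1) * ?h \<nu>))"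
      using a by (simp add: scaleR_conv_of_real field_simps)
    also have "of_real a * ?f (\<nu> + 2) = ?f \<nu> - (\<nu> + 1) * ?f (\<nu> + 1)"
      using bessel_red_recurrence[of \<nu> "of_real a"] \<nu> by simp
    also have "of_real a * ?h (\<nu> + 2) = ?h \<nu> + (\<nu> + 1) * ?h (\<nu> + 1)"
      using mac_int_recurrence[OF a, of \<nu>] by simp
    also have "E / of_real a * ((?f \<nu> - (\<nu> + 1) * ?f (\<nu> + 1)) * ?h \<nu> - ?f \<nu> * (?h \<nu> + (\<nu> + 1) * ?h (\<nu> + 1)) + (\<nu> + 1) * (?f \<nu> * ?h (\<nu> + 1) + ?f (\<nu> + 1) * ?h \<nu>)) = 0"
      by (simp add: algebra_simps)
    finally show ?thesis .
  qed
  hence "\<exists>c. \<forall>a\<in>{0<..}. Q a = c"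
    by (intro has_vector_derivative_zero_constant) auto
  then obtain c where c: "\<And>a. a > 0 \<Longrightarrow> Q a = c" by auto
  \<comment> \<open>Reflection replaces the order \<nu> + 1, whose integral is unbounded at the
    origin, by -(\<nu> + 1), whose limit is Gamma(\<nu> + 1). In the second summand the power
    a^\<nu> has modulus 1 and the spare factor a forces the limit 0.\<close>
  have Q: "Q a = bessel_red \<nu> (of_real a) * mac_int (- (\<nu> + 1)) a +
      exp (\<nu> * of_real (ln a)) * (bessel_red (\<nu> + 1) (of_real a) * (of_real a * mac_int \<nu> a))" if a: "a > 0" for a
  proof -
    have "exp ((\<nu> + 1) * of_real (ln a)) = exp (\<nu> * of_real (ln a)) * of_real a"
      using a by (simp add: ring_distribs exp_add exp_of_real)
    moreover have "exp ((\<nu> + 1) * of_real (ln a)) * mac_int (\<nu> + 1) a = mac_int (- (\<nu> + 1)) a"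
      unfolding mac_int_reflect[OF a, of "\<nu> + 1"] mult.assoc[symmetric] exp_add[symmetric] by (simp add: algebra_simps)
    ultimately show ?thesis unfolding Q_def by (simp add: algebra_simps)
  qed
  have cont: "isCont (bessel_red \<mu>) 0" if "Re \<mu> \<ge> 0" for \<mu>
    using has_field_derivative_bessel_red[OF that] by (rule DERIV_isCont)
  \<comment> \<open>As Q is constant, one sequence tending to 0 determines its value.\<close>
  have "(\<lambda>n. complex_of_real (1 / real (Suc n))) \<longlonglongrightarrow> of_real 0"
    by (intro tendsto_of_real LIMSEQ_Suc lim_1_over_n)
  hence lim: "(\<lambda>n. bessel_red \<mu> (of_real (1 / real (Suc n)))) \<longlonglongrightarrow> rGamma (\<mu> + 1)" if "Re \<mu> \<ge> 0" for \<mu>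
    using isCont_tendsto_compose[OF cont[OF that]] by simp
  have "(\<lambda>n. exp (\<nu> * of_real (ln (1 / real (Suc n)))) * (bessel_red (\<nu> + 1) (of_real (1 / real (Suc n))) *
      (of_real (1 / real (Suc n)) * mac_int \<nu> (1 / real (Suc n))))) \<longlonglongrightarrow> 0"
  proof (rule tendsto_norm_zero_cancel)
    have "(\<lambda>n. norm (bessel_red (\<nu> + 1) (of_real (1 / real (Suc n))) *
      (of_real (1 / real (Suc n)) * mac_int \<nu> (1 / real (Suc n))))) \<longlonglongrightarrow> norm (rGamma (\<nu> + 1 + 1) * 0)"
      using \<nu> by (intro tendsto_norm tendsto_mult lim mac_int_imaginary_tendsto) auto
    thus "(\<lambda>n. norm (exp (\<nu> * of_real (ln (1 / real (Suc n)))) * (bessel_red (\<nu> + 1) (of_real (1 / real (Suc n))) *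
      (of_real (1 / real (Suc n)) * mac_int \<nu> (1 / real (Suc n)))))) \<longlonglongrightarrow> 0"
      unfolding norm_mult[of "exp _"] using \<nu> by simp
  qed
  moreover have "(\<lambda>n. mac_int (- (\<nu> + 1)) (1 / real (Suc n))) \<longlonglongrightarrow> Gamma (\<nu> + 1)"
    by (rule mac_int_tendsto_Gamma) (use \<nu> in simp)
  ultimately have "(\<lambda>n. Q (1 / real (Suc n))) \<longlonglongrightarrow> rGamma (\<nu> + 1) * Gamma (\<nu> + 1) + 0"
    using \<nu> by (subst Q, simp) (intro tendsto_add tendsto_mult lim; simp)
  moreover have "(\<lambda>n. Q (1 / real (Suc n))) = (\<lambda>_. c)" by (auto simp: c)
  ultimately have "c = rGamma (\<nu> + 1) * Gamma (\<nu> + 1)"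
    by (simp add: LIMSEQ_const_iff)
  also have "\<dots> = 1"
  proof -
    have "\<nu> + 1 \<notin> \<int>\<^sub>\<le>\<^sub>0" using \<nu> by (auto elim!: nonpos_Ints_cases simp: complex_eq_iff)
    thus ?thesis by (simp add: rGamma_inverse_Gamma Gamma_eq_zero_iff)
  qed
  finally have "Q a = 1" using c[OF a] by simp
  moreover have "exp (- (\<nu> + 1) * of_real (ln a)) * exp ((\<nu> + 1) * of_real (ln a)) = 1"
    unfolding exp_add[symmetric] by (simp add: algebra_simps)
  hence "exp (- (\<nu> + 1) * of_real (ln a)) * Q a = bessel_red \<nu> (of_real a) * mac_int (\<nu> + 1) a +
      bessel_red (\<nu> + 1) (of_real a) * mac_int \<nu> a"
    unfolding Q_def by (simp flip: mult.assoc)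
  ultimately show ?thesis by simp
qed

text \<open>This is y / 2 times the Wronskian of I(\<nu>,y) and I(-\<nu>,y). All functions involved
  are entire in a, so the constant is the value at a = 0, where only the first summand survives and
  reflection gives the sine.\<close>

lemma bessel_red_wronskian:
  assumes \<nu>: "Re \<nu> = 0"
  shows "- \<nu> * bessel_red \<nu> a * bessel_red (- \<nu>) a + a * bessel_red \<nu> a * bessel_red (1 - \<nu>) a
     - a * bessel_red (- \<nu>) a * bessel_red (\<nu> + 1) a = - sin (of_real pi * \<nu>) / of_real pi"
proof -
  let ?f = bessel_red
  define R where "R a = - \<nu> * (?f \<nu> a * ?f (- \<nu>) a) + a * (?f \<nu> a * ?f (- \<nu> + 1) a) - a * (?f (- \<nu>) a * ?f (\<nu> + 1) a)" for a
  have "(R has_field_derivative 0) (at a within UNIV)" for a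
  proof -
    have rec: "a * ?f (\<nu> + 1 + 1) a = ?f \<nu> a - (\<nu> + 1) * ?f (\<nu> + 1) a"
      "a * ?f (- \<nu> + 1 + 1) a = ?f (- \<nu>) a - (- \<nu> + 1) * ?f (- \<nu> + 1) a"
      using bessel_red_recurrence[of \<nu> a] bessel_red_recurrence[of "- \<nu>" a] \<nu> by (simp_all add: add.assoc)
    have "(R has_field_derivative
       (- \<nu> * (?f (\<nu> + 1) a * ?f (- \<nu>) a + ?f (- \<nu> + 1) a * ?f \<nu> a)
       + (1 * (?f \<nu> a * ?f (- \<nu> + 1) a) + (?f (\<nu> + 1) a * ?f (- \<nu> + 1) a + ?f (- \<nu> + 1 + 1) a * ?f \<nu> a) * a)
       - (1 * (?f (- \<nu>) a * ?f (\<nu> + 1) a) + (?f (- \<nu> + 1) a * ?f (\<nu> + 1) a + ?f (\<nu> + 1 + 1) a * ?f (- \<nu>) a) * a))) (at a within UNIV)"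
      unfolding R_def using \<nu>
      by (intro DERIV_diff DERIV_add DERIV_cmult DERIV_mult DERIV_ident has_field_derivative_bessel_red) auto
    also have "(- \<nu> * (?f (\<nu> + 1) a * ?f (- \<nu>) a + ?f (- \<nu> + 1) a * ?f \<nu> a)
       + (1 * (?f \<nu> a * ?f (- \<nu> + 1) a) + (?f (\<nu> + 1) a * ?f (- \<nu> + 1) a + ?f (- \<nu> + 1 + 1) a * ?f \<nu> a) * a)
       - (1 * (?f (- \<nu>) a * ?f (\<nu> + 1) a) + (?f (- \<nu> + 1) a * ?f (\<nu> + 1) a + ?f (\<nu> + 1 + 1) a * ?f (- \<nu>) a) * a)) =
       - \<nu> * (?f (\<nu> + 1) a * ?f (- \<nu>) a + ?f (- \<nu> + 1) a * ?f \<nu> a) + ?f \<nu> a * ?f (- \<nu> + 1) a - ?f (- \<nu>) a * ?f (\<nu> + 1) a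
       + (a * ?f (- \<nu> + 1 + 1) a) * ?f \<nu> a - (a * ?f (\<nu> + 1 + 1) a) * ?f (- \<nu>) a"
      by (simp add: algebra_simps)
    also have "\<dots> = 0" unfolding rec by (simp add: algebra_simps)
    finally show ?thesis .
  qed
  hence "\<exists>c. \<forall>a\<in>UNIV. R a = c" by (intro has_field_derivative_zero_constant) auto
  hence "R a = R 0" by auto
  also have "\<dots> = - (\<nu> * rGamma (\<nu> + 1)) * rGamma (1 - \<nu>)"
    by (simp add: R_def)
  also have "\<dots> = - sin (of_real pi * \<nu>) / of_real pi"
    unfolding rGamma_plus1 using rGamma_reflection_complex[of \<nu>] by simp
  finally show ?thesis by (simp add: R_def mult.assoc add.commute)
qed

text \<open>The Wronskian relation holds for \<nu> and for -\<nu>. Reflection and recurrence express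
  the integrals of orders -\<nu> and 1 - \<nu> through those of orders \<nu> and \<nu> + 1, which
  leaves two linear equations in two unknowns.\<close>

lemma mac_int_eq_bessel_red:
  assumes \<nu>: "Re \<nu> = 0" "sin (of_real pi * \<nu>) \<noteq> 0" and a: "a > 0"
  shows "mac_int \<nu> a = of_real pi / sin (of_real pi * \<nu>) *
    (exp (- \<nu> * of_real (ln a)) * bessel_red (- \<nu>) (of_real a) - bessel_red \<nu> (of_real a))"
proof -
  let ?f = "\<lambda>\<mu>. bessel_red \<mu> (of_real a)" and ?h = "\<lambda>\<mu>. mac_int \<mu> a" and ?a = "of_real a"
  define p where "p = exp (\<nu> * of_real (ln a))"
  have p: "p \<noteq> 0" "exp (- \<nu> * of_real (ln a)) = 1 / p" by (simp_all add: p_def exp_minus divide_inverse)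
  have pa: "exp (- (\<nu> + 1) * of_real (ln a)) = 1 / (p * ?a)" "exp (- (- \<nu> + 1) * of_real (ln a)) = p / ?a"
    using a by (simp_all add: p_def ring_distribs exp_add exp_diff exp_minus exp_of_real field_simps)
  have w1: "?f \<nu> * (?a * ?h (\<nu> + 1)) + ?a * ?f (\<nu> + 1) * ?h \<nu> = 1 / p"
    using mac_int_wronskian[OF \<nu>(1) a] a p(1) unfolding pa by (simp add: field_simps)
  have h1: "?h (- \<nu>) = p * ?h \<nu>" using mac_int_reflect[OF a, of "- \<nu>"] by (simp add: p_def)
  have "?h (- \<nu> + 1) = exp (- (- \<nu> + 1) * of_real (ln a)) * ?h (\<nu> - 1)"
    using mac_int_reflect[OF a, of "- \<nu> + 1"] by simp
  also have "?h (\<nu> - 1) = ?a * ?h (\<nu> + 1) - \<nu> * ?h \<nu>"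
    using mac_int_recurrence[OF a, of "\<nu> - 1"] by (simp add: add.commute)
  finally have h2: "?h (- \<nu> + 1) = p / ?a * (?a * ?h (\<nu> + 1) - \<nu> * ?h \<nu>)" unfolding pa .
  have "?f (- \<nu>) * (p / ?a * (?a * ?h (\<nu> + 1) - \<nu> * ?h \<nu>)) + ?f (- \<nu> + 1) * (p * ?h \<nu>) = p / ?a"
    using mac_int_wronskian[of "- \<nu>", OF _ a] \<nu>(1) unfolding h1 h2 pa by simp
  hence "p / ?a * (?f (- \<nu>) * (?a * ?h (\<nu> + 1) - \<nu> * ?h \<nu>) + ?a * ?f (- \<nu> + 1) * ?h \<nu>) = p / ?a * 1"
    using a by (simp add: field_simps)
  hence w2: "?f (- \<nu>) * (?a * ?h (\<nu> + 1) - \<nu> * ?h \<nu>) + ?a * ?f (1 - \<nu>) * ?h \<nu> = 1"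
    using a p(1) by (subst (asm) mult_left_cancel) auto
  \<comment> \<open>Cramer's rule: eliminating the order \<nu> + 1 leaves the Wronskian of the two I
    functions as the determinant, nonzero by assumption.\<close>
  have "?h \<nu> * (- sin (of_real pi * \<nu>) / of_real pi) =
     ?f \<nu> * (?f (- \<nu>) * (?a * ?h (\<nu> + 1) - \<nu> * ?h \<nu>) + ?a * ?f (1 - \<nu>) * ?h \<nu>)
     - ?f (- \<nu>) * (?f \<nu> * (?a * ?h (\<nu> + 1)) + ?a * ?f (\<nu> + 1) * ?h \<nu>)"
    unfolding bessel_red_wronskian[OF \<nu>(1), of ?a, symmetric] by (simp add: algebra_simps)
  also have "\<dots> = ?f \<nu> - ?f (- \<nu>) / p" unfolding w1 w2 by simp
  finally show ?thesis using \<nu>(2) p unfolding p(2) by (simp add: field_simps)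
qed

lemma sin_pi_imaginary_nonzero:
  assumes "\<tau> \<noteq> 0" shows "sin (of_real pi * (\<i> * of_real \<tau>)) \<noteq> 0"
proof
  assume "sin (of_real pi * (\<i> * of_real \<tau>)) = 0"
  then obtain n where "complex_of_real pi * (\<i> * of_real \<tau>) = of_real (of_int n * pi)"
    by (auto simp: sin_eq_0)
  thus False using assms by (auto simp: complex_eq_iff)
qed

lemma imaginary_in_Ints_iff: "\<i> * complex_of_real \<tau> \<in> \<int> \<longleftrightarrow> \<tau> = 0"
  by (auto elim!: Ints_cases simp: complex_eq_iff)

text \<open>The order 0 is excluded so that the defining quotient of K applies. Passing to the half
  line accounts for the factor 2 in the normalisation of \<open>mac_int\<close>.\<close>

lemma bessel_K_imaginary:
  assumes \<tau>: "\<tau> \<noteq> 0" and y: "y > 0"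
  shows "bessel_K (\<i> * of_real \<tau>) (of_real y) =
    (LINT \<theta>:{0<..}|lborel. of_real (exp (- y * cosh \<theta>) * cos (\<tau> * \<theta>)))"
proof -
  let ?\<nu> = "\<i> * complex_of_real \<tau>" and ?a = "y\<^sup>2 / 4"
  define E where "E \<theta> = complex_of_real (exp (- y * cosh \<theta>) * cos (\<tau> * \<theta>))" for \<theta>
  have a: "?a > 0" using y by simp
  have lna: "ln ?a = 2 * ln (y / 2)"
    using y ln_realpow[of "y / 2" 2] by (simp add: power_divide)
  \<comment> \<open>Shifting \<theta> by ln (y/2) balances the two exponentials into y cosh
    \<theta>; the prefactor cancels the phase caused by the shift.\<close>
  define F where "F \<theta> = exp (?\<nu> * of_real (ln (y / 2))) * mac_integrand ?\<nu> ?a (ln (y / 2) + 1 * \<theta>)" for \<theta>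
  have F: "F \<theta> = of_real (exp (- y * cosh \<theta>)) * cis (- (\<tau> * \<theta>))" for \<theta>
  proof -
    have e: "exp (ln (y / 2) + 1 * \<theta>) = y / 2 * exp \<theta>" "?a * exp (- (ln (y / 2) + 1 * \<theta>)) = y / 2 * exp (- \<theta>)"
      using y by (simp_all add: exp_add exp_diff exp_minus field_simps power2_eq_square)
    have "exp (ln (y / 2) + 1 * \<theta>) + ?a * exp (- (ln (y / 2) + 1 * \<theta>)) = y * cosh \<theta>"
      unfolding e by (simp add: cosh_def algebra_simps)
    hence "F \<theta> = exp (?\<nu> * of_real (ln (y / 2)) + (- of_real (y * cosh \<theta>) - ?\<nu> * of_real (ln (y / 2) + 1 * \<theta>)))"
      unfolding F_def mac_integrand_def by (simp only: exp_add)
    also have "?\<nu> * of_real (ln (y / 2)) + (- of_real (y * cosh \<theta>) - ?\<nu> * of_real (ln (y / 2) + 1 * \<theta>)) =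
       of_real (- y * cosh \<theta>) + \<i> * of_real (- (\<tau> * \<theta>))"
      by (simp add: algebra_simps)
    finally show ?thesis by (simp only: exp_add cis_conv_exp exp_of_real)
  qed
  have intF: "integrable lborel F"
    unfolding F_def using integrable_mac_integrand[OF a, of ?\<nu>]
    by (intro integrable_mult_right lborel_integrable_real_affine) auto
  have intF': "integrable lborel (\<lambda>\<theta>. F (- \<theta>))"
    using lborel_integrable_real_affine[OF intF, of "- 1" 0] by simp
  \<comment> \<open>Averaging over \<theta> and -\<theta> turns the phase into the cosine.\<close>
  have E: "E \<theta> = (F \<theta> + F (- \<theta>)) / 2" for \<theta>
    by (simp add: E_def F complex_eq_iff)
  have intE: "integrable lborel E" unfolding E using intF intF' by auto
  hence E0: "integrable lborel (\<lambda>\<theta>. indicator {0..} \<theta> *\<^sub>R E \<theta>)"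
    by (intro integrable_mult_indicator) auto
  have ae: "AE \<theta> in lborel. indicator {0<..} \<theta> *\<^sub>R E \<theta> = indicator {0..} \<theta> *\<^sub>R E \<theta>"
    using AE_lborel_singleton[of "0::real"] by eventually_elim (auto simp: indicator_def)
  have "(LINT \<theta>|lborel. E \<theta>) = 2 *\<^sub>R (LINT \<theta>|lborel. indicator {0..} \<theta> *\<^sub>R E \<theta>)"
    by (rule has_bochner_integral_integral_eq[OF has_bochner_integral_even_function])
       (use has_bochner_integral_integrable[OF E0] in \<open>auto simp: E_def\<close>)
  also have "(LINT \<theta>|lborel. indicator {0..} \<theta> *\<^sub>R E \<theta>) = (LINT \<theta>:{0<..}|lborel. E \<theta>)"
    unfolding set_lebesgue_integral_def using ae borel_measurable_integrable[OF intE]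
    by (intro integral_cong_AE[symmetric]) auto
  finally have half: "(LINT \<theta>:{0<..}|lborel. E \<theta>) = (LINT \<theta>|lborel. E \<theta>) / 2" by (simp add: scaleR_conv_of_real)
  have "(LINT \<theta>|lborel. F (- \<theta>)) = (LINT \<theta>|lborel. F \<theta>)"
    using lborel_integral_real_affine[of "- 1" F 0] by simp
  hence "(LINT \<theta>|lborel. E \<theta>) = (LINT \<theta>|lborel. F \<theta>)"
    unfolding E using intF intF' by simp
  also have "\<dots> = exp (?\<nu> * of_real (ln (y / 2))) * (LINT \<theta>|lborel. mac_integrand ?\<nu> ?a (ln (y / 2) + 1 * \<theta>))"
    unfolding F_def by (rule integral_mult_right_zero)
  also have "(LINT \<theta>|lborel. mac_integrand ?\<nu> ?a (ln (y / 2) + 1 * \<theta>)) = mac_int ?\<nu> ?a"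
    unfolding mac_int_def by (subst (2) lborel_integral_real_affine[of 1 _ "ln (y / 2)"]) auto
  also have "\<dots> = of_real pi / sin (of_real pi * ?\<nu>) *
    (exp (- ?\<nu> * of_real (ln ?a)) * bessel_red (- ?\<nu>) (of_real ?a) - bessel_red ?\<nu> (of_real ?a))"
    by (rule mac_int_eq_bessel_red) (use sin_pi_imaginary_nonzero[OF \<tau>] a in auto)
  finally have EE: "(LINT \<theta>|lborel. E \<theta>) = exp (?\<nu> * of_real (ln (y / 2))) * (of_real pi / sin (of_real pi * ?\<nu>) *
    (exp (- ?\<nu> * of_real (ln ?a)) * bessel_red (- ?\<nu>) (of_real ?a) - bessel_red ?\<nu> (of_real ?a)))" .
  also have "\<dots> = of_real pi / sin (of_real pi * ?\<nu>) *
    ((exp (?\<nu> * of_real (ln (y / 2))) * exp (- ?\<nu> * of_real (ln ?a))) * bessel_red (- ?\<nu>) (of_real ?a) - exp (?\<nu> * of_real (ln (y / 2))) * bessel_red ?\<nu> (of_real ?a))"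
    by (simp add: algebra_simps)
  also have "exp (?\<nu> * of_real (ln (y / 2))) * exp (- ?\<nu> * of_real (ln ?a)) = exp (- ?\<nu> * of_real (ln (y / 2)))"
    unfolding lna exp_add[symmetric] by (simp add: algebra_simps)
  also have "exp (- ?\<nu> * of_real (ln (y / 2))) = complex_of_real (y / 2) powr (- ?\<nu>)"
    using y by (simp add: powr_def Ln_of_real del: of_real_divide)
  also have "exp (?\<nu> * of_real (ln (y / 2))) = complex_of_real (y / 2) powr ?\<nu>"
    using y by (simp add: powr_def Ln_of_real del: of_real_divide)
  finally have "(LINT \<theta>|lborel. E \<theta>) = of_real pi / sin (of_real pi * ?\<nu>) * (bessel_I (- ?\<nu>) (of_real y) - bessel_I ?\<nu> (of_real y))"
    using y by (simp add: bessel_I_eq_red del: of_real_divide)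
  hence "(LINT \<theta>|lborel. E \<theta>) / 2 = bessel_K ?\<nu> (of_real y)"
    using \<tau> by (simp add: bessel_K_def macdonald_quotient_def imaginary_in_Ints_iff)
  thus "bessel_K ?\<nu> (of_real y) = (LINT \<theta>:{0<..}|lborel. of_real (exp (- y * cosh \<theta>) * cos (\<tau> * \<theta>)))"
    using half by (simp add: E_def)
qed


section \<open>The Laplace transform of the Bessel function\<close>

lemma has_bochner_integral_Gamma_scaled:
  assumes z: "Re z > 0" and s: "s > 0"
  shows "has_bochner_integral lborel (\<lambda>t. indicator {0<..} t *\<^sub>R (of_real t powr (z - 1) * of_real (exp (- (s * t))))) (Gamma z / of_real s powr z)"
proof -
  let ?f = "\<lambda>t. indicator {0<..} t *\<^sub>R (complex_of_real t powr (z - 1) * of_real (exp (- t)))"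
  have ab: "(\<lambda>t. complex_of_real t powr (z - 1) / of_real (exp t)) absolutely_integrable_on {0<..}"
    by (rule absolutely_integrable_Gamma_integral'[OF z])
  have eq: "(\<lambda>t. indicator {0<..} t *\<^sub>R (complex_of_real t powr (z - 1) / of_real (exp t))) = ?f"
    by (simp add: fun_eq_iff exp_minus divide_inverse)
  have meas: "?f \<in> borel_measurable borel"
  proof -
    have "(\<lambda>t. if t > 0 then exp ((z - 1) * of_real (ln t)) * complex_of_real (exp (- t)) else 0) \<in> borel_measurable borel"
      by measurable
    also have "(\<lambda>t. if t > 0 then exp ((z - 1) * of_real (ln t)) * complex_of_real (exp (- t)) else 0) = ?f"
      by (auto simp: fun_eq_iff powr_def Ln_of_real)
    finally show ?thesis .
  qed
  have "integrable lebesgue ?f" using ab unfolding set_integrable_def eq .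
  hence int: "integrable lborel ?f" using meas by (simp add: integrable_completion)
  have "(LINT t|lborel. ?f t) = (LINT t|lebesgue. ?f t)"
    using meas by (simp add: integral_completion)
  also have "\<dots> = integral {0<..} (\<lambda>t. complex_of_real t powr (z - 1) / of_real (exp t))"
    using set_lebesgue_integral_eq_integral(2)[OF ab] unfolding set_lebesgue_integral_def eq .
  also have "\<dots> = Gamma z" using Gamma_integral_complex'[OF z] by (rule integral_unique)
  finally have "has_bochner_integral lborel ?f (Gamma z)"
    using int by (simp add: has_bochner_integral_iff)
  hence "has_bochner_integral lborel (\<lambda>t. ?f (0 + s * t)) (Gamma z /\<^sub>R \<bar>s\<bar>)"
    using s by (subst (asm) lborel_has_bochner_integral_real_affine_iff[of s _ _ 0]) auto
  hence "has_bochner_integral lborel (\<lambda>t. (1 / of_real s powr (z - 1)) * ?f (0 + s * t)) ((1 / of_real s powr (z - 1)) * (Gamma z /\<^sub>R \<bar>s\<bar>))"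
    by (rule has_bochner_integral_mult_right)
  also have "(\<lambda>t. (1 / of_real s powr (z - 1)) * ?f (0 + s * t)) =
     (\<lambda>t. indicator {0<..} t *\<^sub>R (of_real t powr (z - 1) * of_real (exp (- (s * t)))))"
  proof
    fix t
    show "(1 / of_real s powr (z - 1)) * ?f (0 + s * t) =
      indicator {0<..} t *\<^sub>R (of_real t powr (z - 1) * of_real (exp (- (s * t))))"
    proof (cases "t > 0")
      case True
      hence "complex_of_real (s * t) powr (z - 1) = of_real s powr (z - 1) * of_real t powr (z - 1)"
        using s by (simp add: powr_times_real)
      thus ?thesis using True s by simp
    qed (use s in \<open>auto simp: zero_less_mult_iff\<close>)
  qed
  also have "(1 / of_real s powr (z - 1)) * (Gamma z /\<^sub>R \<bar>s\<bar>) = Gamma z / of_real s powr z"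
    using s by (simp add: powr_diff scaleR_conv_of_real divide_inverse)
  finally show ?thesis .
qed

lemma has_bochner_integral_power_exp:
  fixes s :: real
  assumes s: "s > 0"
  shows "has_bochner_integral lborel (\<lambda>t. indicator {0<..} t * (t ^ n * exp (- (s * t)))) (fact n / s ^ (n + 1))"
proof -
  have "has_bochner_integral lborel (\<lambda>t. indicator {0<..} t *\<^sub>R (complex_of_real t powr (of_nat n + 1 - 1) * of_real (exp (- (s * t)))))
     (Gamma (of_nat n + 1) / of_real s powr (of_nat n + 1))"
    by (rule has_bochner_integral_Gamma_scaled) (use s in auto)
  also have "(\<lambda>t. indicator {0<..} t *\<^sub>R (complex_of_real t powr (of_nat n + 1 - 1) * of_real (exp (- (s * t))))) =
     (\<lambda>t. of_real (indicator {0<..} t * (t ^ n * exp (- (s * t)))))"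
    by (auto simp: fun_eq_iff powr_nat' indicator_def)
  also have "Gamma (of_nat n + 1) / of_real s powr (of_nat n + 1) = complex_of_real (fact n / s ^ (n + 1))"
    using s Gamma_fact[of n, where ?'a = complex] powr_nat'[of "complex_of_real s" "n + 1"] by (simp add: add.commute)
  finally show ?thesis
    by (drule_tac has_bochner_integral_Re) simp
qed

text \<open>The Laplace transform of \<open>I(\<nu>,t)\<close> at \<open>s\<close> is \<open>(2 s)^(-\<nu>) / s\<close> times \<open>lap_D \<nu>\<close> at
  \<open>1 / (2 s)^2\<close>. The companion series \<open>lap_A\<close>, the transform of \<open>\<nu> I(\<nu>,t) / t\<close>, replaces the second order
  hypergeometric equation of \<open>lap_D\<close> by a first order system.\<close>

definition lap_coeff :: "complex \<Rightarrow> nat \<Rightarrow> complex" where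
  "lap_coeff \<nu> k = Gamma (of_nat (2 * k) + \<nu> + 1) * rGamma (of_nat k + \<nu> + 1) / fact k"

definition lap_D :: "complex \<Rightarrow> complex \<Rightarrow> complex" where
  "lap_D \<nu> w = (\<Sum>k. lap_coeff \<nu> k * w ^ k)"

definition lap_A :: "complex \<Rightarrow> complex \<Rightarrow> complex" where
  "lap_A \<nu> w = (\<Sum>k. \<nu> / (of_nat (2 * k) + \<nu>) * lap_coeff \<nu> k * w ^ k)"

definition bessel_term :: "complex \<Rightarrow> real \<Rightarrow> nat \<Rightarrow> real \<Rightarrow> complex" where
  "bessel_term \<nu> s k t = indicator {0<..} t *\<^sub>R (of_real (exp (- (s * t))) *
     (of_real (t / 2) powr \<nu> * (rGamma (of_nat k + \<nu> + 1) / fact k * of_real (t\<^sup>2 / 4) ^ k)))"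

lemma has_bochner_integral_bessel_term:
  assumes \<nu>: "Re \<nu> = 0" and s: "s > 0"
  shows "has_bochner_integral lborel (bessel_term \<nu> s k)
    (exp (- \<nu> * of_real (ln (2 * s))) / of_real s * (lap_coeff \<nu> k * of_real (1 / (4 * s\<^sup>2)) ^ k))"
proof -
  define c where "c = rGamma (of_nat k + \<nu> + 1) / fact k / 4 ^ k * exp (- \<nu> * of_real (ln 2))"
  let ?z = "of_nat (2 * k) + \<nu> + 1"
  have "has_bochner_integral lborel (\<lambda>t. c * (indicator {0<..} t *\<^sub>R (of_real t powr (?z - 1) * of_real (exp (- (s * t)))))) (c * (Gamma ?z / of_real s powr ?z))"
    by (intro has_bochner_integral_mult_right has_bochner_integral_Gamma_scaled) (use \<nu> s in auto)
  also have "(\<lambda>t. c * (indicator {0<..} t *\<^sub>R (of_real t powr (?z - 1) * of_real (exp (- (s * t)))))) = bessel_term \<nu> s k"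
  proof
    fix t :: real
    show "c * (indicator {0<..} t *\<^sub>R (of_real t powr (?z - 1) * of_real (exp (- (s * t))))) = bessel_term \<nu> s k t"
    proof (cases "t > 0")
      case True
      have 1: "complex_of_real t powr (?z - 1) = of_real t ^ (2 * k) * of_real t powr \<nu>"
        using True powr_nat'[of "complex_of_real t" "2 * k"] by (simp add: powr_add)
      have "complex_of_real (t / 2) powr \<nu> = exp (\<nu> * of_real (ln t - ln 2))"
        using True by (simp add: powr_def Ln_of_real ln_div del: of_real_divide)
      also have "\<dots> = of_real t powr \<nu> * exp (- \<nu> * of_real (ln 2))"
        using True by (simp add: powr_def Ln_of_real algebra_simps flip: exp_add)
      finally have 2: "complex_of_real (t / 2) powr \<nu> = of_real t powr \<nu> * exp (- \<nu> * of_real (ln 2))" .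
      have 3: "complex_of_real (t\<^sup>2 / 4) ^ k = of_real t ^ (2 * k) / 4 ^ k"
        by (simp add: power_mult power_divide)
      show ?thesis using True unfolding bessel_term_def 1 2 3 c_def by simp
    qed (simp add: bessel_term_def)
  qed
  also have "c * (Gamma ?z / of_real s powr ?z) =
    exp (- \<nu> * of_real (ln (2 * s))) / of_real s * (lap_coeff \<nu> k * of_real (1 / (4 * s\<^sup>2)) ^ k)"
  proof -
    have 1: "complex_of_real s powr ?z = of_real s ^ (2 * k) * of_real s * exp (\<nu> * of_real (ln s))"
      using s powr_nat'[of "complex_of_real s" "2 * k"] by (simp add: powr_add) (simp add: powr_def Ln_of_real)
    have 2: "exp (- \<nu> * of_real (ln (2 * s))) = exp (- \<nu> * of_real (ln 2)) / exp (\<nu> * of_real (ln s))"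
      using s by (simp add: ln_mult algebra_simps exp_minus exp_diff divide_inverse exp_add)
    have 3: "complex_of_real (1 / (4 * s\<^sup>2)) ^ k = 1 / (4 ^ k * of_real s ^ (2 * k))"
      by (simp add: power_mult power_divide power_mult_distrib)
    show ?thesis unfolding 1 2 3 c_def lap_coeff_def by (simp add: mult_ac)
  qed
  finally show ?thesis .
qed

text \<open>Absolute values leave the moment (2k)! / s^(2k+1) against 4^k (k!)^2, a quotient
  controlled by the central binomial bound. The result is geometric with ratio 1 / s^2, hence
  summable for s > 1.\<close>

lemma integral_norm_bessel_term_le:
  assumes \<nu>: "Re \<nu> = 0" and s: "s > 0"
  shows "(LINT t|lborel. norm (bessel_term \<nu> s k t)) \<le> norm (rGamma (\<nu> + 1)) / s * (1 / s\<^sup>2) ^ k"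
proof -
  let ?C = "norm (rGamma (\<nu> + 1))"
  have "(LINT t|lborel. norm (bessel_term \<nu> s k t)) \<le>
      (LINT t|lborel. ?C / (fact k)\<^sup>2 / 4 ^ k * (indicator {0<..} t * (t ^ (2 * k) * exp (- (s * t)))))"
  proof (rule integral_mono)
    show "integrable lborel (\<lambda>t. norm (bessel_term \<nu> s k t))"
      using has_bochner_integral_bessel_term[OF assms] by (auto simp: has_bochner_integral_iff)
    show "integrable lborel (\<lambda>t. ?C / (fact k)\<^sup>2 / 4 ^ k * (indicator {0<..} t * (t ^ (2 * k) * exp (- (s * t)))))"
      using has_bochner_integral_power_exp[OF s, of "2 * k"] by (intro integrable_mult_right) (auto simp: has_bochner_integral_iff)
    fix t :: real
    show "norm (bessel_term \<nu> s k t) \<le> ?C / (fact k)\<^sup>2 / 4 ^ k * (indicator {0<..} t * (t ^ (2 * k) * exp (- (s * t))))"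
    proof (cases "t > 0")
      case True
      have 1: "norm (complex_of_real (t / 2) powr \<nu>) = 1"
        using True \<nu> by (simp add: norm_powr_real_powr del: of_real_divide)
      have 2: "norm (complex_of_real (t\<^sup>2 / 4) ^ k) = t ^ (2 * k) / 4 ^ k"
        by (simp add: norm_power norm_divide power_divide power_mult)
      have "norm (bessel_term \<nu> s k t) = exp (- (s * t)) * (norm (rGamma (of_nat k + \<nu> + 1) / fact k) * (t ^ (2 * k) / 4 ^ k))"
        using True unfolding bessel_term_def by (simp only: norm_mult 1 2 norm_scaleR norm_of_real) simp
      also have "\<dots> \<le> exp (- (s * t)) * (?C / (fact k)\<^sup>2 * (t ^ (2 * k) / 4 ^ k))"
        using \<nu> True by (intro mult_left_mono mult_right_mono norm_bessel_red_coeff_le) auto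
      finally show ?thesis using True by (simp add: mult_ac)
    qed (simp add: bessel_term_def)
  qed
  also have "\<dots> = ?C / (fact k)\<^sup>2 / 4 ^ k * (fact (2 * k) / s ^ (2 * k + 1))"
    using has_bochner_integral_power_exp[OF s, of "2 * k"] by (simp add: has_bochner_integral_iff)
  also have "\<dots> = ?C / s * (1 / s\<^sup>2) ^ k * (fact (2 * k) / (4 ^ k * (fact k)\<^sup>2))"
  proof -
    have "s ^ (2 * k + 1) = s * (s\<^sup>2) ^ k" by (simp add: power_mult)
    thus ?thesis by (simp add: power_divide)
  qed
  also have "\<dots> \<le> ?C / s * (1 / s\<^sup>2) ^ k * 1"
  proof (intro mult_left_mono)
    have "fact (2 * k) / (4 ^ k * (fact k)\<^sup>2) \<le> 1 / sqrt (2 * real k + 1)" by (rule central_binomial_le)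
    also have "\<dots> \<le> 1" by simp
    finally show "fact (2 * k) / (4 ^ k * (fact k)\<^sup>2) \<le> (1 :: real)" .
  qed (use s in auto)
  finally show ?thesis by simp
qed

text \<open>The growth of this Gamma quotient is read off from the integral at s = 1, which equals
  the coefficient divided by 4^k up to a factor of modulus 1.\<close>

lemma norm_lap_coeff_le:
  assumes \<nu>: "Re \<nu> = 0"
  shows "norm (lap_coeff \<nu> k) \<le> norm (rGamma (\<nu> + 1)) * 4 ^ k"
proof -
  have "norm (LINT t|lborel. bessel_term \<nu> 1 k t) \<le> (LINT t|lborel. norm (bessel_term \<nu> 1 k t))"
    by (rule integral_norm_bound)
  also have "\<dots> \<le> norm (rGamma (\<nu> + 1))"
    using integral_norm_bessel_term_le[OF \<nu>, of 1 k] by simp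
  also have "norm (LINT t|lborel. bessel_term \<nu> 1 k t) = norm (lap_coeff \<nu> k) / 4 ^ k"
  proof -
    have "(LINT t|lborel. bessel_term \<nu> 1 k t) = exp (- \<nu> * of_real (ln 2)) * (lap_coeff \<nu> k * (1 / 4) ^ k)"
      using has_bochner_integral_bessel_term[OF \<nu>, of 1 k] by (simp add: has_bochner_integral_iff)
    thus ?thesis using \<nu> by (simp add: norm_mult norm_divide norm_power power_one_over)
  qed
  finally show ?thesis by (simp add: field_simps)
qed

text \<open>For w = 1 / (2 s)^2 the disc of radius 1/4 means s > 1, which is the range of cosh
  \<theta> for positive \<theta>. The free coefficients c cover \<open>lap_D\<close> and
  \<open>lap_A\<close> together.\<close>

lemma summable_lap:
  fixes c :: "nat \<Rightarrow> complex"
  assumes \<nu>: "Re \<nu> = 0" and w: "norm w < 1 / 4" and c: "\<And>k. norm (c k) \<le> norm (lap_coeff \<nu> k)"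
  shows "summable (\<lambda>k. c k * w ^ k)"
proof (rule summable_comparison_test')
  show "summable (\<lambda>k. norm (rGamma (\<nu> + 1)) * (4 * norm w) ^ k)"
    using w by (intro summable_mult summable_geometric) auto
  fix k :: nat
  have "norm (c k * w ^ k) \<le> (norm (rGamma (\<nu> + 1)) * 4 ^ k) * norm w ^ k"
    unfolding norm_mult norm_power using c[of k] norm_lap_coeff_le[OF \<nu>, of k]
    by (intro mult_right_mono) auto
  thus "norm (c k * w ^ k) \<le> norm (rGamma (\<nu> + 1)) * (4 * norm w) ^ k"
    by (simp add: power_mult_distrib mult_ac)
qed

lemma norm_lap_A_coeff_le:
  assumes "Re \<nu> = 0"
  shows "norm (\<nu> / (of_nat (2 * k) + \<nu>) * lap_coeff \<nu> k) \<le> norm (lap_coeff \<nu> k)"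
proof -
  have "norm \<nu> \<le> norm (of_nat (2 * k) + \<nu>)"
    using assms abs_Im_le_cmod[of "of_nat (2 * k) + \<nu>"] by (simp add: cmod_eq_Im)
  hence "norm \<nu> / norm (of_nat (2 * k) + \<nu>) \<le> 1"
    by (auto simp: divide_le_eq_1)
  from mult_right_mono[OF this norm_ge_zero] show ?thesis
    by (simp only: norm_mult norm_divide mult_1)
qed

lemma imaginary_notin_nonpos_Ints: "Re \<nu> = 0 \<Longrightarrow> of_nat (Suc n) + \<nu> \<notin> \<int>\<^sub>\<le>\<^sub>0"
  by (auto elim!: nonpos_Ints_cases simp: complex_eq_iff simp del: of_nat_Suc)

lemma lap_coeff_Suc:
  assumes \<nu>: "Re \<nu> = 0"
  shows "of_nat (k + 1) * (of_nat (k + 1) + \<nu>) * lap_coeff \<nu> (Suc k) =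
    (of_nat (2 * k + 1) + \<nu>) * (of_nat (2 * k + 2) + \<nu>) * lap_coeff \<nu> k"
proof -
  have G1: "Gamma (of_nat (2 * k + 1) + \<nu> + 1) = (of_nat (2 * k + 1) + \<nu>) * Gamma (of_nat (2 * k) + \<nu> + 1)"
    using Gamma_plus1[OF imaginary_notin_nonpos_Ints[OF \<nu>, of "2 * k"]] by (simp add: add_ac)
  have "Gamma (of_nat (2 * k + 2) + \<nu> + 1) = (of_nat (2 * k + 2) + \<nu>) * Gamma (of_nat (2 * k + 2) + \<nu>)"
    using Gamma_plus1[OF imaginary_notin_nonpos_Ints[OF \<nu>, of "2 * k + 1"]] by (simp add: add_ac)
  also have "of_nat (2 * k + 2) + \<nu> = of_nat (2 * k + 1) + \<nu> + 1" by simp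
  finally have G: "Gamma (of_nat (2 * Suc k) + \<nu> + 1) = (of_nat (2 * k + 2) + \<nu>) * ((of_nat (2 * k + 1) + \<nu>) * Gamma (of_nat (2 * k) + \<nu> + 1))"
    unfolding G1 by (simp add: add_ac)
  have R: "(of_nat (k + 1) + \<nu>) * rGamma (of_nat (Suc k) + \<nu> + 1) = rGamma (of_nat k + \<nu> + 1)"
    using rGamma_plus1[of "of_nat (k + 1) + \<nu>"] by (simp add: add_ac)
  have "of_nat (k + 1) * (of_nat (k + 1) + \<nu>) * lap_coeff \<nu> (Suc k) =
    Gamma (of_nat (2 * Suc k) + \<nu> + 1) * ((of_nat (k + 1) + \<nu>) * rGamma (of_nat (Suc k) + \<nu> + 1)) * (of_nat (Suc k) / fact (Suc k))"
    unfolding lap_coeff_def by (simp del: fact_Suc of_nat_Suc)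
  also have "of_nat (Suc k) / fact (Suc k) = (1 / fact k :: complex)"
    by (simp del: of_nat_Suc)
  finally show ?thesis unfolding R G lap_coeff_def by simp
qed

text \<open>The derivative is recorded through w d/dw, which multiplies the k-th coefficient by k;
  differential equations then become identities between coefficients.\<close>

lemma lap_deriv:
  fixes c :: "nat \<Rightarrow> complex"
  assumes \<nu>: "Re \<nu> = 0" and w: "norm w < 1 / 4" and c: "\<And>k. norm (c k) \<le> norm (lap_coeff \<nu> k)"
  obtains d where "((\<lambda>w. \<Sum>k. c k * w ^ k) has_field_derivative d) (at w)" "(\<lambda>k. of_nat k * c k * w ^ k) sums (w * d)"
proof
  define d where "d = (\<Sum>k. diffs c k * w ^ k)"
  show "((\<lambda>w. \<Sum>k. c k * w ^ k) has_field_derivative d) (at w)"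
    unfolding d_def by (rule termdiffs_strong'[OF summable_lap[OF \<nu> _ c] w])
  have "summable (\<lambda>k. diffs c k * w ^ k)"
    by (rule termdiff_converges[OF w]) (rule summable_lap[OF \<nu> _ c])
  hence "(\<lambda>k. w * (diffs c k * w ^ k)) sums (w * d)"
    unfolding d_def by (intro sums_mult summable_sums)
  also have "(\<lambda>k. w * (diffs c k * w ^ k)) = (\<lambda>k. of_nat (Suc k) * c (Suc k) * w ^ Suc k)"
    by (simp add: diffs_def fun_eq_iff mult_ac del: of_nat_Suc)
  finally show "(\<lambda>k. of_nat k * c k * w ^ k) sums (w * d)"
    by (subst (asm) sums_Suc_iff) simp
qed

text \<open>The first equation undoes the division by 2 k + \<nu> in the coefficients of
  \<open>lap_A\<close>. The second one encodes the two-term recurrence of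
  \<open>lap_coeff\<close>.\<close>

lemma lap_system:
  assumes \<nu>: "Re \<nu> = 0" "\<nu> \<noteq> 0" and w: "norm w < 1 / 4"
  obtains A' D' where
    "(lap_A \<nu> has_field_derivative A') (at w)" "(lap_D \<nu> has_field_derivative D') (at w)"
    "2 * w * A' + \<nu> * lap_A \<nu> w = \<nu> * lap_D \<nu> w"
    "(1 - 4 * w) * (2 * w * D' + \<nu> * lap_D \<nu> w) - 4 * w * lap_D \<nu> w = \<nu> * lap_A \<nu> w"
proof -
  let ?d = "lap_coeff \<nu>" and ?a = "\<lambda>k. \<nu> / (of_nat (2 * k) + \<nu>) * lap_coeff \<nu> k"
  note cA = norm_lap_A_coeff_le[OF \<nu>(1)]
  obtain D' where D': "(lap_D \<nu> has_field_derivative D') (at w)" "(\<lambda>k. of_nat k * ?d k * w ^ k) sums (w * D')"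
    using lap_deriv[OF \<nu>(1) w, of ?d] unfolding lap_D_def[abs_def] by auto
  obtain A' where A': "(lap_A \<nu> has_field_derivative A') (at w)" "(\<lambda>k. of_nat k * ?a k * w ^ k) sums (w * A')"
    using lap_deriv[OF \<nu>(1) w cA] unfolding lap_A_def[abs_def] by auto
  have D: "(\<lambda>k. ?d k * w ^ k) sums lap_D \<nu> w"
    unfolding lap_D_def by (intro summable_sums summable_lap[OF \<nu>(1) w]) auto
  have A: "(\<lambda>k. ?a k * w ^ k) sums lap_A \<nu> w"
    unfolding lap_A_def by (intro summable_sums summable_lap[OF \<nu>(1) w] cA)
  have nz: "of_nat (2 * k) + \<nu> \<noteq> 0" for k
    using \<nu> by (auto simp: complex_eq_iff)
  have "(\<lambda>k. 2 * (of_nat k * ?a k * w ^ k) + \<nu> * (?a k * w ^ k)) sums (2 * (w * A') + \<nu> * lap_A \<nu> w)"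
    by (intro sums_add sums_mult A A')
  moreover have "2 * (of_nat k * ?a k * w ^ k) + \<nu> * (?a k * w ^ k) = \<nu> * (?d k * w ^ k)" for k
  proof -
    have "2 * (of_nat k * ?a k * w ^ k) + \<nu> * (?a k * w ^ k) = ((of_nat (2 * k) + \<nu>) * ?a k) * w ^ k"
    proof -
      have "2 * (of_nat k * x * y) + \<nu> * (x * y) = ((of_nat (2 * k) + \<nu>) * x) * y" for x y :: complex
        by (simp add: algebra_simps)
      thus ?thesis .
    qed
    also have "(of_nat (2 * k) + \<nu>) * ?a k = \<nu> * ?d k" using nz[of k] by simp
    finally show ?thesis by (simp only: mult.assoc)
  qed
  ultimately have "(\<lambda>k. \<nu> * (?d k * w ^ k)) sums (2 * (w * A') + \<nu> * lap_A \<nu> w)" by simp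
  hence 1: "2 * (w * A') + \<nu> * lap_A \<nu> w = \<nu> * lap_D \<nu> w"
    using sums_unique2[OF sums_mult[OF D, of \<nu>]] by simp
  define e where "e k = 2 * (of_nat k * ?d k * w ^ k) + \<nu> * (?d k * w ^ k)" for k
  have e: "e sums (2 * (w * D') + \<nu> * lap_D \<nu> w)"
    unfolding e_def by (intro sums_add sums_mult D D')
  have "(\<lambda>k. e k - \<nu> * (?a k * w ^ k)) sums (2 * (w * D') + \<nu> * lap_D \<nu> w - \<nu> * lap_A \<nu> w)"
    by (intro sums_diff e sums_mult A)
  \<comment> \<open>The term of index 0 is \<nu> - \<nu> times the leading coefficient and drops
    out, so the series may start at 1.\<close>
  hence "(\<lambda>k. e (Suc k) - \<nu> * (?a (Suc k) * w ^ Suc k)) sums (2 * (w * D') + \<nu> * lap_D \<nu> w - \<nu> * lap_A \<nu> w)"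
    using \<nu> by (subst sums_Suc_iff) (simp add: e_def)
  also have "(\<lambda>k. e (Suc k) - \<nu> * (?a (Suc k) * w ^ Suc k)) = (\<lambda>k. 4 * w * (e k + ?d k * w ^ k))"
  proof
    fix k
    let ?m = "of_nat (2 * k + 2) + \<nu>"
    have m: "?m \<noteq> 0" using nz[of "Suc k"] by simp
    have "e (Suc k) - \<nu> * (?a (Suc k) * w ^ Suc k) = (?m - \<nu>\<^sup>2 / ?m) * ?d (Suc k) * w ^ Suc k"
      unfolding e_def by (simp add: algebra_simps power2_eq_square)
    \<comment> \<open>With m = 2 (k + 1) + \<nu> the difference m^2 - \<nu>^2 factors into the left
      coefficient of \<open>lap_coeff_Suc\<close>. Subtracting the \<open>lap_A\<close> term was
      arranged for this.\<close>
    also have "?m - \<nu>\<^sup>2 / ?m = 4 * (of_nat (k + 1) * (of_nat (k + 1) + \<nu>)) / ?m"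
      using m by (simp add: divide_simps) (simp add: power2_eq_square algebra_simps)
    also have "4 * (of_nat (k + 1) * (of_nat (k + 1) + \<nu>)) / ?m * ?d (Suc k) =
       4 / ?m * (of_nat (k + 1) * (of_nat (k + 1) + \<nu>) * ?d (Suc k))" by simp
    also have "\<dots> = 4 * (of_nat (2 * k + 1) + \<nu>) * ?d k"
      unfolding lap_coeff_Suc[OF \<nu>(1)] using m by simp
    finally show "e (Suc k) - \<nu> * (?a (Suc k) * w ^ Suc k) = 4 * w * (e k + ?d k * w ^ k)"
      unfolding e_def by (simp add: algebra_simps)
  qed
  finally have "4 * w * ((2 * (w * D') + \<nu> * lap_D \<nu> w) + lap_D \<nu> w) = 2 * (w * D') + \<nu> * lap_D \<nu> w - \<nu> * lap_A \<nu> w"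
    by (rule sums_unique2[OF sums_mult[OF sums_add[OF e D]]])
  hence 2: "(1 - 4 * w) * (2 * w * D' + \<nu> * lap_D \<nu> w) - 4 * w * lap_D \<nu> w = \<nu> * lap_A \<nu> w"
    by (simp add: algebra_simps)
  show ?thesis using that[OF A'(1) D'(1)] 1 2 by (simp add: mult.assoc)
qed

text \<open>These values fix the constants of integration, since w tends to 0 as \<theta> tends to
  infinity. The leading coefficient of \<open>lap_A\<close> contains \<nu> / \<nu>, hence the
  nonzero order.\<close>

lemma tendsto_lap:
  assumes \<nu>: "Re \<nu> = 0" "\<nu> \<noteq> 0"
  shows "(lap_A \<nu> \<longlongrightarrow> 1) (nhds 0)" "(lap_D \<nu> \<longlongrightarrow> 1) (nhds 0)"
proof -
  obtain A' D' where d: "(lap_A \<nu> has_field_derivative A') (at 0)" "(lap_D \<nu> has_field_derivative D') (at 0)"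
  proof -
    have "norm (0 :: complex) < 1 / 4" by simp
    thus ?thesis using lap_system[OF \<nu>] that by blast
  qed
  have "\<nu> + 1 \<notin> \<int>\<^sub>\<le>\<^sub>0" using imaginary_notin_nonpos_Ints[OF \<nu>(1), of 0] by (simp add: add.commute)
  hence c0: "lap_coeff \<nu> 0 = 1" by (simp add: lap_coeff_def rGamma_inverse_Gamma Gamma_eq_zero_iff)
  have "lap_D \<nu> 0 = 1" using powser_zero[of "lap_coeff \<nu>"] by (simp add: lap_D_def c0)
  thus "(lap_D \<nu> \<longlongrightarrow> 1) (nhds 0)"
    using DERIV_isCont[OF d(2)] by (metis isCont_def tendsto_at_iff_tendsto_nhds)
  have "lap_A \<nu> 0 = 1" using powser_zero[of "\<lambda>k. \<nu> / (of_nat (2 * k) + \<nu>) * lap_coeff \<nu> k"] \<nu>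
    by (simp add: lap_A_def c0)
  thus "(lap_A \<nu> \<longlongrightarrow> 1) (nhds 0)"
    using DERIV_isCont[OF d(1)] by (metis isCont_def tendsto_at_iff_tendsto_nhds)
qed

text \<open>In the variable \<open>\<theta>\<close> with \<open>w = 1 / (2 cosh \<theta>)^2\<close> the hypergeometric system becomes
  \<open>a' = - \<nu> b\<close>, \<open>b' = - \<nu> a\<close>.\<close>

lemma lap_D_closed_form:
  assumes \<nu>: "Re \<nu> = 0" "\<nu> \<noteq> 0" and \<theta>: "\<theta> > 0"
  shows "exp (- \<nu> * of_real (ln (2 * cosh \<theta>))) * lap_D \<nu> (of_real (1 / (4 * (cosh \<theta>)\<^sup>2))) * of_real (tanh \<theta>) =
    exp (- \<nu> * of_real \<theta>)"
proof -
  define W where "W \<theta> = 1 / (4 * (cosh \<theta>)\<^sup>2)" for \<theta> :: real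
  define p where "p \<theta> = exp (- \<nu> * of_real (ln (2 * cosh \<theta>)))" for \<theta>
  \<comment> \<open>Both \<open>a\<close> and \<open>b\<close> turn out to be exp (-\<nu> \<theta>).
    The second is sinh \<theta> times the Laplace transform of I(\<nu>,t) at cosh \<theta>.\<close>
  define a where "a \<theta> = p \<theta> * lap_A \<nu> (of_real (W \<theta>))" for \<theta>
  define b where "b \<theta> = p \<theta> * lap_D \<nu> (of_real (W \<theta>)) * of_real (tanh \<theta>)" for \<theta>
  \<comment> \<open>So the coefficient 1 - 4 w of the system is (tanh \<theta>)^2, and its singular
    point w = 1/4 corresponds to \<theta> = 0.\<close>
  have W4: "4 * W \<theta> = 1 - (tanh \<theta>)\<^sup>2" for \<theta>
  proof -
    have "cosh \<theta> \<noteq> 0" using cosh_real_pos[of \<theta>] by linarith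
    moreover have "(tanh \<theta>)\<^sup>2 = ((cosh \<theta>)\<^sup>2 - 1) / (cosh \<theta>)\<^sup>2"
      by (simp add: tanh_def power_divide cosh_square_eq)
    ultimately show ?thesis by (simp add: W_def diff_divide_distrib)
  qed
  have ab: "(a has_vector_derivative - \<nu> * b \<theta>) (at \<theta>)" "(b has_vector_derivative - \<nu> * a \<theta>) (at \<theta>)"
    if \<theta>: "\<theta> > 0" for \<theta>
  proof -
    have c0: "cosh \<theta> \<noteq> 0" using cosh_real_pos[of \<theta>] by linarith
    have t0: "tanh \<theta> > 0" using \<theta> by simp
    have "W \<theta> < 1 / 4" using W4[of \<theta>] t0 zero_less_power[OF t0, of 2] by linarith
    moreover have "W \<theta> \<ge> 0" by (simp add: W_def)
    ultimately have w: "norm (complex_of_real (W \<theta>)) < 1 / 4" by simp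
    obtain A' D' where d: "(lap_A \<nu> has_field_derivative A') (at (of_real (W \<theta>)))" "(lap_D \<nu> has_field_derivative D') (at (of_real (W \<theta>)))"
      and s1: "2 * of_real (W \<theta>) * A' + \<nu> * lap_A \<nu> (of_real (W \<theta>)) = \<nu> * lap_D \<nu> (of_real (W \<theta>))"
      and s2: "(1 - 4 * of_real (W \<theta>)) * (2 * of_real (W \<theta>) * D' + \<nu> * lap_D \<nu> (of_real (W \<theta>))) - 4 * of_real (W \<theta>) * lap_D \<nu> (of_real (W \<theta>)) = \<nu> * lap_A \<nu> (of_real (W \<theta>))"
      using lap_system[OF \<nu> w] by blast
    have "(W has_field_derivative - 2 * W \<theta> * tanh \<theta>) (at \<theta>)"
      unfolding W_def using c0 by (auto intro!: derivative_eq_intros simp: tanh_def field_simps power2_eq_square)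
    hence dW: "(W has_vector_derivative - 2 * W \<theta> * tanh \<theta>) (at \<theta>)"
      by (simp add: has_real_derivative_iff_has_vector_derivative)
    have dA: "((\<lambda>\<theta>. lap_A \<nu> (of_real (W \<theta>))) has_vector_derivative (- 2 * W \<theta> * tanh \<theta>) *\<^sub>R A') (at \<theta>)"
      using vector_diff_chain_at[OF dW has_vector_derivative_real_field[OF d(1)]] by (simp add: o_def)
    have dD: "((\<lambda>\<theta>. lap_D \<nu> (of_real (W \<theta>))) has_vector_derivative (- 2 * W \<theta> * tanh \<theta>) *\<^sub>R D') (at \<theta>)"
      using vector_diff_chain_at[OF dW has_vector_derivative_real_field[OF d(2)]] by (simp add: o_def)
    have "((\<lambda>\<theta>. ln (2 * cosh \<theta>)) has_field_derivative tanh \<theta>) (at \<theta>)"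
      using cosh_real_pos[of \<theta>] by (auto intro!: derivative_eq_intros simp: tanh_def field_simps)
    hence dl: "((\<lambda>\<theta>. ln (2 * cosh \<theta>)) has_vector_derivative tanh \<theta>) (at \<theta>)"
      by (simp add: has_real_derivative_iff_has_vector_derivative)
    have "((\<lambda>z. exp (- \<nu> * z)) has_field_derivative - \<nu> * p \<theta>) (at (of_real (ln (2 * cosh \<theta>))))"
      by (auto intro!: derivative_eq_intros simp: p_def)
    from vector_diff_chain_at[OF dl has_vector_derivative_real_field[OF this]]
    have dp: "(p has_vector_derivative tanh \<theta> *\<^sub>R (- \<nu> * p \<theta>)) (at \<theta>)"
      by (simp add: o_def p_def[abs_def])
    have "(tanh has_field_derivative (1 - (tanh \<theta>)\<^sup>2)) (at \<theta>)"
      using c0 by (auto intro!: derivative_eq_intros)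
    hence dt: "((\<lambda>\<theta>. complex_of_real (tanh \<theta>)) has_vector_derivative of_real (1 - (tanh \<theta>)\<^sup>2)) (at \<theta>)"
      by (rule has_vector_derivative_of_real)
    have "(a has_vector_derivative (p \<theta> * ((- 2 * W \<theta> * tanh \<theta>) *\<^sub>R A') + (tanh \<theta> *\<^sub>R (- \<nu> * p \<theta>)) * lap_A \<nu> (of_real (W \<theta>)))) (at \<theta>)"
      unfolding a_def by (rule has_vector_derivative_mult[OF dp dA])
    also have "(p \<theta> * ((- 2 * W \<theta> * tanh \<theta>) *\<^sub>R A') + (tanh \<theta> *\<^sub>R (- \<nu> * p \<theta>)) * lap_A \<nu> (of_real (W \<theta>))) =
       - of_real (tanh \<theta>) * p \<theta> * (2 * of_real (W \<theta>) * A' + \<nu> * lap_A \<nu> (of_real (W \<theta>)))"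
      by (simp add: scaleR_conv_of_real algebra_simps)
    also have "\<dots> = - \<nu> * b \<theta>" unfolding s1 b_def by (simp add: algebra_simps)
    finally show "(a has_vector_derivative - \<nu> * b \<theta>) (at \<theta>)" .
    have "(b has_vector_derivative ((p \<theta> * lap_D \<nu> (of_real (W \<theta>))) * of_real (1 - (tanh \<theta>)\<^sup>2) +
       (p \<theta> * ((- 2 * W \<theta> * tanh \<theta>) *\<^sub>R D') + (tanh \<theta> *\<^sub>R (- \<nu> * p \<theta>)) * lap_D \<nu> (of_real (W \<theta>))) * of_real (tanh \<theta>))) (at \<theta>)"
      unfolding b_def by (rule has_vector_derivative_mult[OF has_vector_derivative_mult[OF dp dD] dt])
    also have "((p \<theta> * lap_D \<nu> (of_real (W \<theta>))) * of_real (1 - (tanh \<theta>)\<^sup>2) +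
       (p \<theta> * ((- 2 * W \<theta> * tanh \<theta>) *\<^sub>R D') + (tanh \<theta> *\<^sub>R (- \<nu> * p \<theta>)) * lap_D \<nu> (of_real (W \<theta>))) * of_real (tanh \<theta>)) =
       - p \<theta> * (of_real ((tanh \<theta>)\<^sup>2) * (2 * of_real (W \<theta>) * D' + \<nu> * lap_D \<nu> (of_real (W \<theta>))) - of_real (1 - (tanh \<theta>)\<^sup>2) * lap_D \<nu> (of_real (W \<theta>)))"
      by (simp add: scaleR_conv_of_real algebra_simps power2_eq_square)
    also have "(tanh \<theta>)\<^sup>2 = 1 - 4 * W \<theta>" using W4[of \<theta>] by simp
    also have "- p \<theta> * (of_real (1 - 4 * W \<theta>) * (2 * of_real (W \<theta>) * D' + \<nu> * lap_D \<nu> (of_real (W \<theta>))) - of_real (1 - (1 - 4 * W \<theta>)) * lap_D \<nu> (of_real (W \<theta>))) =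
        - p \<theta> * (\<nu> * lap_A \<nu> (of_real (W \<theta>)))"
      unfolding s2[symmetric] by simp
    also have "\<dots> = - \<nu> * a \<theta>" by (simp add: a_def)
    finally show "(b has_vector_derivative - \<nu> * a \<theta>) (at \<theta>)" .
  qed
  have dexp: "((\<lambda>\<theta>. exp (\<mu> * of_real \<theta>)) has_vector_derivative \<mu> * exp (\<mu> * of_real \<theta>)) (at \<theta>)" for \<mu> :: complex and \<theta>
    by (rule has_vector_derivative_real_field) (auto intro!: derivative_eq_intros)
  \<comment> \<open>The sum and the difference of \<open>a\<close> and \<open>b\<close> satisfy
    decoupled equations; multiplied by the integrating factors they are constant.\<close>
  define u where "u \<theta> = exp (\<nu> * of_real \<theta>) * (a \<theta> + b \<theta>)" for \<theta>
  define v where "v \<theta> = exp (- \<nu> * of_real \<theta>) * (a \<theta> - b \<theta>)" for \<theta>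
  have "(u has_vector_derivative 0) (at \<theta> within {0<..})" if "\<theta> \<in> {0<..}" for \<theta>
  proof -
    have "(u has_vector_derivative (exp (\<nu> * of_real \<theta>) * (- \<nu> * b \<theta> + - \<nu> * a \<theta>) + \<nu> * exp (\<nu> * of_real \<theta>) * (a \<theta> + b \<theta>))) (at \<theta>)"
      unfolding u_def using that by (intro has_vector_derivative_mult has_vector_derivative_add dexp ab) auto
    also have "(exp (\<nu> * of_real \<theta>) * (- \<nu> * b \<theta> + - \<nu> * a \<theta>) + \<nu> * exp (\<nu> * of_real \<theta>) * (a \<theta> + b \<theta>)) = 0"
      by (simp add: algebra_simps)
    finally show ?thesis by (rule has_vector_derivative_at_within)
  qed
  hence "\<exists>c. \<forall>\<theta>\<in>{0<..}. u \<theta> = c" by (intro has_vector_derivative_zero_constant) auto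
  then obtain cu where cu: "\<And>\<theta>. \<theta> > 0 \<Longrightarrow> u \<theta> = cu" by auto
  have "(v has_vector_derivative 0) (at \<theta> within {0<..})" if "\<theta> \<in> {0<..}" for \<theta>
  proof -
    have "(v has_vector_derivative (exp (- \<nu> * of_real \<theta>) * (- \<nu> * b \<theta> - - \<nu> * a \<theta>) + - \<nu> * exp (- \<nu> * of_real \<theta>) * (a \<theta> - b \<theta>))) (at \<theta>)"
      unfolding v_def using that by (intro has_vector_derivative_mult has_vector_derivative_diff dexp ab) auto
    also have "(exp (- \<nu> * of_real \<theta>) * (- \<nu> * b \<theta> - - \<nu> * a \<theta>) + - \<nu> * exp (- \<nu> * of_real \<theta>) * (a \<theta> - b \<theta>)) = 0"
      by (simp add: algebra_simps)
    finally show ?thesis by (rule has_vector_derivative_at_within)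
  qed
  hence "\<exists>c. \<forall>\<theta>\<in>{0<..}. v \<theta> = c" by (intro has_vector_derivative_zero_constant) auto
  then obtain cv where cv: "\<And>\<theta>. \<theta> > 0 \<Longrightarrow> v \<theta> = cv" by auto
  have "(W \<longlongrightarrow> 0) at_top"
    unfolding W_def[abs_def]
    by (intro tendsto_divide_0[OF tendsto_const] filterlim_at_top_imp_at_infinity
         filterlim_tendsto_pos_mult_at_top[OF tendsto_const] filterlim_pow_at_top cosh_real_at_top) auto
  from tendsto_of_real[OF this] have W0: "((\<lambda>\<theta>. complex_of_real (W \<theta>)) \<longlongrightarrow> 0) at_top" by simp
  have limA: "((\<lambda>\<theta>. lap_A \<nu> (of_real (W \<theta>))) \<longlongrightarrow> 1) at_top"
    by (rule filterlim_compose[OF tendsto_lap(1)[OF \<nu>] W0])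
  have limD: "((\<lambda>\<theta>. lap_D \<nu> (of_real (W \<theta>)) * of_real (tanh \<theta>)) \<longlongrightarrow> 1 * of_real 1) at_top"
    by (intro tendsto_mult tendsto_of_real tanh_real_at_top filterlim_compose[OF tendsto_lap(2)[OF \<nu>] W0])
  \<comment> \<open>Each of the two factors oscillates, but in the product the growth \<theta> of ln
    (2 cosh \<theta>) cancels and only ln (1 + exp (-2 \<theta>)) remains.\<close>
  have lime: "((\<lambda>\<theta>. exp (\<nu> * of_real \<theta>) * p \<theta>) \<longlongrightarrow> exp (- \<nu> * of_real (ln (1 + 0)))) at_top"
  proof -
    have "exp (\<nu> * of_real \<theta>) * p \<theta> = exp (- \<nu> * of_real (ln (1 + exp (- 2 * \<theta>))))" for \<theta>
    proof -
      have "2 * cosh \<theta> = exp \<theta> * (1 + exp (- 2 * \<theta>))"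
        by (simp add: cosh_def algebra_simps flip: exp_add)
      hence "ln (2 * cosh \<theta>) = \<theta> + ln (1 + exp (- 2 * \<theta>))"
        using add_pos_pos[of 1 "exp (- (2 * \<theta>))"] by (simp add: ln_mult)
      thus ?thesis by (simp add: p_def algebra_simps flip: exp_add)
    qed
    moreover have "((\<lambda>\<theta>::real. exp (- 2 * \<theta>)) \<longlongrightarrow> 0) at_top"
      by (intro filterlim_compose[OF exp_at_bot] filterlim_tendsto_neg_mult_at_bot[OF tendsto_const] filterlim_ident) auto
    ultimately show ?thesis by (simp only:) (intro tendsto_intros; simp)
  qed
  have "((\<lambda>\<theta>. (exp (\<nu> * of_real \<theta>) * p \<theta>) * (lap_A \<nu> (of_real (W \<theta>)) + lap_D \<nu> (of_real (W \<theta>)) * of_real (tanh \<theta>))) \<longlongrightarrow>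
       exp (- \<nu> * of_real (ln (1 + 0))) * (1 + 1 * of_real 1)) at_top"
    by (intro tendsto_mult tendsto_add limA limD lime)
  also have "(\<lambda>\<theta>. (exp (\<nu> * of_real \<theta>) * p \<theta>) * (lap_A \<nu> (of_real (W \<theta>)) + lap_D \<nu> (of_real (W \<theta>)) * of_real (tanh \<theta>))) = u"
    by (simp add: fun_eq_iff u_def a_def b_def algebra_simps)
  finally have "(u \<longlongrightarrow> 2) at_top" by simp
  moreover have "((\<lambda>_. cu) \<longlongrightarrow> cu) (at_top :: real filter)" by simp
  hence "(u \<longlongrightarrow> cu) at_top"
    by (rule Lim_transform_eventually) (rule eventually_mono[OF eventually_gt_at_top[of 0]], simp add: cu)
  ultimately have cu2: "cu = 2" using tendsto_unique[OF trivial_limit_at_top_linorder] by blast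
  \<comment> \<open>For \<open>v\<close> the phases add up instead of cancelling and have no limit.
    They have modulus 1, though, and the bracket tends to 0, so the modulus suffices.\<close>
  have "((\<lambda>\<theta>. norm (lap_A \<nu> (of_real (W \<theta>)) - lap_D \<nu> (of_real (W \<theta>)) * of_real (tanh \<theta>))) \<longlongrightarrow>
       norm (1 - 1 * of_real 1 :: complex)) at_top"
    by (intro tendsto_norm tendsto_diff limA limD)
  also have "(\<lambda>\<theta>. norm (lap_A \<nu> (of_real (W \<theta>)) - lap_D \<nu> (of_real (W \<theta>)) * of_real (tanh \<theta>))) = (\<lambda>\<theta>. norm (v \<theta>))"
  proof
    fix \<theta>
    have "v \<theta> = exp (- \<nu> * of_real \<theta>) * (p \<theta> * (lap_A \<nu> (of_real (W \<theta>)) - lap_D \<nu> (of_real (W \<theta>)) * of_real (tanh \<theta>)))"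
      by (simp add: v_def a_def b_def algebra_simps)
    thus "norm (lap_A \<nu> (of_real (W \<theta>)) - lap_D \<nu> (of_real (W \<theta>)) * of_real (tanh \<theta>)) = norm (v \<theta>)"
      using \<nu> by (simp add: norm_mult p_def)
  qed
  finally have "((\<lambda>\<theta>. norm (v \<theta>)) \<longlongrightarrow> 0) at_top" by simp
  hence "(v \<longlongrightarrow> 0) at_top" by (rule tendsto_norm_zero_cancel)
  moreover have "((\<lambda>_. cv) \<longlongrightarrow> cv) (at_top :: real filter)" by simp
  hence "(v \<longlongrightarrow> cv) at_top"
    by (rule Lim_transform_eventually) (rule eventually_mono[OF eventually_gt_at_top[of 0]], simp add: cv)
  ultimately have "cv = 0" using tendsto_unique[OF trivial_limit_at_top_linorder] by blast
  hence "a \<theta> = b \<theta>" using cv[OF \<theta>] by (simp add: v_def)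
  hence "exp (\<nu> * of_real \<theta>) * b \<theta> = 1" using cu[OF \<theta>] cu2 by (simp add: u_def)
  hence "b \<theta> = exp (- \<nu> * of_real \<theta>)" by (simp add: exp_minus field_simps)
  thus ?thesis by (simp add: b_def p_def W_def)
qed

text \<open>Sum and integral may be exchanged because the absolute integrals form a geometric series
  of ratio 1 / (cosh \<theta>)^2, less than 1.\<close>

lemma laplace_bessel_I:
  assumes \<nu>: "Re \<nu> = 0" "\<nu> \<noteq> 0" and \<theta>: "\<theta> > 0"
  shows "has_bochner_integral lborel (\<lambda>t. indicator {0<..} t *\<^sub>R (of_real (exp (- (cosh \<theta> * t))) * bessel_I \<nu> (of_real t)))
     (exp (- \<nu> * of_real \<theta>) / of_real (sinh \<theta>))"
proof -
  let ?s = "cosh \<theta>" and ?T = "bessel_term \<nu> (cosh \<theta>)"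
  have s: "?s > 0" by (rule cosh_real_pos)
  have s1: "?s > 1" using cosh_real_strict_mono[of 0 \<theta>] \<theta> by simp
  note T = has_bochner_integral_bessel_term[OF \<nu>(1) s]
  have int: "integrable lborel (?T k)" for k using T[of k] by (simp add: has_bochner_integral_iff)
  have T_eq: "?T k t = indicator {0<..} t *\<^sub>R (of_real (exp (- (?s * t))) * of_real (t / 2) powr \<nu>) * (rGamma (of_nat k + \<nu> + 1) / fact k * of_real (t\<^sup>2 / 4) ^ k)" for k t
    unfolding bessel_term_def by (simp only: scaleR_scaleR mult.assoc mult_scaleR_left)
  have AE: "AE t in lborel. summable (\<lambda>k. norm (?T k t))"
    unfolding T_eq norm_mult[of "_ *\<^sub>R _"] using \<nu> by (intro AE_I2 summable_mult summable_norm_bessel_red) simp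
  have sm: "summable (\<lambda>k. LINT t|lborel. norm (?T k t))"
  proof (rule summable_comparison_test')
    have "1 < ?s\<^sup>2" using s1 by (simp add: one_less_power)
    thus "summable (\<lambda>k. norm (rGamma (\<nu> + 1)) / ?s * (1 / ?s\<^sup>2) ^ k)"
      by (intro summable_mult summable_geometric) simp
    show "norm (LINT t|lborel. norm (?T k t)) \<le> norm (rGamma (\<nu> + 1)) / ?s * (1 / ?s\<^sup>2) ^ k" for k
      using integral_norm_bessel_term_le[OF \<nu>(1) s, of k] by simp
  qed
  have sum: "(\<Sum>k. ?T k t) = indicator {0<..} t *\<^sub>R (of_real (exp (- (?s * t))) * bessel_I \<nu> (of_real t))" for t
  proof (cases "t > 0")
    case True
    have "(\<Sum>k. ?T k t) = indicator {0<..} t *\<^sub>R (of_real (exp (- (?s * t))) * of_real (t / 2) powr \<nu>) * bessel_red \<nu> (of_real (t\<^sup>2 / 4))"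
      unfolding T_eq bessel_red_def using \<nu> by (intro suminf_mult summable_bessel_red) simp
    thus ?thesis using True \<nu> by (simp add: bessel_I_eq_red)
  qed (simp add: bessel_term_def)
  have "(\<lambda>k. exp (- \<nu> * of_real (ln (2 * ?s))) / of_real ?s * (lap_coeff \<nu> k * of_real (1 / (4 * ?s\<^sup>2)) ^ k)) sums
     (LINT t|lborel. (\<Sum>k. ?T k t))"
    using sums_integral[OF int AE sm] has_bochner_integral_integral_eq[OF T] by simp
  moreover have "(\<lambda>k. exp (- \<nu> * of_real (ln (2 * ?s))) / of_real ?s * (lap_coeff \<nu> k * of_real (1 / (4 * ?s\<^sup>2)) ^ k)) sums
     (exp (- \<nu> * of_real (ln (2 * ?s))) / of_real ?s * lap_D \<nu> (of_real (1 / (4 * ?s\<^sup>2))))"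
  proof -
    have "1 < ?s\<^sup>2" using s1 by (simp add: one_less_power)
    hence "norm (complex_of_real (1 / (4 * ?s\<^sup>2))) < 1 / 4"
      by (subst norm_of_real) (simp add: divide_simps)
    thus ?thesis unfolding lap_D_def using \<nu> by (intro sums_mult summable_sums summable_lap[OF \<nu>(1)]) auto
  qed
  ultimately have "(LINT t|lborel. (\<Sum>k. ?T k t)) = exp (- \<nu> * of_real (ln (2 * ?s))) / of_real ?s * lap_D \<nu> (of_real (1 / (4 * ?s\<^sup>2)))"
    by (rule sums_unique2)
  also have "\<dots> = (exp (- \<nu> * of_real (ln (2 * ?s))) * lap_D \<nu> (of_real (1 / (4 * ?s\<^sup>2))) * of_real (tanh \<theta>)) / of_real (sinh \<theta>)"
    using \<theta> s by (simp add: tanh_def divide_simps)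
  also have "\<dots> = exp (- \<nu> * of_real \<theta>) / of_real (sinh \<theta>)"
    unfolding lap_D_closed_form[OF \<nu> \<theta>] ..
  finally show ?thesis
    using integrable_suminf[OF int AE sm] unfolding sum by (simp add: has_bochner_integral_iff)
qed


section \<open>Stieltjes transforms\<close>

lemma borel_measurable_bessel_I_order:
  assumes "y > 0"
  shows "(\<lambda>\<tau>. bessel_I (\<i> * complex_of_real \<tau>) (complex_of_real y)) \<in> borel_measurable borel"
  using measurable_compose[OF _ borel_measurable_bessel_I_imaginary, of "\<lambda>\<tau>. (y, \<tau>)"] assms by simp

lemma borel_measurable_Re_bessel_I:
  "(\<lambda>(t, \<tau>). indicator {0<..} t * Re (bessel_I (\<i> * complex_of_real \<tau>) (complex_of_real t))) \<in> borel_measurable (borel \<Otimes>\<^sub>M borel)"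
proof -
  have "(\<lambda>p. Re ((\<lambda>(y, \<tau>). if y > 0 then bessel_I (\<i> * complex_of_real \<tau>) (complex_of_real y) else 0) p))
     \<in> borel_measurable (borel \<Otimes>\<^sub>M borel)"
    by (rule measurable_compose[OF borel_measurable_bessel_I_imaginary]) simp
  also have "(\<lambda>p. Re ((\<lambda>(y, \<tau>). if y > 0 then bessel_I (\<i> * complex_of_real \<tau>) (complex_of_real y) else 0) p)) =
     (\<lambda>(t, \<tau>). indicator {0<..} t * Re (bessel_I (\<i> * complex_of_real \<tau>) (complex_of_real t)))"
    by (auto simp: fun_eq_iff indicator_def)
  finally show ?thesis .
qed

lemma exp_Re_bessel_I_le:
  assumes "y > 0"
  shows "exp (- y) * \<bar>Re (bessel_I (\<i> * of_real \<tau>) (of_real y))\<bar> \<le> sqrt (cosh (pi * \<tau>))"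
    and "exp (- y) * \<bar>Re (bessel_I (\<i> * of_real \<tau>) (of_real y))\<bar> \<le> sqrt (cosh (pi * \<tau>)) * (1 / (2 * sqrt y))"
proof -
  have "\<bar>Re (bessel_I (\<i> * of_real \<tau>) (of_real y))\<bar> \<le> sqrt (cosh (pi * \<tau>)) * bessel_I0 y"
    using abs_Re_le_cmod norm_bessel_I_imaginary_le[OF assms] by (rule order_trans)
  hence "exp (- y) * \<bar>Re (bessel_I (\<i> * of_real \<tau>) (of_real y))\<bar> \<le> exp (- y) * (sqrt (cosh (pi * \<tau>)) * bessel_I0 y)"
    by (rule mult_left_mono) simp
  also have "\<dots> = sqrt (cosh (pi * \<tau>)) * (exp (- y) * bessel_I0 y)" by simp
  finally have *: "exp (- y) * \<bar>Re (bessel_I (\<i> * of_real \<tau>) (of_real y))\<bar> \<le> sqrt (cosh (pi * \<tau>)) * (exp (- y) * bessel_I0 y)" .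
  have "exp (- y) * bessel_I0 y \<le> exp (- y) * exp y" "exp (- y) * bessel_I0 y \<le> exp (- y) * (exp y / (2 * sqrt y))"
    using assms by (intro mult_left_mono bessel_I0_le_exp bessel_I0_le_exp_sqrt; simp)+
  hence "exp (- y) * bessel_I0 y \<le> 1" "exp (- y) * bessel_I0 y \<le> 1 / (2 * sqrt y)"
    by (simp_all add: exp_minus)
  hence "sqrt (cosh (pi * \<tau>)) * (exp (- y) * bessel_I0 y) \<le> sqrt (cosh (pi * \<tau>)) * 1"
    "sqrt (cosh (pi * \<tau>)) * (exp (- y) * bessel_I0 y) \<le> sqrt (cosh (pi * \<tau>)) * (1 / (2 * sqrt y))"
    by (simp_all only: mult_left_mono real_sqrt_ge_zero cosh_real_nonneg)
  with * show "exp (- y) * \<bar>Re (bessel_I (\<i> * of_real \<tau>) (of_real y))\<bar> \<le> sqrt (cosh (pi * \<tau>))"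
    "exp (- y) * \<bar>Re (bessel_I (\<i> * of_real \<tau>) (of_real y))\<bar> \<le> sqrt (cosh (pi * \<tau>)) * (1 / (2 * sqrt y))"
    by linarith+
qed

text \<open>The majorant behind both applications of Fubini: of size t^(-1/2) at the origin and
  t^(-3/2) at infinity. An arctangent of sqrt (t/z) is its antiderivative.\<close>

lemma integrable_stieltjes_sqrt:
  assumes z: "z > 0"
  shows "integrable lborel (\<lambda>t. indicator {0<..} t * (1 / (2 * sqrt t) / (t + z)) :: real)"
proof -
  define F where "F t = arctan (sqrt (t / z)) / sqrt z" for t
  have "set_integrable lborel (einterval 0 \<infinity>) (\<lambda>t. 1 / (2 * sqrt t) / (t + z))"
  proof (rule interval_integral_FTC_nonneg)
    fix t :: real assume "0 < ereal t"
    hence t: "t > 0" by (simp add: zero_ereal_def)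
    have e: "sqrt (t / z) * sqrt z = sqrt t" using z by (simp add: real_sqrt_divide)
    have "((\<lambda>t. arctan (sqrt (t / z))) has_field_derivative
        inverse (1 + (sqrt (t / z))\<^sup>2) * (inverse (sqrt (t / z)) / 2 * (1 / z))) (at t)"
      using t z by (auto intro!: derivative_eq_intros simp: divide_less_0_iff)
    from DERIV_cdivide[OF this, of "sqrt z"]
    have "(F has_field_derivative (inverse (1 + (sqrt (t / z))\<^sup>2) * (inverse (sqrt (t / z)) / 2 * (1 / z))) / sqrt z) (at t)"
      by (simp only: F_def[abs_def])
    also have "(inverse (1 + (sqrt (t / z))\<^sup>2) * (inverse (sqrt (t / z)) / 2 * (1 / z))) / sqrt z =
        inverse (1 + t / z) * (1 / z) / (2 * (sqrt (t / z) * sqrt z))"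
    proof -
      have "(A * (inverse r / 2 * b)) / q = A * b / (2 * (r * q))" for A r b q :: real
        by (simp add: field_simps)
      moreover have "(sqrt (t / z))\<^sup>2 = t / z" using t z by simp
      ultimately show ?thesis by (simp only:)
    qed
    also have "\<dots> = 1 / (2 * sqrt t) / (t + z)"
      unfolding e using t z by (simp add: divide_simps)
    finally show "(F has_field_derivative 1 / (2 * sqrt t) / (t + z)) (at t)" .
    show "isCont (\<lambda>t. 1 / (2 * sqrt t) / (t + z)) t"
      using t z by (intro continuous_intros) auto
  next
    show "AE t in lborel. 0 < ereal t \<longrightarrow> ereal t < \<infinity> \<longrightarrow> 0 \<le> 1 / (2 * sqrt t) / (t + z)"
      using z by (intro AE_I2) (auto simp: zero_ereal_def)
    have "isCont F 0" unfolding F_def using z by (intro continuous_intros) auto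
    hence "(F \<longlongrightarrow> F 0) (at_right 0)" unfolding isCont_def by (rule tendsto_mono[OF at_le, rotated]) simp
    thus "((F \<circ> real_of_ereal) \<longlongrightarrow> F 0) (at_right 0)"
      by (simp add: zero_ereal_def ereal_tendsto_simps)
    have "filterlim (\<lambda>t. inverse z * t) at_top at_top"
      by (rule filterlim_tendsto_pos_mult_at_top[OF tendsto_const _ filterlim_ident]) (use z in simp)
    hence "filterlim (\<lambda>t. t / z) at_top at_top" by (simp add: divide_inverse mult.commute)
    from filterlim_compose[OF tendsto_arctan_at_top filterlim_compose[OF sqrt_at_top this]]
    have "(F \<longlongrightarrow> (pi / 2) / sqrt z) at_top"
      unfolding F_def[abs_def] by (rule tendsto_divide[OF _ tendsto_const]) (use z in simp)
    thus "((F \<circ> real_of_ereal) \<longlongrightarrow> (pi / 2) / sqrt z) (at_left \<infinity>)"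
      by (simp add: ereal_tendsto_simps)
  qed simp
  thus ?thesis
    by (simp add: set_integrable_def einterval_def greaterThan_def zero_ereal_def)
qed

text \<open>With u = cosh \<theta> - 1 this is the integral of exp (-u c) over u > 0. The shift by 1
  leaves room for the factor exp (-t), which restores exp (-t cosh \<theta>).\<close>

lemma has_bochner_integral_exp_cosh:
  assumes c: "c > 0"
  shows "has_bochner_integral lborel (\<lambda>\<theta>. indicator {0<..} \<theta> * (exp (- ((cosh \<theta> - 1) * c)) * sinh \<theta>)) (1 / c :: real)"
proof -
  define F where "F \<theta> = - exp (- ((cosh \<theta> - 1) * c)) / c" for \<theta>
  let ?f = "\<lambda>\<theta>. exp (- ((cosh \<theta> - 1) * c)) * sinh \<theta>"
  have *: "(F has_field_derivative ?f \<theta>) (at \<theta>)" for \<theta>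
    unfolding F_def using c by (auto intro!: derivative_eq_intros)
  have nonneg: "AE \<theta> in lborel. 0 < ereal \<theta> \<longrightarrow> ereal \<theta> < \<infinity> \<longrightarrow> 0 \<le> ?f \<theta>"
    by (intro AE_I2) (auto simp: zero_ereal_def)
  have cont: "isCont ?f \<theta>" for \<theta> by (intro continuous_intros)
  have "isCont F 0" using * by (rule DERIV_isCont)
  hence "(F \<longlongrightarrow> F 0) (at_right 0)" unfolding isCont_def by (rule tendsto_mono[OF at_le, rotated]) simp
  hence L0: "((F \<circ> real_of_ereal) \<longlongrightarrow> F 0) (at_right 0)"
    by (simp add: zero_ereal_def ereal_tendsto_simps)
  have "filterlim (\<lambda>\<theta>. (cosh \<theta> - 1) * c) at_top (at_top :: real filter)"
    using c filterlim_tendsto_add_at_top[OF tendsto_const[of "- 1 :: real"] cosh_real_at_top]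
    by (intro filterlim_at_top_mult_tendsto_pos[OF tendsto_const]) auto
  hence "(F \<longlongrightarrow> - 0 / c) at_top"
    unfolding F_def using c
    by (intro tendsto_intros filterlim_compose[OF exp_at_bot] filterlim_compose[OF filterlim_uminus_at_bot_at_top]) auto
  hence L1: "((F \<circ> real_of_ereal) \<longlongrightarrow> 0) (at_left \<infinity>)"
    by (simp add: ereal_tendsto_simps)
  have "set_integrable lborel (einterval 0 \<infinity>) ?f" "(LBINT \<theta>=0..\<infinity>. ?f \<theta>) = 0 - F 0"
    using interval_integral_FTC_nonneg[of 0 \<infinity> F ?f, OF _ * cont nonneg L0 L1] by auto
  thus ?thesis
    by (simp add: has_bochner_integral_iff set_integrable_def interval_lebesgue_integral_def set_lebesgue_integral_def
       einterval_def greaterThan_def zero_ereal_def F_def)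
qed

lemma laplace_Re_bessel_I:
  assumes "\<tau> \<noteq> 0" "\<theta> > 0"
  shows "has_bochner_integral lborel (\<lambda>t. indicator {0<..} t * (exp (- (cosh \<theta> * t)) * Re (bessel_I (\<i> * of_real \<tau>) (of_real t))))
     (cos (\<tau> * \<theta>) / sinh \<theta>)"
proof -
  have "exp (- (\<i> * complex_of_real \<tau>) * of_real \<theta>) = cis (- (\<tau> * \<theta>))"
    by (simp add: cis_conv_exp mult.assoc)
  with has_bochner_integral_Re[OF laplace_bessel_I[of "\<i> * of_real \<tau>" \<theta>]] assms show ?thesis by simp
qed

lemma stieltjes_Re_bessel_I:
  assumes \<tau>: "\<tau> \<noteq> 0" and z: "z > 0"
  shows "complex_of_real (LINT t|lborel. indicator {0<..} t * (exp (- t) * Re (bessel_I (\<i> * of_real \<tau>) (of_real t)) / (t + z))) =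
    of_real (exp z) * bessel_K (\<i> * of_real \<tau>) (of_real z)"
proof -
  define J where "J t = indicator {0<..} t * Re (bessel_I (\<i> * of_real \<tau>) (of_real t))" for t :: real
  define E where "E c \<theta> = indicator {0<..} \<theta> * (exp (- ((cosh \<theta> - 1) * c)) * sinh \<theta>)" for c \<theta> :: real
  have [measurable]: "J \<in> borel_measurable borel"
    using measurable_compose[OF _ borel_measurable_Re_bessel_I, of "\<lambda>t. (t, \<tau>)" borel] unfolding J_def by simp
  have [measurable]: "(\<lambda>(t, \<theta>). E (t + z) \<theta>) \<in> borel_measurable (borel \<Otimes>\<^sub>M borel)"
    unfolding E_def cosh_def sinh_def by measurable
  have E: "has_bochner_integral lborel (E c) (1 / c)" if "c > 0" for c
    using has_bochner_integral_exp_cosh[OF that] by (simp only: E_def[abs_def])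
  define f where "f t \<theta> = (exp (- t) * J t) * E (t + z) \<theta>" for t \<theta>
  have intt: "integrable lborel (\<lambda>\<theta>. f t \<theta>)" "(LINT \<theta>|lborel. f t \<theta>) = exp (- t) * J t / (t + z)"
    "(LINT \<theta>|lborel. norm (f t \<theta>)) = exp (- t) * \<bar>J t\<bar> / (t + z)" for t
  proof -
    have "integrable lborel (\<lambda>\<theta>. f t \<theta>) \<and> (LINT \<theta>|lborel. f t \<theta>) = exp (- t) * J t / (t + z) \<and>
      (LINT \<theta>|lborel. norm (f t \<theta>)) = exp (- t) * \<bar>J t\<bar> / (t + z)"
    proof (cases "t > 0")
      case True
      have "norm (f t \<theta>) = exp (- t) * \<bar>J t\<bar> * E (t + z) \<theta>" for \<theta>
        by (auto simp: f_def E_def abs_mult indicator_def)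
      thus ?thesis using E[of "t + z"] True z by (auto simp: f_def has_bochner_integral_iff)
    qed (simp add: f_def J_def)
    thus "integrable lborel (\<lambda>\<theta>. f t \<theta>)" "(LINT \<theta>|lborel. f t \<theta>) = exp (- t) * J t / (t + z)"
      "(LINT \<theta>|lborel. norm (f t \<theta>)) = exp (- t) * \<bar>J t\<bar> / (t + z)" by auto
  qed
  \<comment> \<open>The weight \<open>E\<close> is nonnegative, so the inner integral of the modulus
    is known exactly and only a bound in t is left to prove.\<close>
  have int: "integrable (lborel \<Otimes>\<^sub>M lborel) (case_prod f)"
  proof (rule lborel_pair.Fubini_integrable)
    show "case_prod f \<in> borel_measurable (lborel \<Otimes>\<^sub>M lborel)"
      unfolding f_def by measurable
    have "integrable lborel (\<lambda>t. exp (- t) * \<bar>J t\<bar> / (t + z))"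
    proof (rule Bochner_Integration.integrable_bound)
      show "integrable lborel (\<lambda>t. sqrt (cosh (pi * \<tau>)) * (indicator {0<..} t * (1 / (2 * sqrt t) / (t + z))))"
        by (intro integrable_mult_right integrable_stieltjes_sqrt z)
      show "AE t in lborel. norm (exp (- t) * \<bar>J t\<bar> / (t + z)) \<le>
          norm (sqrt (cosh (pi * \<tau>)) * (indicator {0<..} t * (1 / (2 * sqrt t) / (t + z))))"
      proof (rule AE_I2)
        fix t :: real
        show "norm (exp (- t) * \<bar>J t\<bar> / (t + z)) \<le>
          norm (sqrt (cosh (pi * \<tau>)) * (indicator {0<..} t * (1 / (2 * sqrt t) / (t + z))))"
        proof (cases "t > 0")
          case True
          thus ?thesis
            using divide_right_mono[OF exp_Re_bessel_I_le(2)[OF True, of \<tau>], of "t + z"] z by (simp add: J_def)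
        qed (simp add: J_def)
      qed
    qed measurable
    thus "integrable lborel (\<lambda>t. LINT \<theta>|lborel. norm (case (t, \<theta>) of (t, \<theta>) \<Rightarrow> f t \<theta>))"
      using intt(3) by simp
    show "AE t in lborel. integrable lborel (\<lambda>\<theta>. case (t, \<theta>) of (t, \<theta>) \<Rightarrow> f t \<theta>)"
      using intt(1) by simp
  qed
  have "(LINT t|lborel. indicator {0<..} t * (exp (- t) * Re (bessel_I (\<i> * of_real \<tau>) (of_real t)) / (t + z))) =
     (LINT t|lborel. (LINT \<theta>|lborel. f t \<theta>))"
    unfolding intt(2) by (intro Bochner_Integration.integral_cong refl) (auto simp: J_def indicator_def)
  also have "\<dots> = (LINT \<theta>|lborel. (LINT t|lborel. f t \<theta>))"
    by (rule lborel_pair.Fubini_integral[OF int, symmetric])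
  also have "\<dots> = (LINT \<theta>|lborel. exp z * (indicator {0<..} \<theta> * (exp (- z * cosh \<theta>) * cos (\<tau> * \<theta>))))"
  proof (intro Bochner_Integration.integral_cong refl)
    fix \<theta> :: real
    show "(LINT t|lborel. f t \<theta>) = exp z * (indicator {0<..} \<theta> * (exp (- z * cosh \<theta>) * cos (\<tau> * \<theta>)))"
    proof (cases "\<theta> > 0")
      case True
      have "f t \<theta> = (exp (- ((cosh \<theta> - 1) * z)) * sinh \<theta>) * (indicator {0<..} t * (exp (- (cosh \<theta> * t)) * Re (bessel_I (\<i> * of_real \<tau>) (of_real t))))" for t
      proof -
        have "exp (- t) * exp (- ((cosh \<theta> - 1) * (t + z))) = exp (- ((cosh \<theta> - 1) * z)) * exp (- (cosh \<theta> * t))"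
          by (simp add: algebra_simps flip: exp_add)
        thus ?thesis using True unfolding f_def E_def J_def by simp
      qed
      \<comment> \<open>The sinh \<theta> of the substitution cancels the denominator of the Laplace
        transform, which leaves the integrand of K.\<close>
      hence "(LINT t|lborel. f t \<theta>) = (exp (- ((cosh \<theta> - 1) * z)) * sinh \<theta>) * (cos (\<tau> * \<theta>) / sinh \<theta>)"
        using laplace_Re_bessel_I[OF \<tau> True] by (simp add: has_bochner_integral_iff)
      also have "\<dots> = exp (- ((cosh \<theta> - 1) * z)) * cos (\<tau> * \<theta>)" using True by simp
      also have "exp (- ((cosh \<theta> - 1) * z)) = exp z * exp (- z * cosh \<theta>)"
        by (simp add: algebra_simps flip: exp_add)
      finally show ?thesis using True by simp
    qed (simp add: f_def E_def)
  qed
  finally have "(LINT t|lborel. indicator {0<..} t * (exp (- t) * Re (bessel_I (\<i> * of_real \<tau>) (of_real t)) / (t + z))) =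
     exp z * (LINT \<theta>|lborel. indicator {0<..} \<theta> * (exp (- z * cosh \<theta>) * cos (\<tau> * \<theta>)))" by simp
  moreover have "bessel_K (\<i> * of_real \<tau>) (of_real z) =
      complex_of_real (LINT \<theta>|lborel. indicator {0<..} \<theta> * (exp (- z * cosh \<theta>) * cos (\<tau> * \<theta>)))"
    unfolding bessel_K_imaginary[OF \<tau> z] set_lebesgue_integral_def integral_complex_of_real[symmetric]
    by (intro Bochner_Integration.integral_cong refl) (simp add: scaleR_conv_of_real)
  ultimately show ?thesis by simp
qed

text \<open>Needed to form the product of \<open>lborel\<close> in t with \<open>lebesgue\<close> in
  \<tau>; a countable cover by Borel sets of finite measure works for the completion as
  well.\<close>

lemma sigma_finite_lebesgue: "sigma_finite_measure (lebesgue :: 'a::euclidean_space measure)"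
proof
  obtain A :: "'a set set" where "countable A" "A \<subseteq> sets lborel" "\<Union> A = space lborel" "\<forall>a\<in>A. emeasure lborel a \<noteq> \<infinity>"
    using lborel.sigma_finite_countable by blast
  thus "\<exists>A. countable A \<and> A \<subseteq> sets lebesgue \<and> \<Union> A = space (lebesgue :: 'a measure) \<and> (\<forall>a\<in>A. emeasure lebesgue a \<noteq> \<infinity>)"
    by (intro exI[of _ A]) (auto simp: subset_eq)
qed

text \<open>The limit defining K at order 0 is never evaluated: it affects one point of the
  \<tau>-axis, where any value preserves measurability.\<close>

lemma borel_measurable_bessel_K_imaginary:
  assumes "y > 0"
  shows "(\<lambda>\<tau>. bessel_K (\<i> * complex_of_real \<tau>) (complex_of_real y)) \<in> borel_measurable borel"
proof -
  have I: "(\<lambda>\<tau>. bessel_I (\<i> * complex_of_real \<tau>) (complex_of_real y)) \<in> borel_measurable borel"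
    by (rule borel_measurable_bessel_I_order[OF assms])
  have I': "(\<lambda>\<tau>. bessel_I (- (\<i> * complex_of_real \<tau>)) (complex_of_real y)) \<in> borel_measurable borel"
    using measurable_compose[OF borel_measurable_uminus[OF measurable_ident] borel_measurable_bessel_I_order[OF assms]] by simp
  have "(\<lambda>\<tau>. sin (of_real pi * (\<i> * complex_of_real \<tau>))) \<in> borel_measurable borel"
    by (intro borel_measurable_continuous_onI continuous_intros)
  hence "(\<lambda>\<tau>. macdonald_quotient (\<i> * complex_of_real \<tau>) (complex_of_real y)) \<in> borel_measurable borel"
    unfolding macdonald_quotient_def
    by (intro borel_measurable_times borel_measurable_divide borel_measurable_diff borel_measurable_const I I')
  hence "(\<lambda>\<tau>. if \<tau> \<in> {0} then bessel_K 0 (complex_of_real y) else macdonald_quotient (\<i> * complex_of_real \<tau>) (complex_of_real y)) \<in> borel_measurable borel"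
    by (intro measurable_If_set) auto
  also have "(\<lambda>\<tau>. if \<tau> \<in> {0} then bessel_K 0 (complex_of_real y) else macdonald_quotient (\<i> * complex_of_real \<tau>) (complex_of_real y)) =
     (\<lambda>\<tau>. bessel_K (\<i> * complex_of_real \<tau>) (complex_of_real y))"
    by (auto simp: fun_eq_iff bessel_K_def imaginary_in_Ints_iff)
  finally show ?thesis .
qed

section \<open>Boundedness, continuity and Stieltjes transform of the index transform\<close>

lemma norm_G_integrand_le:
  assumes "x > 0"
  shows "exp (- x / 2) * norm (G_integrand g x \<tau>) \<le> norm (g \<tau>) * cosh_weight \<tau>"
proof -
  let ?c = "cosh (pi * \<tau>)"
  have "exp (- x / 2) * norm (G_integrand g x \<tau>) = (exp (- (x / 2)) * \<bar>Re (bessel_I (\<i> * of_real \<tau>) (of_real (x / 2)))\<bar>) * (norm (g \<tau>) / ?c)"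
    by (simp add: G_integrand_def norm_mult norm_divide)
  also have "\<dots> \<le> sqrt ?c * (norm (g \<tau>) / ?c)"
    using assms by (intro mult_right_mono exp_Re_bessel_I_le(1)) auto
  \<comment> \<open>The weight of the space arises here, as the kernel bound sqrt (cosh (pi \<tau>))
    divided by cosh (pi \<tau>).\<close>
  also have "\<dots> = norm (g \<tau>) * (1 / sqrt ?c)" by (simp add: real_div_sqrt divide_simps)
  also have "1 / sqrt ?c = cosh_weight \<tau>"
    by (simp add: cosh_weight_def powr_minus_divide powr_half_sqrt)
  finally show ?thesis .
qed

lemma borel_measurable_G_integrand:
  assumes "x > 0" "g \<in> borel_measurable lebesgue"
  shows "G_integrand g x \<in> borel_measurable lebesgue"
proof -
  have [measurable]: "(\<lambda>\<tau>. bessel_I (\<i> * complex_of_real \<tau>) (complex_of_real (x / 2))) \<in> borel_measurable lebesgue"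
    using assms(1) by (intro measurable_completion) (simp only: measurable_lborel2, intro borel_measurable_bessel_I_order, simp)
  have [measurable]: "(\<lambda>\<tau>. cosh (pi * \<tau>)) \<in> borel_measurable lebesgue"
    by (intro measurable_completion) (simp only: measurable_lborel2, intro borel_measurable_continuous_onI continuous_intros)
  show ?thesis using assms(2) unfolding G_integrand_def[abs_def] by measurable
qed

lemma integrable_G_integrand:
  assumes x: "x > 0" and g: "g \<in> weighted_L1 cosh_weight"
  shows "integrable lebesgue (G_integrand g x)"
proof (rule Bochner_Integration.integrable_bound)
  show "integrable lebesgue (\<lambda>\<tau>. exp (x / 2) * (norm (g \<tau>) * cosh_weight \<tau>))"
    using g unfolding weighted_L1_def by (intro integrable_mult_right) auto
  show "AE \<tau> in lebesgue. norm (G_integrand g x \<tau>) \<le> norm (exp (x / 2) * (norm (g \<tau>) * cosh_weight \<tau>))"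
  proof (rule AE_I2)
    fix \<tau>
    have "norm (G_integrand g x \<tau>) = exp (x / 2) * (exp (- x / 2) * norm (G_integrand g x \<tau>))"
      by (simp flip: exp_add mult.assoc)
    also have "\<dots> \<le> exp (x / 2) * (norm (g \<tau>) * cosh_weight \<tau>)"
      by (intro mult_left_mono norm_G_integrand_le x) auto
    finally show "norm (G_integrand g x \<tau>) \<le> norm (exp (x / 2) * (norm (g \<tau>) * cosh_weight \<tau>))" by simp
  qed
qed (use x g borel_measurable_G_integrand in \<open>auto simp: weighted_L1_def\<close>)

lemma norm_G_transform_le:
  assumes x: "x > 0" and g: "g \<in> weighted_L1 cosh_weight"
  shows "norm (G_transform g x) \<le> sqrt pi * weighted_L1_norm cosh_weight g"
proof -
  have "norm (G_transform g x) \<le> sqrt pi * exp (- x / 2) * (LINT \<tau>|lebesgue. norm (G_integrand g x \<tau>))"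
    unfolding G_transform_def norm_mult norm_of_real by (intro mult_mono integral_norm_bound) auto
  also have "\<dots> = sqrt pi * (LINT \<tau>|lebesgue. exp (- x / 2) * norm (G_integrand g x \<tau>))" by simp
  also have "\<dots> \<le> sqrt pi * (LINT \<tau>|lebesgue. norm (g \<tau>) * cosh_weight \<tau>)"
    using integrable_G_integrand[OF x g] g norm_G_integrand_le[OF x]
    by (intro mult_left_mono integral_mono) (auto simp: weighted_L1_def)
  finally show ?thesis by (simp add: weighted_L1_norm_def)
qed

text \<open>Dominated convergence is applied with the factor exp (-x/2) inside the integral; then
  the weighted modulus of \<open>g\<close> is a majorant independent of x.\<close>

lemma continuous_on_G_transform:
  assumes g: "g \<in> weighted_L1 cosh_weight"
  shows "continuous_on {0<..} (G_transform g)"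
proof (rule continuous_on_sequentiallyI)
  fix u :: "nat \<Rightarrow> real" and a assume u: "\<forall>n. u n \<in> {0<..}" and a: "a \<in> {0<..}" and lim: "u \<longlonglongrightarrow> a"
  have "(\<lambda>n. LINT \<tau>|lebesgue. of_real (exp (- u n / 2)) * G_integrand g (u n) \<tau>) \<longlonglongrightarrow>
     (LINT \<tau>|lebesgue. of_real (exp (- a / 2)) * G_integrand g a \<tau>)"
  proof (rule integral_dominated_convergence)
    show "integrable lebesgue (\<lambda>\<tau>. norm (g \<tau>) * cosh_weight \<tau>)" using g by (simp add: weighted_L1_def)
    show "AE \<tau> in lebesgue. norm (of_real (exp (- u n / 2)) * G_integrand g (u n) \<tau>) \<le> norm (g \<tau>) * cosh_weight \<tau>" for n
      using norm_G_integrand_le[of "u n" g] u by (intro AE_I2) (simp add: norm_mult)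
    show "AE \<tau> in lebesgue. (\<lambda>n. of_real (exp (- u n / 2)) * G_integrand g (u n) \<tau>) \<longlonglongrightarrow> of_real (exp (- a / 2)) * G_integrand g a \<tau>"
    proof (rule AE_I2)
      fix \<tau>
      have "(\<lambda>n. bessel_I (\<i> * of_real \<tau>) (of_real (u n / 2))) \<longlonglongrightarrow> bessel_I (\<i> * of_real \<tau>) (of_real (a / 2))"
        by (rule continuous_on_tendsto_compose[OF continuous_on_bessel_I]) (use a u lim in \<open>auto intro!: tendsto_intros always_eventually\<close>)
      thus "(\<lambda>n. of_real (exp (- u n / 2)) * G_integrand g (u n) \<tau>) \<longlonglongrightarrow> of_real (exp (- a / 2)) * G_integrand g a \<tau>"
        unfolding G_integrand_def using lim by (intro tendsto_intros) auto
    qed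
  qed (use integrable_G_integrand[OF _ g] u a in auto)
  hence "(\<lambda>n. of_real (sqrt pi) * (of_real (exp (- u n / 2)) * (LINT \<tau>|lebesgue. G_integrand g (u n) \<tau>))) \<longlonglongrightarrow>
     of_real (sqrt pi) * (of_real (exp (- a / 2)) * (LINT \<tau>|lebesgue. G_integrand g a \<tau>))"
    by (intro tendsto_mult_left) simp
  thus "(\<lambda>n. G_transform g (u n)) \<longlonglongrightarrow> G_transform g a"
    by (simp add: G_transform_def mult.assoc)
qed

text \<open>The space consists of functions, so descent to classes modulo null sets, part of being
  well defined, is stated separately.\<close>

lemma G_transform_cong_AE:
  assumes "g \<in> weighted_L1 cosh_weight" "h \<in> weighted_L1 cosh_weight" "AE \<tau> in lebesgue. g \<tau> = h \<tau>" "x > 0"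
  shows "G_transform g x = G_transform h x"
proof -
  have "(LINT \<tau>|lebesgue. G_integrand g x \<tau>) = (LINT \<tau>|lebesgue. G_integrand h x \<tau>)"
  proof (rule integral_cong_AE)
    show "AE \<tau> in lebesgue. G_integrand g x \<tau> = G_integrand h x \<tau>"
      using assms(3) by eventually_elim (simp add: G_integrand_def)
  qed (rule borel_measurable_integrable integrable_G_integrand assms)+
  thus ?thesis by (simp add: G_transform_def)
qed

lemma G_transform_linear:
  assumes "g \<in> weighted_L1 cosh_weight" "h \<in> weighted_L1 cosh_weight" "x > 0"
  shows "G_transform (\<lambda>\<tau>. a * g \<tau> + b * h \<tau>) x = a * G_transform g x + b * G_transform h x"
proof -
  have "G_integrand (\<lambda>\<tau>. a * g \<tau> + b * h \<tau>) x = (\<lambda>\<tau>. a * G_integrand g x \<tau> + b * G_integrand h x \<tau>)"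
    by (simp add: G_integrand_def fun_eq_iff add_divide_distrib algebra_simps)
  thus ?thesis
    using integrable_G_integrand[OF assms(3,1)] integrable_G_integrand[OF assms(3,2)]
    by (simp add: G_transform_def algebra_simps)
qed

text \<open>Under t = 2 s the kernel dt / (x + t) becomes ds / (s + x/2), so the transform of the
  Bessel kernel is needed at z = x/2. Fubini supplies both integrability claims along with the
  identity.\<close>

lemma stieltjes_G_transform:
  assumes g: "g \<in> weighted_L1 cosh_weight" and x: "x > 0"
  shows "set_integrable lebesgue {0<..} (\<lambda>t. G_transform g t / of_real (x + t))"
    and "integrable lebesgue (\<lambda>\<tau>. bessel_K (\<i> * of_real \<tau>) (of_real (x / 2)) * (g \<tau> / of_real (cosh (pi * \<tau>))))"
    and "(LINT t:{0<..}|lebesgue. G_transform g t / of_real (x + t)) =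
      of_real (sqrt pi * exp (x / 2)) * (LINT \<tau>|lebesgue. bessel_K (\<i> * of_real \<tau>) (of_real (x / 2)) * (g \<tau> / of_real (cosh (pi * \<tau>))))"
proof -
  interpret L: sigma_finite_measure "lebesgue :: real measure" by (rule sigma_finite_lebesgue)
  interpret pair_sigma_finite lborel "lebesgue :: real measure" ..
  have g_meas [measurable]: "g \<in> borel_measurable lebesgue" using g by (simp add: weighted_L1_def)
  have cosh_meas [measurable]: "(\<lambda>\<tau>. cosh (pi * \<tau>)) \<in> borel_measurable lebesgue"
    by (intro measurable_completion) (simp only: measurable_lborel2, intro borel_measurable_continuous_onI continuous_intros)
  define J where "J t \<tau> = indicator {0<..} t * Re (bessel_I (\<i> * of_real \<tau>) (of_real t))" for t \<tau> :: real
  define q where "q t = sqrt pi * exp (- t / 2) / (x + t)" for t :: real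
  define f where "f t \<tau> = complex_of_real (q t * J (t / 2) \<tau>) * (g \<tau> / of_real (cosh (pi * \<tau>)))" for t \<tau>
  have f_G: "f t \<tau> = of_real (indicator {0<..} t * q t) * G_integrand g t \<tau>" for t \<tau>
    by (simp add: f_def J_def G_integrand_def indicator_def)
  have fst_f: "(LINT \<tau>|lebesgue. f t \<tau>) = indicator {0<..} t *\<^sub>R (G_transform g t / of_real (x + t))" for t
    unfolding f_G by (simp add: G_transform_def q_def scaleR_conv_of_real indicator_def)
  have "(\<lambda>(t, \<tau>). J t \<tau>) \<in> borel_measurable (borel \<Otimes>\<^sub>M borel)"
    unfolding J_def by (rule borel_measurable_Re_bessel_I)
  moreover have "(\<lambda>p. (fst p / 2, snd p)) \<in> lborel \<Otimes>\<^sub>M lebesgue \<rightarrow>\<^sub>M (borel \<Otimes>\<^sub>M borel :: (real \<times> real) measure)"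
  proof (rule measurable_Pair)
    have "(\<lambda>\<tau>::real. \<tau>) \<in> borel_measurable lebesgue" by (rule measurable_completion) simp
    from measurable_compose[OF measurable_snd this]
    show "snd \<in> borel_measurable (lborel \<Otimes>\<^sub>M (lebesgue :: real measure))" .
  qed measurable
  ultimately have [measurable]: "(\<lambda>p. J (fst p / 2) (snd p)) \<in> borel_measurable (lborel \<Otimes>\<^sub>M lebesgue)"
    by (auto dest: measurable_compose)
  have [measurable]: "q \<in> borel_measurable borel" unfolding q_def by measurable
  have meas: "case_prod f \<in> borel_measurable (lborel \<Otimes>\<^sub>M lebesgue)"
  proof -
    have "(\<lambda>p. complex_of_real (q (fst p) * J (fst p / 2) (snd p)) * (g (snd p) / of_real (cosh (pi * snd p)))) \<in> borel_measurable (lborel \<Otimes>\<^sub>M lebesgue)"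
      using measurable_compose[OF measurable_snd g_meas] measurable_compose[OF measurable_snd cosh_meas] by measurable
    thus ?thesis by (simp add: f_def case_prod_unfold)
  qed
  have int_f: "integrable lebesgue (f t)" for t
    using integrable_G_integrand[OF _ g, of t] unfolding f_G[abs_def] by (cases "t > 0") auto
  let ?N = "weighted_L1_norm cosh_weight g"
  \<comment> \<open>The bound separates the variables: the weighted modulus of \<open>g\<close>
    times the integrable Stieltjes majorant in t.\<close>
  have norm_f: "norm (f t \<tau>) \<le> (norm (g \<tau>) * cosh_weight \<tau>) * (indicator {0<..} t * (sqrt pi * (1 / (2 * sqrt (t / 2))) / (t + x)))" for t \<tau>
  proof (cases "t > 0")
    case True
    have c: "norm (g \<tau>) * cosh_weight \<tau> = sqrt (cosh (pi * \<tau>)) * (norm (g \<tau>) / cosh (pi * \<tau>))"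
      by (simp add: cosh_weight_def powr_minus_divide powr_half_sqrt divide_simps)
    have "norm (f t \<tau>) = (exp (- (t / 2)) * \<bar>Re (bessel_I (\<i> * of_real \<tau>) (of_real (t / 2)))\<bar>) * (sqrt pi / (t + x) * (norm (g \<tau>) / cosh (pi * \<tau>)))"
    proof -
      have "norm (complex_of_real t + of_real x) = t + x"
        using True x by (simp del: of_real_add flip: of_real_add)
      thus ?thesis using True by (simp add: f_def q_def J_def norm_mult norm_divide add.commute)
    qed
    also have "\<dots> \<le> (sqrt (cosh (pi * \<tau>)) * (1 / (2 * sqrt (t / 2)))) * (sqrt pi / (t + x) * (norm (g \<tau>) / cosh (pi * \<tau>)))"
      using True x by (intro mult_right_mono exp_Re_bessel_I_le(2)) auto
    finally show ?thesis using True unfolding c by (simp add: mult_ac)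
  qed (simp add: f_def J_def)
  have gint: "integrable lebesgue (\<lambda>\<tau>. norm (g \<tau>) * cosh_weight \<tau>)" using g by (simp add: weighted_L1_def)
  have int: "integrable (lborel \<Otimes>\<^sub>M lebesgue) (case_prod f)"
  proof (rule Fubini_integrable[OF meas])
    show "AE t in lborel. integrable lebesgue (\<lambda>\<tau>. case (t, \<tau>) of (t, \<tau>) \<Rightarrow> f t \<tau>)"
      using int_f by simp
    show "integrable lborel (\<lambda>t. LINT \<tau>|lebesgue. norm (case (t, \<tau>) of (t, \<tau>) \<Rightarrow> f t \<tau>))"
    proof (rule Bochner_Integration.integrable_bound)
      \<comment> \<open>The majorant is needed in t / 2 with parameter x / 2. The zeros and the
        unsimplified products match the affine substitution rule literally.\<close>
      have "integrable lborel (\<lambda>t. indicator {0<..} (0 + 1 / 2 * t) * (1 / (2 * sqrt (0 + 1 / 2 * t)) / (0 + 1 / 2 * t + x / 2)))"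
        by (rule lborel_integrable_real_affine[OF integrable_stieltjes_sqrt]) (use x in auto)
      hence "integrable lborel (\<lambda>t. (?N * sqrt pi / 2) * (indicator {0<..} (0 + 1 / 2 * t) * (1 / (2 * sqrt (0 + 1 / 2 * t)) / (0 + 1 / 2 * t + x / 2))))"
        by (rule integrable_mult_right)
      also have "(\<lambda>t. (?N * sqrt pi / 2) * (indicator {0<..} (0 + 1 / 2 * t) * (1 / (2 * sqrt (0 + 1 / 2 * t)) / (0 + 1 / 2 * t + x / 2)))) =
         (\<lambda>t. ?N * (indicator {0<..} t * (sqrt pi * (1 / (2 * sqrt (t / 2))) / (t + x))))"
      proof
        fix t :: real
        have "(0 + 1 / 2 * t + x / 2) = (t + x) / 2" by simp
        thus "(?N * sqrt pi / 2) * (indicator {0<..} (0 + 1 / 2 * t) * (1 / (2 * sqrt (0 + 1 / 2 * t)) / (0 + 1 / 2 * t + x / 2))) =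
          ?N * (indicator {0<..} t * (sqrt pi * (1 / (2 * sqrt (t / 2))) / (t + x)))"
          by (simp only:) (simp add: indicator_def)
      qed
      finally show "integrable lborel (\<lambda>t. ?N * (indicator {0<..} t * (sqrt pi * (1 / (2 * sqrt (t / 2))) / (t + x))))" .
      show "(\<lambda>t. LINT \<tau>|lebesgue. norm (case (t, \<tau>) of (t, \<tau>) \<Rightarrow> f t \<tau>)) \<in> borel_measurable lborel"
        using meas by (intro L.borel_measurable_lebesgue_integral) (simp add: case_prod_unfold)
      show "AE t in lborel. norm (LINT \<tau>|lebesgue. norm (case (t, \<tau>) of (t, \<tau>) \<Rightarrow> f t \<tau>)) \<le>
         norm (?N * (indicator {0<..} t * (sqrt pi * (1 / (2 * sqrt (t / 2))) / (t + x))))"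
      proof (rule AE_I2)
        fix t
        let ?r = "indicator {0<..} t * (sqrt pi * (1 / (2 * sqrt (t / 2))) / (t + x))"
        have "(LINT \<tau>|lebesgue. norm (f t \<tau>)) \<le> (LINT \<tau>|lebesgue. (norm (g \<tau>) * cosh_weight \<tau>) * ?r)"
          using int_f[of t] gint norm_f by (intro integral_mono integrable_mult_left) auto
        also have "\<dots> = ?N * ?r" unfolding weighted_L1_norm_def by (rule integral_mult_left_zero)
        also have "\<dots> \<le> norm (?N * ?r)" by (simp only: real_norm_def abs_ge_self)
        finally show "norm (LINT \<tau>|lebesgue. norm (case (t, \<tau>) of (t, \<tau>) \<Rightarrow> f t \<tau>)) \<le> norm (?N * ?r)"
          by (simp add: integral_nonneg_AE)
      qed
    qed
  qed
  let ?K = "\<lambda>\<tau>. bessel_K (\<i> * of_real \<tau>) (of_real (x / 2)) * (g \<tau> / of_real (cosh (pi * \<tau>)))"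
  have snd_f: "(LINT t|lborel. f t \<tau>) = of_real (sqrt pi * exp (x / 2)) * ?K \<tau>" if \<tau>: "\<tau> \<noteq> 0" for \<tau>
  proof -
    have "(LINT t|lborel. f t \<tau>) = complex_of_real (LINT t|lborel. q t * J (t / 2) \<tau>) * (g \<tau> / of_real (cosh (pi * \<tau>)))"
      unfolding f_def by (simp only: integral_mult_left_zero integral_complex_of_real)
    also have "(LINT t|lborel. q t * J (t / 2) \<tau>) = \<bar>2\<bar> *\<^sub>R (LINT t|lborel. q (0 + 2 * t) * J ((0 + 2 * t) / 2) \<tau>)"
      by (rule lborel_integral_real_affine) simp
    also have "\<dots> = (LINT t|lborel. 2 * (q (0 + 2 * t) * J ((0 + 2 * t) / 2) \<tau>))" by simp
    also have "\<dots> = (LINT t|lborel. sqrt pi * (indicator {0<..} t * (exp (- t) * Re (bessel_I (\<i> * of_real \<tau>) (of_real t)) / (t + x / 2))))"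
    proof (intro Bochner_Integration.integral_cong refl)
      fix t :: real
      define d where "d = t + x / 2"
      have "x + (0 + 2 * t) = 2 * d" by (simp add: d_def)
      hence "q (0 + 2 * t) = sqrt pi * exp (- t) / (2 * d)" unfolding q_def by simp
      thus "2 * (q (0 + 2 * t) * J ((0 + 2 * t) / 2) \<tau>) = sqrt pi * (indicator {0<..} t * (exp (- t) * Re (bessel_I (\<i> * of_real \<tau>) (of_real t)) / (t + x / 2)))"
        unfolding d_def[symmetric] by (simp only:) (simp add: J_def indicator_def)
    qed
    also have "complex_of_real \<dots> = of_real (sqrt pi) * complex_of_real (LINT t|lborel. indicator {0<..} t * (exp (- t) * Re (bessel_I (\<i> * of_real \<tau>) (of_real t)) / (t + x / 2)))"
      by (simp only: integral_mult_right_zero of_real_mult)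
    also have "\<dots> = of_real (sqrt pi) * (of_real (exp (x / 2)) * bessel_K (\<i> * of_real \<tau>) (of_real (x / 2)))"
      using stieltjes_Re_bessel_I[OF \<tau>, of "x / 2"] x by simp
    finally show ?thesis by simp
  qed
  \<comment> \<open>The kernel identity was obtained for nonzero \<tau> only, so the null set {0} is
    removed.\<close>
  have "AE \<tau> in lebesgue. \<tau> \<noteq> (0::real)"
    using AE_lborel_singleton[of "0::real"] by (rule AE_completion)
  hence AE: "AE \<tau> in lebesgue. (LINT t|lborel. f t \<tau>) = of_real (sqrt pi * exp (x / 2)) * ?K \<tau>"
    by eventually_elim (rule snd_f)
  have K_meas: "?K \<in> borel_measurable lebesgue"
  proof -
    have "(\<lambda>\<tau>. bessel_K (\<i> * complex_of_real \<tau>) (complex_of_real (x / 2))) \<in> borel_measurable lebesgue"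
      using x by (intro measurable_completion) (simp only: measurable_lborel2, intro borel_measurable_bessel_K_imaginary, simp)
    thus ?thesis by measurable
  qed
  have int_snd: "integrable lebesgue (\<lambda>\<tau>. LINT t|lborel. f t \<tau>)"
    by (rule integrable_snd[OF int])
  have cK_meas: "(\<lambda>\<tau>. of_real (sqrt pi * exp (x / 2)) * ?K \<tau>) \<in> borel_measurable lebesgue"
    by (intro borel_measurable_times borel_measurable_const K_meas)
  have "integrable lebesgue (\<lambda>\<tau>. of_real (sqrt pi * exp (x / 2)) * ?K \<tau>)"
    using integrable_cong_AE[OF borel_measurable_integrable[OF int_snd] cK_meas AE] int_snd by blast
  hence "integrable lebesgue (\<lambda>\<tau>. (1 / of_real (sqrt pi * exp (x / 2))) * (of_real (sqrt pi * exp (x / 2)) * ?K \<tau>))"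
    by (rule integrable_mult_right)
  thus "integrable lebesgue ?K" by simp
  have int_fst: "integrable lborel (\<lambda>t. indicator {0<..} t *\<^sub>R (G_transform g t / of_real (x + t)))"
    using integrable_fst[OF int] unfolding fst_f .
  thus "set_integrable lebesgue {0<..} (\<lambda>t. G_transform g t / of_real (x + t))"
    unfolding set_integrable_def by (subst integrable_completion) (auto dest: borel_measurable_integrable)
  have "(LINT t:{0<..}|lebesgue. G_transform g t / of_real (x + t)) = (LINT t|lborel. indicator {0<..} t *\<^sub>R (G_transform g t / of_real (x + t)))"
    unfolding set_lebesgue_integral_def using int_fst by (intro integral_completion) (auto dest: borel_measurable_integrable)
  also have "\<dots> = (LINT t|lborel. LINT \<tau>|lebesgue. f t \<tau>)" unfolding fst_f ..
  also have "\<dots> = (LINT \<tau>|lebesgue. LINT t|lborel. f t \<tau>)" by (rule Fubini_integral[OF int, symmetric])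
  also have "\<dots> = (LINT \<tau>|lebesgue. of_real (sqrt pi * exp (x / 2)) * ?K \<tau>)"
    by (rule integral_cong_AE[OF borel_measurable_integrable[OF int_snd] cK_meas AE])
  also have "\<dots> = of_real (sqrt pi * exp (x / 2)) * (LINT \<tau>|lebesgue. ?K \<tau>)" by (rule integral_mult_right_zero)
  finally show "(LINT t:{0<..}|lebesgue. G_transform g t / of_real (x + t)) = of_real (sqrt pi * exp (x / 2)) * (LINT \<tau>|lebesgue. ?K \<tau>)" .
qed

theorem theorem3:
  shows
    "(\<forall>g \<in> weighted_L1 cosh_weight.
        (\<forall>x>0. integrable lebesgue (G_integrand g x)) \<and>
        G_transform g \<in> BC_halfline \<and>
        sup_norm_halfline (G_transform g) \<le> sqrt pi * weighted_L1_norm cosh_weight g) \<and>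
     (\<forall>g \<in> weighted_L1 cosh_weight. \<forall>h \<in> weighted_L1 cosh_weight.
        (AE \<tau> in lebesgue. g \<tau> = h \<tau>) \<longrightarrow> (\<forall>x>0. G_transform g x = G_transform h x)) \<and>
     (\<forall>g \<in> weighted_L1 cosh_weight. \<forall>h \<in> weighted_L1 cosh_weight. \<forall>a b :: complex. \<forall>x>0.
        G_transform (\<lambda>\<tau>. a * g \<tau> + b * h \<tau>) x = a * G_transform g x + b * G_transform h x) \<and>
     (\<forall>g \<in> weighted_L1 cosh_weight. \<forall>\<nu>::real.
        0 < \<nu> \<and> \<nu> < 1 / 2 \<and> G_transform g \<in> L_halfline \<nu> \<longrightarrow>
        (\<forall>x>0.
           set_integrable lebesgue {0<..} (\<lambda>t. G_transform g t / of_real (x + t)) \<and>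
           integrable lebesgue
             (\<lambda>\<tau>. bessel_K (\<i> * of_real \<tau>) (of_real (x / 2)) * (g \<tau> / of_real (cosh (pi * \<tau>)))) \<and>
           (LINT t:{0<..}|lebesgue. G_transform g t / of_real (x + t)) =
             of_real (sqrt pi * exp (x / 2)) *
             (LINT \<tau>|lebesgue.
                bessel_K (\<i> * of_real \<tau>) (of_real (x / 2)) * (g \<tau> / of_real (cosh (pi * \<tau>))))))"
proof -
  have "G_transform g \<in> BC_halfline" if "g \<in> weighted_L1 cosh_weight" for g
    using continuous_on_G_transform[OF that] norm_G_transform_le[OF _ that]
    by (auto simp: BC_halfline_def bounded_iff)
  moreover have "sup_norm_halfline (G_transform g) \<le> sqrt pi * weighted_L1_norm cosh_weight g"
    if "g \<in> weighted_L1 cosh_weight" for g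
    unfolding sup_norm_halfline_def using norm_G_transform_le[OF _ that]
    by (intro cSUP_least) auto
  ultimately have main: "\<forall>g \<in> weighted_L1 cosh_weight.
        (\<forall>x>0. integrable lebesgue (G_integrand g x)) \<and>
        G_transform g \<in> BC_halfline \<and>
        sup_norm_halfline (G_transform g) \<le> sqrt pi * weighted_L1_norm cosh_weight g"
    using integrable_G_integrand by blast
  show ?thesis
    by (intro conjI main) (use G_transform_cong_AE G_transform_linear stieltjes_G_transform in \<open>blast+\<close>)
qed

end
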